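(* Let $H$ be a quasi-Hopf $*$-algebra over $\mathbb{C}$ with $*$-canonical element $\Omega$, let $F_\delta$ be the Drinfeld twist of $H$, let $F_0=(S^{-1}\otimes S^{-1})(F_\delta^T)$ be the second Drinfeld twist, and let $w\in H$ be the canonical invertible element attached to $(H,\Omega)$ (defined in the context). Then the $*$-canonical elements $\Omega'=(F_\delta^\dagger)^{-1}\Omega F_\delta^{-1}$ and $\Omega_0=(F_0^\dagger)^{-1}\Omega F_0^{-1}$ of the quasi-Hopf $*$-algebras obtained from $H$ by twisting with $F_\delta$ and $F_0$ respectively are given by $$\Omega'=\big[S^{-1}(w^{-1})\otimes S^{-1}(w^{-1})\big]\,(S^{-1}\otimes S^{-1})\big((\Omega^T)^{-1}\big)\,F_0\,\Delta(S^{-1}(w))\,F_\delta^{-1},$$ $$\Omega_0=(w^{-1}\otimes w^{-1})\,(S\otimes S)\big((\Omega^T)^{-1}\big)\,F_\delta\,\Delta(w)\,F_0^{-1}.$$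
   Context: Base field $\mathbb{C}$; $1$ also denotes the identity map; $m$ is multiplication; $T(a\otimes b)=b\otimes a$, $X^T=T(X)$ for $X\in H\otimes H$, $\Delta^T=T\circ\Delta$. Sums over repeated indices are understood. A conjugation operation on $H$ is an antilinear map $\dagger:H\to H$ with $(a^\dagger)^\dagger=a$, $(ab)^\dagger=b^\dagger a^\dagger$, extended to tensor powers by $(a\otimes b)^\dagger=a^\dagger\otimes b^\dagger$, etc. A quasi-Hopf algebra (QHA) is a unital associative algebra $H$ with algebra homomorphisms $\varepsilon:H\to\mathbb{C}$, $\Delta:H\to H\otimes H$, an invertible $\Phi=X_\nu\otimes Y_\nu\otimes Z_\nu\in H^{\otimes3}$ (write $\Phi^{-1}=\bar X_\nu\otimes\bar Y_\nu\otimes\bar Z_\nu$), a bijective algebra anti-homomorphism $S$ and $\alpha,\beta\in H$ such that: $(\varepsilon\otimes1)\Delta=1=(1\otimes\varepsilon)\Delta$; $(1\otimes\Delta)\Delta(a)=\Phi^{-1}(\Delta\otimes1)\Delta(a)\Phi$; $(\Delta\otimes1\otimes1)\Phi\cdot(1\otimes1\otimes\Delta)\Phi=(\Phi\otimes1)\cdot(1\otimes\Delta\otimes1)\Phi\cdot(1\otimes\Phi)$; $(1\otimes\varepsilon\otimes1)\Phi=1$; $S(X_\nu)\alpha Y_\nu\beta S(Z_\nu)=1=\bar X_\nu\beta S(\bar Y_\nu)\alpha\bar Z_\nu$; $S(a_{(1)})\alpha a_{(2)}=\varepsilon(a)\alpha$, $a_{(1)}\beta S(a_{(2)})=\varepsilon(a)\beta$.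 A twist is an invertible $F\in H\otimes H$ with $(\varepsilon\otimes1)F=(1\otimes\varepsilon)F=1$. For a twist $F$: $\Delta_F(a)=F\Delta(a)F^{-1}$, $\Phi_F=(F\otimes1)(\Delta\otimes1)(F)\,\Phi\,(1\otimes\Delta)(F^{-1})(1\otimes F^{-1})$, $\alpha_F=m(1\otimes\alpha)(S\otimes1)F^{-1}$, $\beta_F=m(1\otimes\beta)(1\otimes S)F$. A quasi-Hopf $*$-algebra is a QHA with a conjugation operation $\dagger$ and a twist $\Omega$ ($*$-canonical element) such that $\varepsilon(a^\dagger)=\overline{\varepsilon(a)}$, $\Delta(a)^\dagger=\Omega\Delta(a^\dagger)\Omega^{-1}$, $(\Phi^\dagger)^{-1}=\Phi_\Omega$. (Twisting it by $F$ gives a quasi-Hopf $*$-algebra with $*$-canonical element $(F^\dagger)^{-1}\Omega F^{-1}$.) Put $\tilde S(a)=(S^{-1}(a^\dagger))^\dagger$. The element $w\in H$ is the unique invertible element with $w\,S^{-1}(\beta)^\dagger=\alpha_\Omega$, $\beta_\Omega w=S^{-1}(\alpha)^\dagger$ and $S(a)=w\tilde S(a)w^{-1}$ for all $a\in H$; explicitly $w=S(\bar X_\nu^\dagger)\alpha_\Omega\bar Y_\nu^\dagger S^{-1}(\alpha)^\dagger\tilde S(\bar Z_\nu^\dagger)$. Drinfeld twist: $F_\delta=(S\otimes S)(\Delta^T(X_\nu))\cdot\gamma\cdot\Delta(Y_\nu\beta S(Z_\nu))$ with $\gamma=S(B_i)\alpha C_i\otimes S(A_i)\alpha D_i$, where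 $A_i\otimes B_i\otimes C_i\otimes D_i=(\Phi^{-1}\otimes1)\cdot(\Delta\otimes1\otimes1)\Phi$. It is a twist (Drinfeld) satisfying $F_\delta\Delta(a)F_\delta^{-1}=(S\otimes S)\Delta^T(S^{-1}(a))$. Its inverse is $F_\delta^{-1}=\Delta(\bar X_\nu)\cdot\bar\gamma\cdot(S\otimes S)\Delta^T\big(S^{-1}(S(\bar Y_\nu)\alpha\bar Z_\nu)\big)$ with $\bar\gamma=\bar A_i\beta S(\bar D_i)\otimes\bar B_i\beta S(\bar C_i)$, $\bar A_i\otimes\bar B_i\otimes\bar C_i\otimes\bar D_i=(\Delta\otimes1\otimes1)\Phi^{-1}\cdot(\Phi\otimes1)$. *)

theory Defs
  imports Complex_Main "HOL-Library.Multiset"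
begin

section \<open>Complex vector spaces and unital associative complex algebras\<close>

class scaleC =
  fixes scaleC :: "complex \<Rightarrow> 'a \<Rightarrow> 'a" (infixr "*\<^sub>C" 75)

class complex_vector = scaleC + ab_group_add +
  assumes scaleC_add_right: "c *\<^sub>C (x + y) = c *\<^sub>C x + c *\<^sub>C y"
    and scaleC_add_left: "(c + d) *\<^sub>C x = c *\<^sub>C x + d *\<^sub>C x"
    and scaleC_scaleC: "c *\<^sub>C d *\<^sub>C x = (c * d) *\<^sub>C x"
    and scaleC_one: "1 *\<^sub>C x = x"

text \<open>The class \<open>ring_1\<close> contains \<open>0 \<noteq> 1\<close>. This excludes no quasi-Hopf algebra, since
  a counit is a unital homomorphism to the complex numbers.\<close>

class complex_algebra_1 = complex_vector + ring_1 +
  assumes mult_scaleC_left: "(c *\<^sub>C x) * y = c *\<^sub>C (x * y)"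
    and mult_scaleC_right: "x * (c *\<^sub>C y) = c *\<^sub>C (x * y)"

instantiation complex :: complex_algebra_1
begin

definition scaleC_complex :: "complex \<Rightarrow> complex \<Rightarrow> complex"
  where "scaleC_complex c x = c * x"

instance
  by standard (simp_all add: scaleC_complex_def algebra_simps)

end

lemma vector_space_scaleC:
  "vector_space (scaleC :: complex \<Rightarrow> 'a \<Rightarrow> 'a::complex_vector)"
  by unfold_locales
    (simp_all add: scaleC_add_right scaleC_add_left scaleC_scaleC scaleC_one)

lemma scaleC_zero_left [simp]: "0 *\<^sub>C (x::'a::complex_vector) = 0"
  using scaleC_add_left[of 0 0 x] by simp

lemma scaleC_zero_right [simp]: "c *\<^sub>C (0::'a::complex_vector) = 0"
  using scaleC_add_right[of c "0::'a" 0] by simp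

abbreviation clinear :: "('a::complex_vector \<Rightarrow> 'b::complex_vector) \<Rightarrow> bool"
  where "clinear \<equiv> Vector_Spaces.linear scaleC scaleC"

definition antilinear :: "('a::complex_vector \<Rightarrow> 'b::complex_vector) \<Rightarrow> bool"
  where "antilinear f \<longleftrightarrow>
    (\<forall>x y. f (x + y) = f x + f y) \<and> (\<forall>c x. f (c *\<^sub>C x) = cnj c *\<^sub>C f x)"

lemma clinear_add: "clinear f \<Longrightarrow> f (x + y) = f x + f y"
  and clinear_scaleC: "clinear f \<Longrightarrow> f (c *\<^sub>C x) = c *\<^sub>C f x"
  by (simp_all add: Vector_Spaces.linear_iff)

definition algebra_hom :: "('a::complex_algebra_1 \<Rightarrow> 'b::complex_algebra_1) \<Rightarrow> bool"
  where "algebra_hom f \<longleftrightarrow> clinear f \<and> f 1 = 1 \<and> (\<forall>x y. f (x * y) = f x * f y)"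

definition algebra_antihom :: "('a::complex_algebra_1 \<Rightarrow> 'b::complex_algebra_1) \<Rightarrow> bool"
  where "algebra_antihom f \<longleftrightarrow> clinear f \<and> f 1 = 1 \<and> (\<forall>x y. f (x * y) = f y * f x)"

definition has_inverse :: "'a::monoid_mult \<Rightarrow> bool"
  where "has_inverse x \<longleftrightarrow> (\<exists>y. x * y = 1 \<and> y * x = 1)"

definition inv_el :: "'a::monoid_mult \<Rightarrow> 'a"
  where "inv_el x = (THE y. x * y = 1 \<and> y * x = 1)"

lemma inv_el_eqI:
  fixes x y :: "'a::monoid_mult"
  assumes "x * y = 1" "y * x = 1"
  shows "inv_el x = y"
  unfolding inv_el_def
proof (rule the_equality)
  fix z assume z: "x * z = 1 \<and> z * x = 1"
  have "z = (y * x) * z" using assms by simp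
  also have "\<dots> = y" using z by (simp add: mult.assoc)
  finally show "z = y" .
qed (use assms in simp)


section \<open>The tensor product of two complex vector spaces\<close>

text \<open>A tensor is a formal sum of pairs (a multiset) modulo the tensor relations. Scalars enter
  only through the relation \<open>(c a, b) \<sim> (a, c b)\<close>; therefore biadditive maps that are antilinear
  in both arguments descend to the tensor product just as bilinear maps do.\<close>

inductive tensor_eq ::
  "('a::complex_vector \<times> 'b::complex_vector) multiset \<Rightarrow> ('a \<times> 'b) multiset \<Rightarrow> bool"
where
  refl: "tensor_eq X X"
| sym: "tensor_eq X Y \<Longrightarrow> tensor_eq Y X"
| trans: "tensor_eq X Y \<Longrightarrow> tensor_eq Y Z \<Longrightarrow> tensor_eq X Z"
| plus: "tensor_eq X Y \<Longrightarrow> tensor_eq (X + Z) (Y + Z)"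
| zero: "tensor_eq {#(0, b)#} {#}"
| add_left: "tensor_eq {#(a + a', b)#} {#(a, b), (a', b)#}"
| add_right: "tensor_eq {#(a, b + b')#} {#(a, b), (a, b')#}"
| balance: "tensor_eq {#(c *\<^sub>C a, b)#} {#(a, c *\<^sub>C b)#}"

lemma equivp_tensor_eq: "equivp tensor_eq"
  by (intro equivpI reflpI sympI transpI) (auto intro: tensor_eq.intros)

quotient_type (overloaded) ('a, 'b) tensor (infixr "\<otimes>" 71) =
  "('a::complex_vector \<times> 'b::complex_vector) multiset" / tensor_eq
  by (rule equivp_tensor_eq)

lift_definition pure :: "'a::complex_vector \<Rightarrow> 'b::complex_vector \<Rightarrow> 'a \<otimes> 'b" (infixr "\<otimes>" 71)
  is "\<lambda>a b. {#(a, b)#}" .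

lemma tensor_eq_plus2:
  assumes "tensor_eq X Y" "tensor_eq X' Y'"
  shows "tensor_eq (X + X') (Y + Y')"
proof -
  have "tensor_eq (X + X') (Y + X')" using assms(1) by (rule tensor_eq.plus)
  moreover have "tensor_eq (X' + Y) (Y' + Y)" using assms(2) by (rule tensor_eq.plus)
  ultimately show ?thesis by (metis add.commute tensor_eq.trans)
qed

lemma tensor_eq_map_left:
  fixes f :: "'a::complex_vector \<Rightarrow> 'a"
  assumes "clinear f" "tensor_eq X Y"
  shows "tensor_eq {#(f a, b). (a, b) \<in># X#} {#(f a, b). (a, b) \<in># Y#}"
  using assms(2)
proof (induction rule: tensor_eq.induct)
  case (zero b)
  have "f 0 = 0" using clinear_scaleC[OF assms(1), of 0 0] by simp
  then show ?case by (simp add: tensor_eq.zero)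
next
  case (plus X Y Z)
  then show ?case by (simp add: tensor_eq.plus)
qed (auto simp: clinear_add[OF assms(1)] clinear_scaleC[OF assms(1)] intro: tensor_eq.intros)

lemma clinear_scaleC_const: "clinear (\<lambda>x::'a::complex_vector. c *\<^sub>C x)"
  by (simp add: Vector_Spaces.linear_iff vector_space_scaleC scaleC_add_right scaleC_scaleC
      mult.commute)

instantiation tensor :: (complex_vector, complex_vector) complex_vector
begin

lift_definition zero_tensor :: "'a \<otimes> 'b" is "{#}" .

lift_definition plus_tensor :: "'a \<otimes> 'b \<Rightarrow> 'a \<otimes> 'b \<Rightarrow> 'a \<otimes> 'b" is "(+)"
  by (rule tensor_eq_plus2)

lift_definition scaleC_tensor :: "complex \<Rightarrow> 'a \<otimes> 'b \<Rightarrow> 'a \<otimes> 'b"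
  is "\<lambda>c X. {#(c *\<^sub>C a, b). (a, b) \<in># X#}"
  by (rule tensor_eq_map_left[OF clinear_scaleC_const])

definition uminus_tensor :: "'a \<otimes> 'b \<Rightarrow> 'a \<otimes> 'b"
  where "uminus_tensor x = (- 1) *\<^sub>C x"

definition minus_tensor :: "'a \<otimes> 'b \<Rightarrow> 'a \<otimes> 'b \<Rightarrow> 'a \<otimes> 'b"
  where "minus_tensor x y = x + - y"

instance
proof
  fix x y z :: "'a \<otimes> 'b" and c d :: complex
  show "x + y + z = x + (y + z)" by transfer (simp add: add.assoc tensor_eq.refl)
  show "x + y = y + x" by transfer (simp add: add.commute tensor_eq.refl)
  show z: "0 + x = x" by transfer (simp add: tensor_eq.refl)
  show "c *\<^sub>C (x + y) = c *\<^sub>C x + c *\<^sub>C y" by transfer (simp add: tensor_eq.refl)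
  show "c *\<^sub>C d *\<^sub>C x = (c * d) *\<^sub>C x"
    by transfer
      (simp add: multiset.map_comp comp_def case_prod_unfold scaleC_scaleC tensor_eq.refl)
  show one: "1 *\<^sub>C x = x" by transfer (simp add: scaleC_one tensor_eq.refl)
  have add: "tensor_eq {#((c + d) *\<^sub>C a, b). (a, b) \<in># X#}
     ({#(c *\<^sub>C a, b). (a, b) \<in># X#} + {#(d *\<^sub>C a, b). (a, b) \<in># X#})"
    for c d :: complex and X :: "('a \<times> 'b) multiset"
  proof (induction X)
    case (add p X)
    obtain a b where p: "p = (a, b)" by (cases p)
    have "tensor_eq {#((c + d) *\<^sub>C a, b)#} {#(c *\<^sub>C a, b), (d *\<^sub>C a, b)#}"
      by (simp add: scaleC_add_left tensor_eq.add_left)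
    from tensor_eq_plus2[OF this add.IH] show ?case by (simp add: p add_mset_commute)
  qed (simp add: tensor_eq.refl)
  show add': "(c + d) *\<^sub>C x = c *\<^sub>C x + d *\<^sub>C x" for c d by transfer (rule add)
  have "tensor_eq {#(0 *\<^sub>C a, b). (a, b) \<in># X#} {#}" for X :: "('a \<times> 'b) multiset"
  proof (induction X)
    case (add p X)
    obtain a b where p: "p = (a, b)" by (cases p)
    from tensor_eq_plus2[OF tensor_eq.zero[of b] add.IH] show ?case by (simp add: p)
  qed (simp add: tensor_eq.refl)
  then have "0 *\<^sub>C x = 0" by transfer
  with add'[of "- 1" 1] one show "- x + x = 0" by (simp add: uminus_tensor_def)
  show "x - y = x + - y" by (simp add: minus_tensor_def)
qed

end

lemma pure_add_left: "(a + a') \<otimes> b = a \<otimes> b + a' \<otimes> b"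
  by transfer (simp, subst add_mset_commute, rule tensor_eq.add_left)

lemma pure_add_right: "a \<otimes> (b + b') = a \<otimes> b + a \<otimes> b'"
  by transfer (simp, subst add_mset_commute, rule tensor_eq.add_right)

lemma pure_scaleC_left: "(c *\<^sub>C a) \<otimes> b = c *\<^sub>C (a \<otimes> b)"
  by transfer (simp add: tensor_eq.refl)

lemma pure_scaleC_right: "a \<otimes> (c *\<^sub>C b) = c *\<^sub>C (a \<otimes> b)"
  by transfer (simp add: tensor_eq.balance tensor_eq.sym)

lemma tensor_induct [case_names zero pure_add, induct type: tensor]:
  fixes P :: "'a::complex_vector \<otimes> 'b::complex_vector \<Rightarrow> bool"
  assumes "P 0" and "\<And>a b x. P x \<Longrightarrow> P (a \<otimes> b + x)"
  shows "P x"
proof -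
  have "P (abs_tensor X)" for X
  proof (induction X)
    case empty
    then show ?case using assms(1) by (simp add: zero_tensor_def)
  next
    case (add p X)
    obtain a b where "p = (a, b)" by (cases p)
    then have "abs_tensor (add_mset p X) = a \<otimes> b + abs_tensor X"
      by (simp add: pure.abs_eq plus_tensor.abs_eq)
    with add assms(2) show ?case by simp
  qed
  then show ?thesis by (metis Quotient_rep_abs Quotient3_abs_rep Quotient3_tensor)
qed

subsection \<open>Maps out of a tensor product\<close>

definition balanced ::
  "('a::complex_vector \<Rightarrow> 'b::complex_vector \<Rightarrow> 'c::ab_group_add) \<Rightarrow> bool"
  where "balanced h \<longleftrightarrow>
    (\<forall>a a' b. h (a + a') b = h a b + h a' b) \<and>
    (\<forall>a b b'. h a (b + b') = h a b + h a b') \<and>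
    (\<forall>c a b. h (c *\<^sub>C a) b = h a (c *\<^sub>C b))"

lemma balanced_zero_left: "balanced h \<Longrightarrow> h 0 b = 0"
  unfolding balanced_def by (metis add_cancel_left_left)

lemma balanced_sum_mset:
  assumes "balanced h" "tensor_eq X Y"
  shows "(\<Sum>(a, b)\<in>#X. h a b) = (\<Sum>(a, b)\<in>#Y. h a b)"
  using assms(2)
  by induction (use assms(1) balanced_zero_left[OF assms(1)] in \<open>simp_all add: balanced_def\<close>)

text \<open>\<open>tensor_lift h\<close> is the additive map with \<open>a \<otimes> b \<mapsto> h a b\<close>; the value \<open>0\<close> is a dummy for
  those \<open>h\<close> that do not descend to the tensor product.\<close>

lift_definition tensor_lift ::
  "('a::complex_vector \<Rightarrow> 'b::complex_vector \<Rightarrow> 'c::ab_group_add) \<Rightarrow> 'a \<otimes> 'b \<Rightarrow> 'c"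
  is "\<lambda>h X. if balanced h then \<Sum>(a, b)\<in>#X. h a b else 0"
  by (simp add: balanced_sum_mset)

lemma tensor_lift_pure: "balanced h \<Longrightarrow> tensor_lift h (a \<otimes> b) = h a b"
  by transfer simp

lemma tensor_lift_add: "tensor_lift h (x + y) = tensor_lift h x + tensor_lift h y"
  by transfer simp

lemma tensor_lift_0: "tensor_lift h 0 = 0"
  by transfer simp

lemma tensor_lift_scaleC:
  fixes h :: "'a::complex_vector \<Rightarrow> 'b::complex_vector \<Rightarrow> 'c::complex_vector"
  assumes "balanced h" "\<And>c a b. h (c *\<^sub>C a) b = c *\<^sub>C h a b"
  shows "tensor_lift h (c *\<^sub>C x) = c *\<^sub>C tensor_lift h x"
  by (induction x)
    (simp_all add: tensor_lift_0 tensor_lift_add scaleC_add_right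
      flip: pure_scaleC_left, simp_all add: assms tensor_lift_pure)

lemma additive_eq_on_tensors:
  fixes f g :: "'a::complex_vector \<otimes> 'b::complex_vector \<Rightarrow> 'c::ab_group_add"
  assumes "\<And>x y. f (x + y) = f x + f y" "\<And>x y. g (x + y) = g x + g y"
    and "\<And>a b. f (a \<otimes> b) = g (a \<otimes> b)"
  shows "f x = g x"
proof (induction x)
  case zero
  show ?case using assms(1)[of 0 0] assms(2)[of 0 0] by simp
qed (simp add: assms)

definition tensor_map ::
  "('a::complex_vector \<Rightarrow> 'c::complex_vector) \<Rightarrow> ('b::complex_vector \<Rightarrow> 'd::complex_vector)
    \<Rightarrow> 'a \<otimes> 'b \<Rightarrow> 'c \<otimes> 'd"
  where "tensor_map f g = tensor_lift (\<lambda>a b. f a \<otimes> g b)"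

lemma tensor_map_pure_linear:
  assumes "clinear f" "clinear g"
  shows "tensor_map f g (a \<otimes> b) = f a \<otimes> g b"
  unfolding tensor_map_def
  by (rule tensor_lift_pure)
    (simp add: balanced_def assms[THEN clinear_add] assms[THEN clinear_scaleC]
      pure_add_left pure_add_right pure_scaleC_left pure_scaleC_right)

lemma tensor_map_pure_antilinear:
  assumes "antilinear f" "antilinear g"
  shows "tensor_map f g (a \<otimes> b) = f a \<otimes> g b"
  unfolding tensor_map_def
  by (rule tensor_lift_pure)
    (use assms in \<open>simp add: balanced_def antilinear_def
      pure_add_left pure_add_right pure_scaleC_left pure_scaleC_right\<close>)

definition flip :: "'a::complex_vector \<otimes> 'b::complex_vector \<Rightarrow> 'b \<otimes> 'a"
  where "flip = tensor_lift (\<lambda>a b. b \<otimes> a)"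

text \<open>Tensor powers are nested to the right; \<open>reassoc\<close> is \<open>(a \<otimes> b) \<otimes> c \<mapsto> a \<otimes> (b \<otimes> c)\<close>.\<close>

definition reassoc ::
  "('a::complex_vector \<otimes> 'b::complex_vector) \<otimes> 'c::complex_vector \<Rightarrow> 'a \<otimes> 'b \<otimes> 'c"
  where "reassoc = tensor_lift (\<lambda>t c. tensor_lift (\<lambda>a b. a \<otimes> b \<otimes> c) t)"

definition tensor_lift3 ::
  "('a::complex_vector \<Rightarrow> 'b::complex_vector \<Rightarrow> 'c::complex_vector \<Rightarrow> 'd::ab_group_add)
    \<Rightarrow> 'a \<otimes> 'b \<otimes> 'c \<Rightarrow> 'd"
  where "tensor_lift3 h = tensor_lift (\<lambda>a. tensor_lift (h a))"

definition tensor_lift4 ::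
  "('a::complex_vector \<Rightarrow> 'b::complex_vector \<Rightarrow> 'c::complex_vector \<Rightarrow> 'd::complex_vector
    \<Rightarrow> 'e::ab_group_add) \<Rightarrow> 'a \<otimes> 'b \<otimes> 'c \<otimes> 'd \<Rightarrow> 'e"
  where "tensor_lift4 h = tensor_lift (\<lambda>a. tensor_lift3 (h a))"

subsection \<open>The tensor product of two algebras\<close>

lemma balanced_mult_inner:
  "balanced (\<lambda>c d. (a * c) \<otimes> (b * d))"
  for a :: "'a::complex_algebra_1" and b :: "'b::complex_algebra_1"
  by (simp add: balanced_def distrib_left pure_add_left pure_add_right mult_scaleC_right
      pure_scaleC_left pure_scaleC_right)

lemma balanced_mult_outer:
  "balanced (\<lambda>a b. tensor_lift (\<lambda>c d. (a * c) \<otimes> (b * d)) y)"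
  for y :: "'a::complex_algebra_1 \<otimes> 'b::complex_algebra_1"
  by (induction y)
    (auto simp: balanced_def tensor_lift_0 tensor_lift_add tensor_lift_pure[OF balanced_mult_inner]
      distrib_right pure_add_left pure_add_right mult_scaleC_left pure_scaleC_left
      pure_scaleC_right algebra_simps)

instantiation tensor :: (complex_algebra_1, complex_algebra_1) complex_algebra_1
begin

definition one_tensor :: "'a \<otimes> 'b"
  where "one_tensor = 1 \<otimes> 1"

definition times_tensor :: "'a \<otimes> 'b \<Rightarrow> 'a \<otimes> 'b \<Rightarrow> 'a \<otimes> 'b"
  where "times_tensor x y = tensor_lift (\<lambda>a b. tensor_lift (\<lambda>c d. (a * c) \<otimes> (b * d)) y) x"

instance
proof
  have pp: "(a \<otimes> b) * (c \<otimes> d) = (a * c) \<otimes> (b * d)" for a c :: 'a and b d :: 'b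
    unfolding times_tensor_def
    by (subst tensor_lift_pure[OF balanced_mult_outer])
      (rule tensor_lift_pure[OF balanced_mult_inner])
  have dl: "(x + y) * z = x * z + y * z" for x y z :: "'a \<otimes> 'b"
    by (simp add: times_tensor_def tensor_lift_add)
  have dr1: "(a \<otimes> b) * (y + z) = (a \<otimes> b) * y + (a \<otimes> b) * z" for a b and y z :: "'a \<otimes> 'b"
    unfolding times_tensor_def
    by (subst (1 2 3) tensor_lift_pure[OF balanced_mult_outer]) (rule tensor_lift_add)
  have zl: "0 * y = 0" for y :: "'a \<otimes> 'b" by (simp add: times_tensor_def tensor_lift_0)
  have dr: "x * (y + z) = x * y + x * z" for x y z :: "'a \<otimes> 'b"
    by (induction x) (simp_all add: zl dl dr1 algebra_simps)
  have zr: "x * 0 = 0" for x :: "'a \<otimes> 'b" using dr[of x 0 0] by simp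
  fix x y z :: "'a \<otimes> 'b" and k :: complex
  show "(x + y) * z = x * z + y * z" by (rule dl)
  show "x * (y + z) = x * y + x * z" by (rule dr)
  show "x * y * z = x * (y * z)"
  proof (induction x)
    case (pure_add a b x)
    have "(a \<otimes> b) * y * z = (a \<otimes> b) * (y * z)"
    proof (induction y)
      case (pure_add c d y)
      have "(a \<otimes> b) * (c \<otimes> d) * z = (a \<otimes> b) * ((c \<otimes> d) * z)"
        by (induction z) (simp_all add: zr dr pp mult.assoc)
      with pure_add show ?case by (simp add: dl dr)
    qed (simp add: zl zr)
    with pure_add show ?case by (simp add: dl)
  qed (simp add: zl)
  show "1 * x = x" by (induction x) (simp_all add: one_tensor_def zr dr pp)
  show "x * 1 = x" by (induction x) (simp_all add: one_tensor_def zl dl pp)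
  show "(k *\<^sub>C x) * y = k *\<^sub>C (x * y)"
  proof (induction x)
    case (pure_add a b x)
    have "(k *\<^sub>C (a \<otimes> b)) * y = k *\<^sub>C ((a \<otimes> b) * y)"
      by (induction y)
        (simp_all add: zr dr pp scaleC_add_right mult_scaleC_left flip: pure_scaleC_left)
    with pure_add show ?case by (simp add: dl scaleC_add_right)
  qed (simp add: zl)
  show "x * (k *\<^sub>C y) = k *\<^sub>C (x * y)"
  proof (induction x)
    case (pure_add a b x)
    have "(a \<otimes> b) * (k *\<^sub>C y) = k *\<^sub>C ((a \<otimes> b) * y)"
      by (induction y)
        (simp_all add: zr dr pp scaleC_add_right mult_scaleC_right flip: pure_scaleC_left)
    with pure_add show ?case by (simp add: dl scaleC_add_right)
  qed (simp add: zl)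
  show "(0::'a \<otimes> 'b) \<noteq> 1"
  proof
    assume eq: "(0::'a \<otimes> 'b) = 1"
    have ex: "\<exists>f::'c \<Rightarrow> complex. clinear f \<and> f 1 = 1"
      if "(1::'c::complex_algebra_1) \<noteq> 0" for dummy :: "'c::complex_algebra_1"
    proof -
      interpret vector_space_pair "scaleC :: complex \<Rightarrow> 'c \<Rightarrow> 'c"
        "scaleC :: complex \<Rightarrow> complex \<Rightarrow> complex"
        by (intro vector_space_pair.intro vector_space_scaleC)
      have "vs1.independent {1::'c}"
        using that by (simp add: vs1.dependent_single)
      from linear_independent_extend[OF this, of "\<lambda>_. 1"] show ?thesis by auto
    qed
    obtain f :: "'a \<Rightarrow> complex" where f: "clinear f" "f 1 = 1" using ex by auto
    obtain g :: "'b \<Rightarrow> complex" where g: "clinear g" "g 1 = 1" using ex by auto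
    have "balanced (\<lambda>a b. f a * g b)"
      by (simp add: balanced_def clinear_add[OF f(1)] clinear_add[OF g(1)]
          clinear_scaleC[OF f(1)] clinear_scaleC[OF g(1)] scaleC_complex_def algebra_simps)
    from tensor_lift_pure[OF this, of 1 1] have "tensor_lift (\<lambda>a b. f a * g b) 1 = 1"
      by (simp add: one_tensor_def f g)
    moreover have "tensor_lift (\<lambda>a b. f a * g b) 0 = 0" by (rule tensor_lift_0)
    ultimately show False using eq by simp
  qed
qed

end

lemma pure_mult_pure: "(a \<otimes> b) * (c \<otimes> d) = (a * c) \<otimes> (b * d)"
  for a c :: "'a::complex_algebra_1" and b d :: "'b::complex_algebra_1"
  unfolding times_tensor_def
    by (subst tensor_lift_pure[OF balanced_mult_outer])
      (rule tensor_lift_pure[OF balanced_mult_inner])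


section \<open>Quasi-Hopf algebras\<close>

record (overloaded) 'h qha =
  counit :: "'h \<Rightarrow> complex"
  comult :: "'h \<Rightarrow> 'h \<otimes> 'h"
  coassociator :: "'h \<otimes> 'h \<otimes> 'h"
  antipode :: "'h \<Rightarrow> 'h"
  alpha :: 'h
  beta :: 'h

text \<open>\<open>comult_fst\<close> and \<open>counit_fst\<close> are \<open>\<Delta> \<otimes> 1\<close> and \<open>\<epsilon> \<otimes> 1\<close>; with \<open>'b\<close> itself a tensor power 
  \<open>comult_fst\<close> also gives \<open>\<Delta> \<otimes> 1 \<otimes> 1\<close> on \<open>H \<otimes> H \<otimes> H\<close>.\<close>

definition comult_fst ::
  "('h::complex_algebra_1, 'z) qha_scheme \<Rightarrow> 'h \<otimes> 'b::complex_vector \<Rightarrow> 'h \<otimes> 'h \<otimes> 'b"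
  where "comult_fst H x = reassoc (tensor_map (comult H) id x)"

definition counit_fst ::
  "('h::complex_algebra_1, 'z) qha_scheme \<Rightarrow> 'h \<otimes> 'b::complex_vector \<Rightarrow> 'b"
  where "counit_fst H = tensor_lift (\<lambda>a b. counit H a *\<^sub>C b)"

definition counit_snd ::
  "('h::complex_algebra_1, 'z) qha_scheme \<Rightarrow> 'b::complex_vector \<otimes> 'h \<Rightarrow> 'b"
  where "counit_snd H = tensor_lift (\<lambda>b a. counit H a *\<^sub>C b)"

definition tensor3_one :: "'h \<otimes> 'h \<otimes> 'h \<Rightarrow> 'h \<otimes> 'h \<otimes> 'h \<otimes> ('h::complex_algebra_1)"
  where "tensor3_one X = tensor_map id reassoc (reassoc (X \<otimes> 1))"

locale quasi_hopf_algebra =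
  fixes H :: "('h::complex_algebra_1, 'z) qha_scheme"
  assumes counit_hom: "algebra_hom (counit H)"
    and comult_hom: "algebra_hom (comult H)"
    and coassociator_inv: "has_inverse (coassociator H)"
    and antipode_bij: "bij (antipode H)"
    and antipode_antihom: "algebra_antihom (antipode H)"
    and counit_left: "counit_fst H (comult H a) = a"
    and counit_right: "counit_snd H (comult H a) = a"
    and quasi_coassoc: "tensor_map id (comult H) (comult H a) =
      inv_el (coassociator H) * comult_fst H (comult H a) * coassociator H"
    and pentagon:
      "comult_fst H (coassociator H) * tensor_map id (tensor_map id (comult H)) (coassociator H) =
       tensor3_one (coassociator H) * tensor_map id (comult_fst H) (coassociator H)
         * (1 \<otimes> coassociator H)"
    and counit_coassociator: "tensor_map id (counit_fst H) (coassociator H) = 1"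
    and antipode_coassociator:
      "tensor_lift3 (\<lambda>x y z. antipode H x * alpha H * y * beta H * antipode H z)
        (coassociator H) = 1"
    and antipode_coassociator_inv:
      "tensor_lift3 (\<lambda>x y z. x * beta H * antipode H y * alpha H * z)
        (inv_el (coassociator H)) = 1"
    and antipode_alpha:
      "tensor_lift (\<lambda>x y. antipode H x * alpha H * y) (comult H a) = counit H a *\<^sub>C alpha H"
    and antipode_beta:
      "tensor_lift (\<lambda>x y. x * beta H * antipode H y) (comult H a) = counit H a *\<^sub>C beta H"

definition is_twist :: "('h::complex_algebra_1, 'z) qha_scheme \<Rightarrow> 'h \<otimes> 'h \<Rightarrow> bool"
  where "is_twist H F \<longleftrightarrow> has_inverse F \<and> counit_fst H F = 1 \<and> counit_snd H F = 1"

definition twist_coassociator ::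
  "('h::complex_algebra_1, 'z) qha_scheme \<Rightarrow> 'h \<otimes> 'h \<Rightarrow> 'h \<otimes> 'h \<otimes> 'h"
  where "twist_coassociator H F =
    reassoc (F \<otimes> 1) * comult_fst H F * coassociator H
      * tensor_map id (comult H) (inv_el F) * (1 \<otimes> inv_el F)"

definition twist_alpha :: "('h::complex_algebra_1, 'z) qha_scheme \<Rightarrow> 'h \<otimes> 'h \<Rightarrow> 'h"
  where "twist_alpha H F = tensor_lift (\<lambda>x y. antipode H x * alpha H * y) (inv_el F)"

definition twist_beta :: "('h::complex_algebra_1, 'z) qha_scheme \<Rightarrow> 'h \<otimes> 'h \<Rightarrow> 'h"
  where "twist_beta H F = tensor_lift (\<lambda>x y. x * beta H * antipode H y) F"

definition twist_qha ::
  "'h \<otimes> 'h \<Rightarrow> ('h::complex_algebra_1, 'z) qha_scheme \<Rightarrow> ('h, 'z) qha_scheme"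
  where "twist_qha F H = H
    \<lparr> comult := (\<lambda>a. F * comult H a * inv_el F),
      coassociator := twist_coassociator H F,
      alpha := twist_alpha H F,
      beta := twist_beta H F \<rparr>"

subsection \<open>The Drinfeld twists\<close>

definition drinfeld_gamma :: "('h::complex_algebra_1, 'z) qha_scheme \<Rightarrow> 'h \<otimes> 'h"
  where "drinfeld_gamma H =
    tensor_lift4 (\<lambda>a b c d. (antipode H b * alpha H * c) \<otimes> (antipode H a * alpha H * d))
      (tensor3_one (inv_el (coassociator H)) * comult_fst H (coassociator H))"

definition drinfeld_twist :: "('h::complex_algebra_1, 'z) qha_scheme \<Rightarrow> 'h \<otimes> 'h"
  where "drinfeld_twist H =
    tensor_lift3 (\<lambda>x y z.
        tensor_map (antipode H) (antipode H) (flip (comult H x)) * drinfeld_gamma H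
          * comult H (y * beta H * antipode H z))
      (coassociator H)"

definition drinfeld_twist2 :: "('h::complex_algebra_1, 'z) qha_scheme \<Rightarrow> 'h \<otimes> 'h"
  where "drinfeld_twist2 H =
    tensor_map (inv (antipode H)) (inv (antipode H)) (flip (drinfeld_twist H))"


section \<open>Quasi-Hopf star-algebras\<close>

record (overloaded) 'h qhsa = "'h qha" +
  conj_op :: "'h \<Rightarrow> 'h"
  star_can :: "'h \<otimes> 'h"

definition conj2 :: "('h::complex_algebra_1, 'z) qhsa_scheme \<Rightarrow> 'h \<otimes> 'h \<Rightarrow> 'h \<otimes> 'h"
  where "conj2 H = tensor_map (conj_op H) (conj_op H)"

definition conj3 :: "('h::complex_algebra_1, 'z) qhsa_scheme \<Rightarrow> 'h \<otimes> 'h \<otimes> 'h \<Rightarrow> 'h \<otimes> 'h \<otimes> 'h"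
  where "conj3 H = tensor_map (conj_op H) (conj2 H)"

definition conjugation :: "('h::complex_algebra_1 \<Rightarrow> 'h) \<Rightarrow> bool"
  where "conjugation d \<longleftrightarrow>
    antilinear d \<and> (\<forall>a. d (d a) = a) \<and> (\<forall>a b. d (a * b) = d b * d a)"

locale quasi_hopf_star_algebra = quasi_hopf_algebra H
  for H :: "('h::complex_algebra_1, 'z) qhsa_scheme" +
  assumes conj_op: "conjugation (conj_op H)"
    and star_can_twist: "is_twist H (star_can H)"
    and counit_conj: "counit H (conj_op H a) = cnj (counit H a)"
    and comult_conj:
      "conj2 H (comult H a) = star_can H * comult H (conj_op H a) * inv_el (star_can H)"
    and coassociator_conj:
      "inv_el (conj3 H (coassociator H)) = twist_coassociator H (star_can H)"

definition twist_qhsa ::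
  "'h \<otimes> 'h \<Rightarrow> ('h::complex_algebra_1, 'z) qhsa_scheme \<Rightarrow> ('h, 'z) qhsa_scheme"
  where "twist_qhsa F H =
    (twist_qha F H) \<lparr> star_can := inv_el (conj2 H F) * star_can H * inv_el F \<rparr>"

definition conj_antipode :: "('h::complex_algebra_1, 'z) qhsa_scheme \<Rightarrow> 'h \<Rightarrow> 'h"
  where "conj_antipode H a = conj_op H (inv (antipode H) (conj_op H a))"

definition canonical_w :: "('h::complex_algebra_1, 'z) qhsa_scheme \<Rightarrow> 'h"
  where "canonical_w H = (THE w.
    has_inverse w \<and>
    w * conj_op H (inv (antipode H) (beta H)) = twist_alpha H (star_can H) \<and>
    twist_beta H (star_can H) * w = conj_op H (inv (antipode H) (alpha H)) \<and>
    (\<forall>a. antipode H a = w * conj_antipode H a * inv_el w))"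

end

theory Submission
  imports Defs
begin

text \<open>The proof rests on the uniqueness of antipodes, in a relative form. Let \<open>\<rho> : H \<rightarrow> B\<close> be an algebra
homomorphism, and let \<open>(\<sigma>, a, b)\<close> satisfy the axioms of \<open>(S, \<alpha>, \<beta>)\<close> with \<open>\<rho>\<close> in the place of the
identity map (\<open>antipode_along\<close>). In the language of representations \<open>\<sigma>\<close> is a dual of \<open>\<rho>\<close>, with
evaluation \<open>a\<close> and coevaluation \<open>b\<close>, so two such triples differ by a unique invertible element:
\<open>u = \<sigma>1(X) a1 \<rho>(Y) b2 \<sigma>2(Z)\<close> satisfies \<open>\<sigma>1 u = u \<sigma>2\<close>, \<open>u a2 = a1\<close> and \<open>b1 u = b2\<close>, and the first two
of these properties determine \<open>u\<close> (the lemmas \<open>comparison_intertwines\<close>, \<open>comparison_alpha\<close>,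
\<open>comparison_beta\<close>, \<open>comparison_unique\<close>).

For \<open>\<rho> = \<Delta>\<close> there are two such triples: the image \<open>(\<Delta> S, \<Delta>(\<alpha>), \<Delta>(\<beta>))\<close> of the antipode, and
\<open>((S \<otimes> S) \<Delta>\<^sup>T, \<gamma>, \<gamma>')\<close>, the dual of a tensor product in reversed order. Their comparison element is the
Drinfeld twist \<open>F\<close>, which gives its invertibility and \<open>F \<Delta>(S a) = (S \<otimes> S)(\<Delta>\<^sup>T a) F\<close>,
\<open>F \<Delta>(\<alpha>) = \<gamma>\<close>, \<open>\<gamma>' F = \<Delta>(\<beta>)\<close> (\<open>drinfeld_twist_properties\<close>). The substantial point is that the
second triple satisfies the two axioms that involve \<open>\<Phi>\<close> (\<open>drinfeld_zigzag_right\<close>,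
\<open>drinfeld_zigzag_left\<close>). For \<open>\<rho> = 1\<close>, the antipode is compared with the conjugate antipode
\<open>St = \<dagger> S\<^sup>-\<^sup>1 \<dagger>\<close>; undoing the twist by \<open>\<Omega>\<close> in its canonical elements turns it into an antipode along
the identity of \<open>H\<close> itself, and the comparison element is \<open>w\<close> (\<open>canonical_w_properties\<close>).

The formula for the twist by \<open>F\<^sub>0\<close> says that \<open>E = (w \<otimes> w) (F\<^sub>0\<^sup>\<dagger>)\<^sup>-\<^sup>1 \<Omega> \<Delta>(w\<^sup>-\<^sup>1)\<close> equals
\<open>E' = (S \<otimes> S)((\<Omega>\<^sup>T)\<^sup>-\<^sup>1) F\<close>. Both elements intertwine \<open>\<Delta> S\<close> with \<open>(S \<otimes> S)\<close> applied to the flip of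
\<open>\<Omega> \<Delta> \<Omega>\<^sup>-\<^sup>1\<close>, and they agree on \<open>\<Delta>(\<alpha>\<^sub>\<Omega>)\<close>: there both are the element \<open>\<gamma>\<close> of the twisted algebra
times \<open>\<Omega>\<close>. Hence \<open>(S \<otimes> S)(\<Omega>\<^sup>T) E\<close> has the two properties that determine \<open>F\<close>
(\<open>star_can_drinfeld_twist2\<close>). Applying \<open>S\<^sup>-\<^sup>1 \<otimes> S\<^sup>-\<^sup>1\<close> and the flip to this formula gives the one for
the twist by \<open>F\<close> (\<open>star_can_drinfeld_twist\<close>).

The computations in tensor powers are organised as words. For homomorphisms \<open>f\<close>, \<open>g\<close>, \<open>h\<close> from \<open>H\<close> with
commuting images (the legs of a tensor power, and their convolutions), \<open>Phi f g h\<close> is the associator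
placed on these legs; quasi-coassociativity and the pentagon become relations between such words.
A multilinear map \<open>\<tau>\<close> then closes up the legs with \<open>S\<close>, \<open>\<alpha>\<close> and \<open>\<beta>\<close>, and the invariance of \<open>\<alpha>\<close> and
\<open>\<beta>\<close> says that under \<open>\<tau>\<close> certain coproduct legs may be replaced by the counit at the left or right end of
a word.\<close>

section \<open>Linear maps out of tensor products\<close>

text \<open>The rules \<open>lin\<close> derive from the syntax of a term that it is linear in a variable, so that an identity
between tensors has to be checked on pure tensors only; the rules \<open>legs\<close> derive in the same way that maps
assembled from commuting homomorphisms are homomorphisms and commute.\<close>

named_theorems lin
named_theorems legs

lemma clinearI:
  assumes "\<And>x y. f (x + y) = f x + f y" "\<And>c x. f (c *\<^sub>C x) = c *\<^sub>C f x"
  shows "clinear f"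
  using assms by (simp add: Vector_Spaces.linear_iff vector_space_scaleC)

lemma clinear_ident [lin]: "clinear (\<lambda>x::'a::complex_vector. x)"
  by (rule clinearI) simp_all

lemma clinear_compose:
  assumes "clinear f" "clinear g"
  shows "clinear (\<lambda>x. f (g x))"
  by (rule clinearI) (simp_all add: assms[THEN clinear_add] assms[THEN clinear_scaleC])

lemma clinear_mult_const [lin]:
  fixes f :: "'a::complex_vector \<Rightarrow> 'b::complex_algebra_1"
  shows "clinear f \<Longrightarrow> clinear (\<lambda>x. f x * c)"
  by (rule clinearI)
    (simp_all add: clinear_add clinear_scaleC distrib_right mult_scaleC_left)

lemma clinear_const_mult [lin]:
  fixes f :: "'a::complex_vector \<Rightarrow> 'b::complex_algebra_1"
  shows "clinear f \<Longrightarrow> clinear (\<lambda>x. c * f x)"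
  by (rule clinearI)
    (simp_all add: clinear_add clinear_scaleC distrib_left mult_scaleC_right)

lemma clinear_scaleC_of [lin]: "clinear f \<Longrightarrow> clinear (\<lambda>x. c *\<^sub>C f x)"
  using clinear_compose[OF clinear_scaleC_const] .

lemma clinear_scaleC_left [lin]:
  fixes f :: "'a::complex_vector \<Rightarrow> complex" 
  shows "clinear f \<Longrightarrow> clinear (\<lambda>x. f x *\<^sub>C v)"
  by (rule clinearI)
    (simp_all add: clinear_add clinear_scaleC scaleC_add_left scaleC_scaleC scaleC_complex_def)

lemma clinear_pure_left [lin]: "clinear f \<Longrightarrow> clinear (\<lambda>x. f x \<otimes> c)"
  by (rule clinearI) (simp_all add: clinear_add clinear_scaleC pure_add_left pure_scaleC_left)

lemma clinear_pure_right [lin]: "clinear f \<Longrightarrow> clinear (\<lambda>x. c \<otimes> f x)"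
  by (rule clinearI) (simp_all add: clinear_add clinear_scaleC pure_add_right pure_scaleC_right)

definition bilinear :: "('a::complex_vector \<Rightarrow> 'b::complex_vector \<Rightarrow> 'c::complex_vector) \<Rightarrow> bool"
  where "bilinear h \<longleftrightarrow> (\<forall>b. clinear (\<lambda>a. h a b)) \<and> (\<forall>a. clinear (\<lambda>b. h a b))"

lemma bilinearI [lin]:
  "(\<And>b. clinear (\<lambda>a. h a b)) \<Longrightarrow> (\<And>a. clinear (\<lambda>b. h a b)) \<Longrightarrow> bilinear h"
  by (simp add: bilinear_def)

lemma bilinear_balanced: "bilinear h \<Longrightarrow> balanced h"
  by (simp add: bilinear_def balanced_def Vector_Spaces.linear_iff)

lemma lift_pure: "bilinear h \<Longrightarrow> tensor_lift h (a \<otimes> b) = h a b"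
  by (rule tensor_lift_pure[OF bilinear_balanced])

lemma clinear_lift:
  assumes "bilinear h"
  shows "clinear (tensor_lift h)"
proof (rule clinearI)
  show "tensor_lift h (c *\<^sub>C x) = c *\<^sub>C tensor_lift h x" for c x
    by (rule tensor_lift_scaleC[OF bilinear_balanced[OF assms]])
      (use assms in \<open>auto simp: bilinear_def Vector_Spaces.linear_iff\<close>)
qed (rule tensor_lift_add)

lemma clinear_lift_of [lin]: "bilinear h \<Longrightarrow> clinear f \<Longrightarrow> clinear (\<lambda>x. tensor_lift h (f x))"
  by (rule clinear_compose[OF clinear_lift])

text \<open>A parameter of a lifted map may sit outside the tensor that is being lifted; induction on that tensor
makes the lift linear in the parameter, which is what nested lifts need.\<close>

lemma clinear_lift_param [lin]:
  assumes "\<And>a. bilinear (h a)" "\<And>b c. clinear (\<lambda>a. h a b c)"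
  shows "clinear (\<lambda>a. tensor_lift (h a) t)"
proof (induction t)
  case zero
  show ?case by (rule clinearI) (simp_all add: tensor_lift_0)
next
  case (pure_add b c t)
  then show ?case
    using assms(2)[of b c]
    by (simp add: Vector_Spaces.linear_iff vector_space_scaleC tensor_lift_add
        lift_pure[OF assms(1)] scaleC_add_right)
qed

lemma tensor_ext:
  assumes "clinear f" "clinear g" "\<And>a b. f (a \<otimes> b) = g (a \<otimes> b)"
  shows "f t = g t"
  by (rule additive_eq_on_tensors)
    (simp_all add: assms(3) assms(1,2)[THEN clinear_add])

lemma tensor_ext22:
  assumes "\<And>t. clinear (\<lambda>s. f s t)" "\<And>t. clinear (\<lambda>s. g s t)"
    and "\<And>s. clinear (\<lambda>t. f s t)" "\<And>s. clinear (\<lambda>t. g s t)"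
    and "\<And>a b c d. f (a \<otimes> b) (c \<otimes> d) = g (a \<otimes> b) (c \<otimes> d)"
  shows "f s t = g s t"
proof (rule tensor_ext[where f="\<lambda>s. f s t" and g="\<lambda>s. g s t"])
  show "f (a \<otimes> b) t = g (a \<otimes> b) t" for a b
    by (rule tensor_ext[where f="f (a \<otimes> b)" and g="g (a \<otimes> b)"]) (intro assms)+
qed (intro assms)+

lemma tensor_ext3:
  assumes "clinear f" "clinear g" "\<And>a b c. f (a \<otimes> b \<otimes> c) = g (a \<otimes> b \<otimes> c)"
  shows "f t = g t"
  using assms(1,2)
proof (rule tensor_ext)
  fix a t
  show "f (a \<otimes> t) = g (a \<otimes> t)"
    by (rule tensor_ext[where f="\<lambda>t. f (a \<otimes> t)" and g="\<lambda>t. g (a \<otimes> t)"])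
      (intro lin clinear_compose[OF assms(1)] clinear_compose[OF assms(2)] assms(3))+
qed

lemma tensor_ext4:
  assumes "clinear f" "clinear g" "\<And>a b c d. f (a \<otimes> b \<otimes> c \<otimes> d) = g (a \<otimes> b \<otimes> c \<otimes> d)"
  shows "f t = g t"
  using assms(1,2)
proof (rule tensor_ext)
  fix a t
  show "f (a \<otimes> t) = g (a \<otimes> t)"
    by (rule tensor_ext3[where f="\<lambda>t. f (a \<otimes> t)" and g="\<lambda>t. g (a \<otimes> t)"])
      (intro lin clinear_compose[OF assms(1)] clinear_compose[OF assms(2)] assms(3))+
qed

lemma tensor_ext6:
  assumes "clinear f" "clinear g"
    "\<And>a b c d e k. f (a \<otimes> b \<otimes> c \<otimes> d \<otimes> e \<otimes> k) = g (a \<otimes> b \<otimes> c \<otimes> d \<otimes> e \<otimes> k)"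
  shows "f t = g t"
  using assms(1,2)
proof (rule tensor_ext3)
  fix a b t
  show "f (a \<otimes> b \<otimes> t) = g (a \<otimes> b \<otimes> t)"
    by (rule tensor_ext4[where f="\<lambda>t. f (a \<otimes> b \<otimes> t)" and g="\<lambda>t. g (a \<otimes> b \<otimes> t)"])
      (intro lin clinear_compose[OF assms(1)] clinear_compose[OF assms(2)] assms(3))+
qed

lemma clinear_map_of [lin]:
  assumes "clinear f" "clinear g" "clinear h"
  shows "clinear (\<lambda>x. tensor_map f g (h x))"
  unfolding tensor_map_def
  by (intro lin clinear_compose[OF assms(1)] clinear_compose[OF assms(2)] assms(3))

lemmas clinear_map = clinear_map_of[OF _ _ clinear_ident]

lemma clinear_flip_of [lin]: "clinear h \<Longrightarrow> clinear (\<lambda>x. flip (h x))"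
  unfolding flip_def by (intro lin)

lemma flip_pure [simp]: "flip (a \<otimes> b) = b \<otimes> a"
  unfolding flip_def by (rule lift_pure) (intro lin)

lemma clinear_reassoc_of [lin]: "clinear h \<Longrightarrow> clinear (\<lambda>x. reassoc (h x))"
  unfolding reassoc_def by (intro lin)

lemma reassoc_pure [simp]: "reassoc ((a \<otimes> b) \<otimes> c) = a \<otimes> b \<otimes> c"
proof -
  have "reassoc ((a \<otimes> b) \<otimes> c) = tensor_lift (\<lambda>a b. a \<otimes> b \<otimes> c) (a \<otimes> b)"
    unfolding reassoc_def by (rule lift_pure) (intro lin)
  also have "\<dots> = a \<otimes> b \<otimes> c"
    by (rule lift_pure) (intro lin)
  finally show ?thesis .
qed

lemma bilinear_lift3:
  assumes "\<And>b c. clinear (\<lambda>a. h a b c)" "\<And>a c. clinear (\<lambda>b. h a b c)" "\<And>a b. clinear (h a b)"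
  shows "bilinear (h a)" "bilinear (\<lambda>a. tensor_lift (h a))"
proof -
  show *: "bilinear (h a)" for a by (intro bilinearI assms)
  show "bilinear (\<lambda>a. tensor_lift (h a))"
    by (intro bilinearI clinear_lift_param clinear_lift * assms)
qed

lemma clinear_lift3_of [lin]:
  assumes "\<And>b c. clinear (\<lambda>a. h a b c)" "\<And>a c. clinear (\<lambda>b. h a b c)" "\<And>a b. clinear (h a b)"
    and "clinear f"
  shows "clinear (\<lambda>x. tensor_lift3 h (f x))"
  unfolding tensor_lift3_def by (intro clinear_lift_of bilinear_lift3 assms)

lemma lift3_pure:
  assumes "\<And>b c. clinear (\<lambda>a. h a b c)" "\<And>a c. clinear (\<lambda>b. h a b c)" "\<And>a b. clinear (h a b)"
  shows "tensor_lift3 h (a \<otimes> b \<otimes> c) = h a b c"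
  unfolding tensor_lift3_def
  by (simp add: lift_pure bilinear_lift3 assms)

lemma bilinear_lift4:
  assumes "\<And>b c d. clinear (\<lambda>a. h a b c d)" "\<And>a c d. clinear (\<lambda>b. h a b c d)"
    "\<And>a b d. clinear (\<lambda>c. h a b c d)" "\<And>a b c. clinear (h a b c)"
  shows "bilinear (\<lambda>a. tensor_lift3 (h a))"
  unfolding tensor_lift3_def
proof (rule bilinearI)
  show "clinear (\<lambda>a. tensor_lift (\<lambda>aa. tensor_lift (h a aa)) t)" for t
    by (intro clinear_lift_param bilinear_lift3 assms)
  show "clinear (tensor_lift (\<lambda>aa. tensor_lift (h a aa)))" for a
    by (intro clinear_lift bilinear_lift3 assms)
qed

lemma clinear_lift4_of [lin]:
  assumes "\<And>b c d. clinear (\<lambda>a. h a b c d)" "\<And>a c d. clinear (\<lambda>b. h a b c d)"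
    "\<And>a b d. clinear (\<lambda>c. h a b c d)" "\<And>a b c. clinear (h a b c)" and "clinear f"
  shows "clinear (\<lambda>x. tensor_lift4 h (f x))"
  unfolding tensor_lift4_def by (intro clinear_lift_of bilinear_lift4 assms)

lemma lift4_pure:
  assumes "\<And>b c d. clinear (\<lambda>a. h a b c d)" "\<And>a c d. clinear (\<lambda>b. h a b c d)"
    "\<And>a b d. clinear (\<lambda>c. h a b c d)" "\<And>a b c. clinear (h a b c)"
  shows "tensor_lift4 h (a \<otimes> b \<otimes> c \<otimes> d) = h a b c d"
  unfolding tensor_lift4_def
  by (simp add: lift_pure bilinear_lift4 lift3_pure assms)

section \<open>Homomorphisms out of a tensor product of algebras\<close>

lemma hom_linear: "algebra_hom f \<Longrightarrow> clinear f"
  and hom_one: "algebra_hom f \<Longrightarrow> f 1 = 1"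
  and hom_mult: "algebra_hom f \<Longrightarrow> f (x * y) = f x * f y"
  by (simp_all add: algebra_hom_def)

lemma antihom_linear: "algebra_antihom f \<Longrightarrow> clinear f"
  and antihom_one: "algebra_antihom f \<Longrightarrow> f 1 = 1"
  and antihom_mult: "algebra_antihom f \<Longrightarrow> f (x * y) = f y * f x"
  by (simp_all add: algebra_antihom_def)

definition commuting :: "('x \<Rightarrow> 'a::times) \<Rightarrow> ('y \<Rightarrow> 'a) \<Rightarrow> bool"
  where "commuting f g \<longleftrightarrow> (\<forall>x y. f x * g y = g y * f x)"

lemma commuting_sym: "commuting f g \<Longrightarrow> commuting g f"
  by (simp add: commuting_def)

text \<open>For homomorphisms with commuting images this is the map given by the universal property of the tensor
product of algebras (\<open>mlift_hom\<close>).\<close>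

definition mlift :: "('x::complex_vector \<Rightarrow> 'a::complex_algebra_1) \<Rightarrow> ('y::complex_vector \<Rightarrow> 'a)
    \<Rightarrow> 'x \<otimes> 'y \<Rightarrow> 'a"
  where "mlift f g = tensor_lift (\<lambda>x y. f x * g y)"

lemma clinear_mlift_of [lin]:
  "clinear f \<Longrightarrow> clinear g \<Longrightarrow> clinear h \<Longrightarrow> clinear (\<lambda>x. mlift f g (h x))"
  unfolding mlift_def by (intro lin)

lemma clinear_mlift [lin]: "clinear f \<Longrightarrow> clinear g \<Longrightarrow> clinear (mlift f g)"
  unfolding mlift_def by (intro clinear_lift lin)

lemma mlift_pure: "clinear f \<Longrightarrow> clinear g \<Longrightarrow> mlift f g (x \<otimes> y) = f x * g y"
  unfolding mlift_def by (rule lift_pure) (intro lin)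

text \<open>An element that moves past both factors moves past everything assembled from them. All commutation
rules between words below come from this.\<close>

lemma mlift_intertwine:
  assumes l: "clinear f" "clinear g" "clinear f'" "clinear g'"
    and f: "\<And>x. u * f x = f' x * u" and g: "\<And>y. u * g y = g' y * u"
  shows "u * mlift f g t = mlift f' g' t * u"
proof (rule tensor_ext[where f="\<lambda>t. u * mlift f g t" and g="\<lambda>t. mlift f' g' t * u"])
  fix a b
  have "u * (f a * g b) = f' a * (u * g b)"
    by (simp add: f flip: mult.assoc)
  also have "\<dots> = (f' a * g' b) * u"
    by (simp add: g mult.assoc)
  finally have "u * (f a * g b) = (f' a * g' b) * u" .
  then show "u * mlift f g (a \<otimes> b) = mlift f' g' (a \<otimes> b) * u"
    by (simp add: mlift_pure l)
qed (intro lin l)+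

lemma commuting_mlift:
  assumes "clinear f" "clinear g" "commuting h f" "commuting h g"
  shows "commuting h (mlift f g)"
  unfolding commuting_def
  by (intro allI mlift_intertwine) (use assms in \<open>auto simp: commuting_def\<close>)

lemma mlift_hom [legs]:
  assumes "algebra_hom f" "algebra_hom g" "commuting f g"
  shows "algebra_hom (mlift f g)"
proof -
  note l = assms(1,2)[THEN hom_linear]
  have "mlift f g (s * t) = mlift f g s * mlift f g t" for s t
  proof (rule tensor_ext22[where f="\<lambda>s t. mlift f g (s * t)" and g="\<lambda>s t. mlift f g s * mlift f g t"])
    fix a b c d
    have "f c * g b * g d = g b * f c * g d"
      using assms(3)[unfolded commuting_def, rule_format, of c b] by simp
    then show "mlift f g ((a \<otimes> b) * (c \<otimes> d)) = mlift f g (a \<otimes> b) * mlift f g (c \<otimes> d)"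
      by (simp add: pure_mult_pure mlift_pure l assms(1,2)[THEN hom_mult] mult.assoc)
  qed (intro lin l)+
  then show ?thesis
    by (simp add: algebra_hom_def clinear_mlift l one_tensor_def mlift_pure
        assms(1,2)[THEN hom_one])
qed

section \<open>The associator on commuting legs\<close>

lemma inv_el_unique:
  assumes "x * y = (1::'a::monoid_mult)" "z * x = 1"
  shows "y = z"
  by (metis assms mult.assoc mult_1_left mult_1_right)

lemma inv_el_right: "has_inverse x \<Longrightarrow> x * inv_el x = 1"
  and inv_el_left: "has_inverse x \<Longrightarrow> inv_el x * x = 1"
  unfolding has_inverse_def by (metis inv_el_eqI)+

lemma mlift_map_id:
  assumes "clinear f" "clinear q" "clinear r"
  shows "mlift f q (tensor_map id r t) = mlift f (\<lambda>x. q (r x)) t"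
proof (rule tensor_ext[where f="\<lambda>t. mlift f q (tensor_map id r t)"])
  have i: "clinear id" unfolding id_def by (rule clinear_ident)
  note l = assms clinear_compose[OF assms(2,3)]
  show "clinear (\<lambda>t. mlift f q (tensor_map id r t))" by (intro lin l i)
  show "clinear (mlift f (\<lambda>x. q (r x)))" by (intro lin l)
  show "mlift f q (tensor_map id r (a \<otimes> b)) = mlift f (\<lambda>x. q (r x)) (a \<otimes> b)" for a b
    by (simp add: tensor_map_pure_linear i mlift_pure l)
qed

lemma mlift_reassoc:
  assumes "clinear f" "clinear g" "clinear h"
  shows "mlift f (mlift g h) (reassoc (s \<otimes> c)) = mlift f g s * h c"
  by (rule tensor_ext[where f="\<lambda>s. mlift f (mlift g h) (reassoc (s \<otimes> c))"])
    (intro lin assms | simp add: mlift_pure assms clinear_mlift mult.assoc)+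

context quasi_hopf_algebra
begin

lemma clinear_comult: "clinear (comult H)" by (rule hom_linear[OF comult_hom])
lemma clinear_counit: "clinear (counit H)" by (rule hom_linear[OF counit_hom])
lemma clinear_antipode: "clinear (antipode H)" by (rule antihom_linear[OF antipode_antihom])

lemmas clinear_comult_of [lin] = clinear_compose[OF clinear_comult]
lemmas clinear_counit_of [lin] = clinear_compose[OF clinear_counit]
lemmas clinear_antipode_of [lin] = clinear_compose[OF clinear_antipode]

lemma clinear_id: "clinear id" unfolding id_def by (rule clinear_ident)

lemma clinear_comult_fst_of [lin]: "clinear f \<Longrightarrow> clinear (\<lambda>x. comult_fst H (f x))"
  unfolding comult_fst_def by (intro lin clinear_id clinear_comult)

lemma comult_fst_pure: "comult_fst H (a \<otimes> b) = reassoc (comult H a \<otimes> b)"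
  by (simp add: comult_fst_def tensor_map_pure_linear clinear_id clinear_comult)

text \<open>Convolution: for two legs of a tensor power this is the coproduct placed on these two legs.\<close>

definition conv :: "('h \<Rightarrow> 'a::complex_algebra_1) \<Rightarrow> ('h \<Rightarrow> 'a) \<Rightarrow> 'h \<Rightarrow> 'a"
  where "conv f g a = mlift f g (comult H a)"

text \<open>The associator with its factors on the legs \<open>f\<close>, \<open>g\<close>, \<open>h\<close>. A leg may itself be a convolution:
\<open>Phi (conv f g) h k\<close> is \<open>(\<Delta> \<otimes> 1 \<otimes> 1) \<Phi>\<close> on the legs \<open>f\<close>, \<open>g\<close>, \<open>h\<close>, \<open>k\<close>.\<close>

definition Phi :: "('h \<Rightarrow> 'a::complex_algebra_1) \<Rightarrow> ('h \<Rightarrow> 'a) \<Rightarrow> ('h \<Rightarrow> 'a) \<Rightarrow> 'a"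
  where "Phi f g h = mlift f (mlift g h) (coassociator H)"

definition Phi_inv :: "('h \<Rightarrow> 'a::complex_algebra_1) \<Rightarrow> ('h \<Rightarrow> 'a) \<Rightarrow> ('h \<Rightarrow> 'a) \<Rightarrow> 'a"
  where "Phi_inv f g h = mlift f (mlift g h) (inv_el (coassociator H))"

text \<open>Unit after counit, the unit for convolution. Putting it in a slot of \<open>Phi\<close> applies the counit there.\<close>

definition eta :: "'h \<Rightarrow> 'a::complex_algebra_1"
  where "eta a = counit H a *\<^sub>C 1"

lemma clinear_conv: "clinear f \<Longrightarrow> clinear g \<Longrightarrow> clinear (conv f g)"
  unfolding conv_def[abs_def] by (intro lin)

lemma conv_hom [legs]:
  "algebra_hom f \<Longrightarrow> algebra_hom g \<Longrightarrow> commuting f g \<Longrightarrow> algebra_hom (conv f g)"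
  using clinear_conv[OF hom_linear hom_linear, of f g] mlift_hom[of f g] comult_hom
  by (simp add: algebra_hom_def conv_def)

lemma eta_hom [legs]: "algebra_hom eta"
  using counit_hom
  by (simp add: algebra_hom_def eta_def[abs_def] scaleC_one mult_scaleC_left scaleC_scaleC)
    (intro lin)

lemma commuting_eta [legs]: "commuting f eta" "commuting eta f"
  by (simp_all add: commuting_def eta_def mult_scaleC_left mult_scaleC_right)

lemma commuting_conv [legs]:
  assumes "algebra_hom f" "algebra_hom g" "commuting h f" "commuting h g"
  shows "commuting h (conv f g)" "commuting (conv f g) h"
  using commuting_mlift[OF assms(1,2)[THEN hom_linear] assms(3,4)]
  by (simp_all add: commuting_def conv_def)

lemma commuting_mlift_hom [legs]:
  assumes "algebra_hom f" "algebra_hom g" "commuting h f" "commuting h g"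
  shows "commuting h (mlift f g)" "commuting (mlift f g) h"
  using commuting_mlift[OF assms(1,2)[THEN hom_linear] assms(3,4)]
  by (simp_all add: commuting_sym)

lemma mlift_eta_left:
  assumes "clinear g"
  shows "mlift eta g t = g (counit_fst H t)"
proof (rule tensor_ext[where g="\<lambda>t. g (counit_fst H t)"])
  have b: "bilinear (\<lambda>a b. counit H a *\<^sub>C b)" by (intro lin)
  show "mlift eta g (a \<otimes> b) = g (counit_fst H (a \<otimes> b))" for a b
    by (simp add: mlift_pure assms hom_linear eta_hom counit_fst_def lift_pure b)
      (simp add: eta_def mult_scaleC_left clinear_scaleC[OF assms])
  show "clinear (\<lambda>t. g (counit_fst H t))"
    unfolding counit_fst_def by (intro clinear_compose[OF assms] clinear_lift b)
qed (intro lin assms hom_linear eta_hom)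

lemma mlift_eta_right:
  assumes "clinear g"
  shows "mlift g eta t = g (counit_snd H t)"
proof (rule tensor_ext[where g="\<lambda>t. g (counit_snd H t)"])
  have b: "bilinear (\<lambda>b a. counit H a *\<^sub>C b)" by (intro lin)
  show "mlift g eta (a \<otimes> b) = g (counit_snd H (a \<otimes> b))" for a b
    by (simp add: mlift_pure assms hom_linear eta_hom counit_snd_def lift_pure b)
      (simp add: eta_def mult_scaleC_right clinear_scaleC[OF assms])
  show "clinear (\<lambda>t. g (counit_snd H t))"
    unfolding counit_snd_def by (intro clinear_compose[OF assms] clinear_lift b)
qed (intro lin assms hom_linear eta_hom)

lemma conv_eta: "algebra_hom f \<Longrightarrow> conv eta f = f" "algebra_hom f \<Longrightarrow> conv f eta = f"
  by (auto simp: conv_def mlift_eta_left mlift_eta_right hom_linear counit_left counit_right)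

lemma Phi_cancel:
  assumes "algebra_hom f" "algebra_hom g" "algebra_hom h"
    and "commuting f g" "commuting f h" "commuting g h"
  shows "Phi f g h * Phi_inv f g h = 1" "Phi_inv f g h * Phi f g h = 1"
proof -
  have *: "algebra_hom (mlift f (mlift g h))"
    by (intro legs assms)
  show "Phi f g h * Phi_inv f g h = 1" "Phi_inv f g h * Phi f g h = 1"
    unfolding Phi_def Phi_inv_def
    by (simp_all add: hom_one[OF *] inv_el_left inv_el_right coassociator_inv flip: hom_mult[OF *])
qed

lemma mlift_comult_fst:
  assumes "clinear f" "clinear g" "clinear q"
  shows "mlift f (mlift g q) (comult_fst H t) = mlift (conv f g) q t"
  by (rule tensor_ext[where f="\<lambda>t. mlift f (mlift g q) (comult_fst H t)"])
    (intro lin clinear_conv assms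
      | simp add: comult_fst_pure mlift_reassoc mlift_pure assms clinear_conv
      | simp add: conv_def)+

text \<open>Quasi-coassociativity on legs, obtained by applying the homomorphism \<open>mlift f (mlift g h)\<close>.\<close>

lemma Phi_conv:
  assumes "algebra_hom f" "algebra_hom g" "algebra_hom h"
    and "commuting f g" "commuting f h" "commuting g h"
  shows "Phi f g h * conv f (conv g h) a = conv (conv f g) h a * Phi f g h"
proof -
  note l = assms(1-3)[THEN hom_linear]
  have *: "algebra_hom (mlift f (mlift g h))"
    by (intro legs assms)
  have "coassociator H * tensor_map id (comult H) (comult H a)
      = comult_fst H (comult H a) * coassociator H"
    by (simp add: quasi_coassoc inv_el_right coassociator_inv flip: mult.assoc)
  then have "mlift f (mlift g h) (coassociator H * tensor_map id (comult H) (comult H a))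
      = mlift f (mlift g h) (comult_fst H (comult H a) * coassociator H)"
    by simp
  moreover have "mlift f (mlift g h) (tensor_map id (comult H) (comult H a)) = conv f (conv g h) a"
    unfolding conv_def[of f] by (simp add: mlift_map_id l clinear_comult clinear_mlift conv_def[abs_def])
  moreover have "mlift f (mlift g h) (comult_fst H (comult H a)) = conv (conv f g) h a"
    unfolding conv_def[of "conv f g"] by (simp add: mlift_comult_fst l)
  ultimately show ?thesis
    by (simp add: hom_mult[OF *] Phi_def)
qed

lemma mlift_tensor3_one:
  assumes "clinear f" "clinear g" "clinear h" "algebra_hom k"
  shows "mlift f (mlift g (mlift h k)) (tensor3_one X) = mlift f (mlift g h) X"
  by (rule tensor_ext3[where f="\<lambda>X. mlift f (mlift g (mlift h k)) (tensor3_one X)"])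
    (unfold tensor3_one_def, intro lin clinear_id clinear_reassoc_of assms hom_linear
      | simp add: tensor_map_pure_linear clinear_id clinear_reassoc_of[OF clinear_ident]
          mlift_pure assms hom_linear clinear_mlift hom_one)+

lemma Phi_pentagon:
  assumes "algebra_hom f" "algebra_hom g" "algebra_hom h" "algebra_hom k"
    and "commuting f g" "commuting f h" "commuting f k" "commuting g h" "commuting g k" "commuting h k"
  shows "Phi (conv f g) h k * Phi f g (conv h k) = Phi f g h * Phi f (conv g h) k * Phi g h k"
proof -
  note l = assms(1-4)[THEN hom_linear]
  let ?L = "mlift f (mlift g (mlift h k))"
  have *: "algebra_hom ?L"
    by (intro legs assms)
  have 1: "?L (comult_fst H (coassociator H)) = Phi (conv f g) h k"
    by (simp add: mlift_comult_fst l clinear_mlift Phi_def)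
  have "(\<lambda>x. mlift g (mlift h k) (tensor_map id (comult H) x)) = mlift g (conv h k)"
    by (rule ext) (simp add: mlift_map_id l clinear_mlift clinear_comult conv_def[abs_def])
  then have 2: "?L (tensor_map id (tensor_map id (comult H)) (coassociator H)) = Phi f g (conv h k)"
    by (simp add: mlift_map_id l clinear_mlift clinear_map clinear_id clinear_comult Phi_def)
  have "(\<lambda>x. mlift g (mlift h k) (comult_fst H x)) = mlift (conv g h) k"
    by (rule ext) (simp add: mlift_comult_fst l)
  then have 3: "?L (tensor_map id (comult_fst H) (coassociator H)) = Phi f (conv g h) k"
    by (simp add: mlift_map_id l clinear_mlift clinear_comult_fst_of[OF clinear_ident] Phi_def)
  have 4: "?L (tensor3_one (coassociator H)) = Phi f g h"
    by (simp add: mlift_tensor3_one l assms Phi_def)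
  have 5: "?L (1 \<otimes> coassociator H) = Phi g h k"
    by (simp add: mlift_pure l clinear_mlift hom_one assms Phi_def)
  from arg_cong[OF pentagon, of ?L] show ?thesis
    by (simp only: hom_mult[OF *] 1 2 3 4 5)
qed

end

section \<open>Contraction of legs\<close>

text \<open>In a word under \<open>\<tau>\<close>, a left factor \<open>P x\<close> may be replaced by \<open>Q x\<close>. The main case is \<open>Q = eta\<close> with \<open>P\<close> a
coproduct on two legs that \<open>\<tau>\<close> joins by \<open>S(_) \<alpha> _\<close>; then \<open>left_equiv\<close> expresses
\<open>S(x\<^sub>1) \<alpha> x\<^sub>2 = \<epsilon>(x) \<alpha>\<close>. Legs joined by \<open>_ \<beta> S(_)\<close> are contracted at the right end of a word, since
\<open>S\<close> reverses products.\<close>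

definition left_equiv :: "('a::times \<Rightarrow> 'b) \<Rightarrow> ('x \<Rightarrow> 'a) \<Rightarrow> ('x \<Rightarrow> 'a) \<Rightarrow> bool"
  where "left_equiv \<tau> P Q \<longleftrightarrow> (\<forall>x T. \<tau> (P x * T) = \<tau> (Q x * T))"

definition right_equiv :: "('a::times \<Rightarrow> 'b) \<Rightarrow> ('x \<Rightarrow> 'a) \<Rightarrow> ('x \<Rightarrow> 'a) \<Rightarrow> bool"
  where "right_equiv \<tau> P Q \<longleftrightarrow> (\<forall>x T. \<tau> (T * P x) = \<tau> (T * Q x))"

lemma left_equivD: "left_equiv \<tau> P Q \<Longrightarrow> \<tau> (P x * T) = \<tau> (Q x * T)"
  by (simp add: left_equiv_def)

lemma right_equivD: "right_equiv \<tau> P Q \<Longrightarrow> \<tau> (T * P x) = \<tau> (T * Q x)"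
  by (simp add: right_equiv_def)

lemma left_equiv_mlift1:
  assumes "left_equiv \<tau> P Q" "clinear \<tau>" "clinear P" "clinear Q" "clinear f"
  shows "left_equiv \<tau> (mlift P f) (mlift Q f)"
  unfolding left_equiv_def
proof (intro allI)
  fix t T
  note l = assms(2-)
  show "\<tau> (mlift P f t * T) = \<tau> (mlift Q f t * T)"
  proof (rule tensor_ext[where f="\<lambda>t. \<tau> (mlift P f t * T)" and g="\<lambda>t. \<tau> (mlift Q f t * T)"])
    show "\<tau> (mlift P f (a \<otimes> b) * T) = \<tau> (mlift Q f (a \<otimes> b) * T)" for a b
      using assms(1) by (simp add: mlift_pure l left_equiv_def mult.assoc)
  qed (intro clinear_compose[OF \<open>clinear \<tau>\<close>] lin l)+
qed

text \<open>Only the leftmost factor may be replaced, so \<open>P\<close> has to be moved past \<open>f\<close> first.\<close>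

lemma left_equiv_mlift2:
  assumes "left_equiv \<tau> P Q" "clinear \<tau>" "clinear P" "clinear Q" "clinear f"
    and "commuting f P" "commuting f Q"
  shows "left_equiv \<tau> (mlift f P) (mlift f Q)"
  unfolding left_equiv_def
proof (intro allI)
  fix t T
  note l = assms(2-5)
  show "\<tau> (mlift f P t * T) = \<tau> (mlift f Q t * T)"
  proof (rule tensor_ext[where f="\<lambda>t. \<tau> (mlift f P t * T)" and g="\<lambda>t. \<tau> (mlift f Q t * T)"])
    show "\<tau> (mlift f P (a \<otimes> b) * T) = \<tau> (mlift f Q (a \<otimes> b) * T)" for a b
      using assms(1,6,7) by (simp add: mlift_pure l left_equiv_def commuting_def mult.assoc)
  qed (intro clinear_compose[OF \<open>clinear \<tau>\<close>] lin l)+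
qed

lemma right_equiv_mlift2:
  assumes "right_equiv \<tau> P Q" "clinear \<tau>" "clinear P" "clinear Q" "clinear f"
  shows "right_equiv \<tau> (mlift f P) (mlift f Q)"
  unfolding right_equiv_def
proof (intro allI)
  fix t T
  note l = assms(2-)
  show "\<tau> (T * mlift f P t) = \<tau> (T * mlift f Q t)"
  proof (rule tensor_ext[where f="\<lambda>t. \<tau> (T * mlift f P t)" and g="\<lambda>t. \<tau> (T * mlift f Q t)"])
    show "\<tau> (T * mlift f P (a \<otimes> b)) = \<tau> (T * mlift f Q (a \<otimes> b))" for a b
      using assms(1) by (simp add: mlift_pure l right_equiv_def flip: mult.assoc)
  qed (intro clinear_compose[OF \<open>clinear \<tau>\<close>] lin l)+
qed

lemma right_equiv_mlift1:
  assumes "right_equiv \<tau> P Q" "clinear \<tau>" "clinear P" "clinear Q" "clinear f"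
    and "commuting P f" "commuting Q f"
  shows "right_equiv \<tau> (mlift P f) (mlift Q f)"
  unfolding right_equiv_def
proof (intro allI)
  fix t T
  note l = assms(2-5)
  show "\<tau> (T * mlift P f t) = \<tau> (T * mlift Q f t)"
  proof (rule tensor_ext[where f="\<lambda>t. \<tau> (T * mlift P f t)" and g="\<lambda>t. \<tau> (T * mlift Q f t)"])
    show "\<tau> (T * mlift P f (a \<otimes> b)) = \<tau> (T * mlift Q f (a \<otimes> b))" for a b
      using assms(1,6,7) by (simp add: mlift_pure l right_equiv_def commuting_def flip: mult.assoc)
  qed (intro clinear_compose[OF \<open>clinear \<tau>\<close>] lin l)+
qed

text \<open>A factor that commutes with the leg may stand to the left of it; it is absorbed into \<open>\<tau>\<close>.\<close>

lemma left_equiv_shift: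
  assumes "left_equiv \<tau> P Q" "\<And>x. u * P x = P x * u" "\<And>x. u * Q x = Q x * (u::'a::semigroup_mult)"
  shows "left_equiv (\<lambda>x. \<tau> (u * x)) P Q"
  using assms(1) by (simp add: left_equiv_def assms(2,3) mult.assoc flip: mult.assoc[of u])

lemma right_equiv_shift:
  assumes "right_equiv \<tau> P Q" "\<And>x. P x * u = u * P x" "\<And>x. Q x * u = u * (Q x::'a::semigroup_mult)"
  shows "right_equiv (\<lambda>x. \<tau> (x * u)) P Q"
  using assms(1) by (simp add: right_equiv_def assms(2,3) mult.assoc) (simp flip: mult.assoc)

context quasi_hopf_algebra
begin

lemma eta_mult: "eta a * T = counit H a *\<^sub>C T" "T * eta a = counit H a *\<^sub>C T"
  by (simp_all add: eta_def mult_scaleC_left mult_scaleC_right)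

lemma contract_conv:
  assumes "clinear F" "clinear f" "clinear g" "clinear R" "bilinear h"
    and "\<And>x y. F (f x * g y) = R (h x y)"
    and "tensor_lift h (comult H a) = counit H a *\<^sub>C c"
  shows "F (conv f g a) = counit H a *\<^sub>C R c"
proof -
  have "F (mlift f g t) = R (tensor_lift h t)" for t
    by (rule tensor_ext[where f="\<lambda>t. F (mlift f g t)" and g="\<lambda>t. R (tensor_lift h t)"])
      (intro clinear_compose[OF assms(1)] clinear_compose[OF assms(4)] lin clinear_lift assms(2,3,5)
        | simp add: mlift_pure lift_pure assms)+
  then show ?thesis
    by (simp add: conv_def assms(7) clinear_scaleC[OF assms(4)])
qed

text \<open>Contractions are verified on pure tensors: if \<open>\<tau>\<close> sees the legs \<open>f\<close> and \<open>g\<close> only through \<open>h\<close>, and \<open>h\<close>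
turns a coproduct into \<open>\<epsilon>\<close> times \<open>c\<close>, then \<open>\<tau>\<close> contracts \<open>conv f g\<close>. The maps \<open>R\<close> describe what \<open>\<tau>\<close> does
with the value of \<open>h\<close>.\<close>

lemma left_contract3:
  fixes \<tau> :: "'h \<otimes> 'h \<otimes> 'h \<Rightarrow> 'b::complex_vector"
  assumes l: "clinear \<tau>" "clinear f" "clinear g" and h: "bilinear h"
    and c: "\<And>a. tensor_lift h (comult H a) = counit H a *\<^sub>C c"
    and R: "\<And>p q r. clinear (R p q r)"
      "\<And>p q r x y. \<tau> (f x * g y * (p \<otimes> q \<otimes> r)) = R p q r (h x y)"
      "\<And>p q r. R p q r c = \<tau> (p \<otimes> q \<otimes> r)"
  shows "left_equiv \<tau> (conv f g) eta"
  unfolding left_equiv_def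
proof (intro allI)
  fix a T
  have *: "\<tau> (conv f g a * (p \<otimes> q \<otimes> r)) = counit H a *\<^sub>C R p q r c" for p q r
    by (rule contract_conv[where F="\<lambda>m. \<tau> (m * (p \<otimes> q \<otimes> r))" and h=h and R="R p q r"])
      (intro lin clinear_compose[OF l(1)] l h c R)+
  show "\<tau> (conv f g a * T) = \<tau> (eta a * T)"
    by (rule tensor_ext3[where f="\<lambda>T. \<tau> (conv f g a * T)" and g="\<lambda>T. \<tau> (eta a * T)"])
      (intro lin clinear_compose[OF l(1)] | simp add: * R eta_mult clinear_scaleC[OF l(1)])+
qed

lemma right_contract3:
  fixes \<tau> :: "'h \<otimes> 'h \<otimes> 'h \<Rightarrow> 'b::complex_vector"
  assumes l: "clinear \<tau>" "clinear f" "clinear g" and h: "bilinear h"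
    and c: "\<And>a. tensor_lift h (comult H a) = counit H a *\<^sub>C c"
    and R: "\<And>p q r. clinear (R p q r)"
      "\<And>p q r x y. \<tau> ((p \<otimes> q \<otimes> r) * (f x * g y)) = R p q r (h x y)"
      "\<And>p q r. R p q r c = \<tau> (p \<otimes> q \<otimes> r)"
  shows "right_equiv \<tau> (conv f g) eta"
  unfolding right_equiv_def
proof (intro allI)
  fix a T
  have *: "\<tau> ((p \<otimes> q \<otimes> r) * conv f g a) = counit H a *\<^sub>C R p q r c" for p q r
    by (rule contract_conv[where F="\<lambda>m. \<tau> ((p \<otimes> q \<otimes> r) * m)" and h=h and R="R p q r"])
      (intro lin clinear_compose[OF l(1)] l h c R)+
  show "\<tau> (T * conv f g a) = \<tau> (T * eta a)"
    by (rule tensor_ext3[where f="\<lambda>T. \<tau> (T * conv f g a)" and g="\<lambda>T. \<tau> (T * eta a)"])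
      (intro lin clinear_compose[OF l(1)] | simp add: * R eta_mult clinear_scaleC[OF l(1)])+
qed

lemma left_contract4:
  fixes \<tau> :: "'h \<otimes> 'h \<otimes> 'h \<otimes> 'h \<Rightarrow> 'b::complex_vector"
  assumes l: "clinear \<tau>" "clinear f" "clinear g" and h: "bilinear h"
    and c: "\<And>a. tensor_lift h (comult H a) = counit H a *\<^sub>C c"
    and R: "\<And>p q r s. clinear (R p q r s)"
      "\<And>p q r s x y. \<tau> (f x * g y * (p \<otimes> q \<otimes> r \<otimes> s)) = R p q r s (h x y)"
      "\<And>p q r s. R p q r s c = \<tau> (p \<otimes> q \<otimes> r \<otimes> s)"
  shows "left_equiv \<tau> (conv f g) eta"
  unfolding left_equiv_def
proof (intro allI)
  fix a T
  have *: "\<tau> (conv f g a * (p \<otimes> q \<otimes> r \<otimes> s)) = counit H a *\<^sub>C R p q r s c" for p q r s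
    by (rule contract_conv[where F="\<lambda>m. \<tau> (m * (p \<otimes> q \<otimes> r \<otimes> s))" and h=h and R="R p q r s"])
      (intro lin clinear_compose[OF l(1)] l h c R)+
  show "\<tau> (conv f g a * T) = \<tau> (eta a * T)"
    by (rule tensor_ext4[where f="\<lambda>T. \<tau> (conv f g a * T)" and g="\<lambda>T. \<tau> (eta a * T)"])
      (intro lin clinear_compose[OF l(1)] | simp add: * R eta_mult clinear_scaleC[OF l(1)])+
qed

lemma right_contract4:
  fixes \<tau> :: "'h \<otimes> 'h \<otimes> 'h \<otimes> 'h \<Rightarrow> 'b::complex_vector"
  assumes l: "clinear \<tau>" "clinear f" "clinear g" and h: "bilinear h"
    and c: "\<And>a. tensor_lift h (comult H a) = counit H a *\<^sub>C c"
    and R: "\<And>p q r s. clinear (R p q r s)"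
      "\<And>p q r s x y. \<tau> ((p \<otimes> q \<otimes> r \<otimes> s) * (f x * g y)) = R p q r s (h x y)"
      "\<And>p q r s. R p q r s c = \<tau> (p \<otimes> q \<otimes> r \<otimes> s)"
  shows "right_equiv \<tau> (conv f g) eta"
  unfolding right_equiv_def
proof (intro allI)
  fix a T
  have *: "\<tau> ((p \<otimes> q \<otimes> r \<otimes> s) * conv f g a) = counit H a *\<^sub>C R p q r s c" for p q r s
    by (rule contract_conv[where F="\<lambda>m. \<tau> ((p \<otimes> q \<otimes> r \<otimes> s) * m)" and h=h and R="R p q r s"])
      (intro lin clinear_compose[OF l(1)] l h c R)+
  show "\<tau> (T * conv f g a) = \<tau> (T * eta a)"
    by (rule tensor_ext4[where f="\<lambda>T. \<tau> (T * conv f g a)" and g="\<lambda>T. \<tau> (T * eta a)"])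
      (intro lin clinear_compose[OF l(1)] | simp add: * R eta_mult clinear_scaleC[OF l(1)])+
qed

lemma left_contract6:
  fixes \<tau> :: "'h \<otimes> 'h \<otimes> 'h \<otimes> 'h \<otimes> 'h \<otimes> 'h \<Rightarrow> 'b::complex_vector"
  assumes l: "clinear \<tau>" "clinear f" "clinear g" and h: "bilinear h"
    and c: "\<And>a. tensor_lift h (comult H a) = counit H a *\<^sub>C c"
    and R: "\<And>p q r s u v. clinear (R p q r s u v)"
      "\<And>p q r s u v x y. \<tau> (f x * g y * (p \<otimes> q \<otimes> r \<otimes> s \<otimes> u \<otimes> v)) = R p q r s u v (h x y)"
      "\<And>p q r s u v. R p q r s u v c = \<tau> (p \<otimes> q \<otimes> r \<otimes> s \<otimes> u \<otimes> v)"
  shows "left_equiv \<tau> (conv f g) eta"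
  unfolding left_equiv_def
proof (intro allI)
  fix a T
  have *: "\<tau> (conv f g a * (p \<otimes> q \<otimes> r \<otimes> s \<otimes> u \<otimes> v)) = counit H a *\<^sub>C R p q r s u v c" for p q r s u v
    by (rule contract_conv[where F="\<lambda>m. \<tau> (m * (p \<otimes> q \<otimes> r \<otimes> s \<otimes> u \<otimes> v))" and h=h and R="R p q r s u v"])
      (intro lin clinear_compose[OF l(1)] l h c R)+
  show "\<tau> (conv f g a * T) = \<tau> (eta a * T)"
    by (rule tensor_ext6[where f="\<lambda>T. \<tau> (conv f g a * T)" and g="\<lambda>T. \<tau> (eta a * T)"])
      (intro lin clinear_compose[OF l(1)] | simp add: * R eta_mult clinear_scaleC[OF l(1)])+
qed

lemma right_contract6:
  fixes \<tau> :: "'h \<otimes> 'h \<otimes> 'h \<otimes> 'h \<otimes> 'h \<otimes> 'h \<Rightarrow> 'b::complex_vector"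
  assumes l: "clinear \<tau>" "clinear f" "clinear g" and h: "bilinear h"
    and c: "\<And>a. tensor_lift h (comult H a) = counit H a *\<^sub>C c"
    and R: "\<And>p q r s u v. clinear (R p q r s u v)"
      "\<And>p q r s u v x y. \<tau> ((p \<otimes> q \<otimes> r \<otimes> s \<otimes> u \<otimes> v) * (f x * g y)) = R p q r s u v (h x y)"
      "\<And>p q r s u v. R p q r s u v c = \<tau> (p \<otimes> q \<otimes> r \<otimes> s \<otimes> u \<otimes> v)"
  shows "right_equiv \<tau> (conv f g) eta"
  unfolding right_equiv_def
proof (intro allI)
  fix a T
  have *: "\<tau> ((p \<otimes> q \<otimes> r \<otimes> s \<otimes> u \<otimes> v) * conv f g a) = counit H a *\<^sub>C R p q r s u v c" for p q r s u v
    by (rule contract_conv[where F="\<lambda>m. \<tau> ((p \<otimes> q \<otimes> r \<otimes> s \<otimes> u \<otimes> v) * m)" and h=h and R="R p q r s u v"])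
      (intro lin clinear_compose[OF l(1)] l h c R)+
  show "\<tau> (T * conv f g a) = \<tau> (T * eta a)"
    by (rule tensor_ext6[where f="\<lambda>T. \<tau> (T * conv f g a)" and g="\<lambda>T. \<tau> (T * eta a)"])
      (intro lin clinear_compose[OF l(1)] | simp add: * R eta_mult clinear_scaleC[OF l(1)])+
qed

lemma left_equiv_conv1:
  assumes "left_equiv \<tau> P Q" "clinear \<tau>" "clinear P" "clinear Q" "clinear f"
  shows "left_equiv \<tau> (conv P f) (conv Q f)"
  using left_equiv_mlift1[OF assms] by (simp add: left_equiv_def conv_def)

lemma left_equiv_conv2:
  assumes "left_equiv \<tau> P Q" "clinear \<tau>" "clinear P" "clinear Q" "clinear f"
    "commuting f P" "commuting f Q"
  shows "left_equiv \<tau> (conv f P) (conv f Q)"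
  using left_equiv_mlift2[OF assms] by (simp add: left_equiv_def conv_def)

lemma right_equiv_conv2:
  assumes "right_equiv \<tau> P Q" "clinear \<tau>" "clinear P" "clinear Q" "clinear f"
  shows "right_equiv \<tau> (conv f P) (conv f Q)"
  using right_equiv_mlift2[OF assms] by (simp add: right_equiv_def conv_def)

lemma right_equiv_conv1:
  assumes "right_equiv \<tau> P Q" "clinear \<tau>" "clinear P" "clinear Q" "clinear f"
    "commuting P f" "commuting Q f"
  shows "right_equiv \<tau> (conv P f) (conv Q f)"
  using right_equiv_mlift1[OF assms] by (simp add: right_equiv_def conv_def)

text \<open>The replacements inside an associator, one lemma for each slot and side. A slot that is not the
outermost one has to commute with the slots between it and the end of the word.\<close>

lemma left_Phi1:
  assumes "left_equiv \<tau> P Q" "clinear \<tau>" "algebra_hom P" "algebra_hom Q" "algebra_hom g" "algebra_hom h"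
  shows "\<tau> (Phi P g h * T) = \<tau> (Phi Q g h * T)" "\<tau> (Phi_inv P g h * T) = \<tau> (Phi_inv Q g h * T)"
  unfolding Phi_def Phi_inv_def
  by (intro left_equivD left_equiv_mlift1 assms clinear_mlift hom_linear)+

lemma left_Phi2:
  assumes "left_equiv \<tau> P Q" "clinear \<tau>" "algebra_hom P" "algebra_hom Q" "algebra_hom f" "algebra_hom h"
    "commuting f P" "commuting f Q" "commuting f h"
  shows "\<tau> (Phi f P h * T) = \<tau> (Phi f Q h * T)" "\<tau> (Phi_inv f P h * T) = \<tau> (Phi_inv f Q h * T)"
  unfolding Phi_def Phi_inv_def
  by (intro left_equivD left_equiv_mlift2 left_equiv_mlift1 assms clinear_mlift hom_linear
      commuting_mlift)+

lemma left_Phi3: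
  assumes "left_equiv \<tau> P Q" "clinear \<tau>" "algebra_hom P" "algebra_hom Q" "algebra_hom f" "algebra_hom g"
    "commuting f P" "commuting f Q" "commuting f g" "commuting g P" "commuting g Q"
  shows "\<tau> (Phi f g P * T) = \<tau> (Phi f g Q * T)" "\<tau> (Phi_inv f g P * T) = \<tau> (Phi_inv f g Q * T)"
  unfolding Phi_def Phi_inv_def
  by (intro left_equivD left_equiv_mlift2 left_equiv_mlift1 assms clinear_mlift hom_linear
      commuting_mlift)+

lemma right_Phi3:
  assumes "right_equiv \<tau> P Q" "clinear \<tau>" "algebra_hom P" "algebra_hom Q" "algebra_hom f" "algebra_hom g"
  shows "\<tau> (T * Phi f g P) = \<tau> (T * Phi f g Q)" "\<tau> (T * Phi_inv f g P) = \<tau> (T * Phi_inv f g Q)"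
  unfolding Phi_def Phi_inv_def
  by (intro right_equivD right_equiv_mlift2 assms clinear_mlift hom_linear)+

lemma right_Phi2:
  assumes "right_equiv \<tau> P Q" "clinear \<tau>" "algebra_hom P" "algebra_hom Q" "algebra_hom f" "algebra_hom h"
    "commuting P h" "commuting Q h"
  shows "\<tau> (T * Phi f P h) = \<tau> (T * Phi f Q h)" "\<tau> (T * Phi_inv f P h) = \<tau> (T * Phi_inv f Q h)"
  unfolding Phi_def Phi_inv_def
  by (intro right_equivD right_equiv_mlift2 right_equiv_mlift1 assms clinear_mlift hom_linear
      commuting_mlift)+

lemma right_Phi1:
  assumes "right_equiv \<tau> P Q" "clinear \<tau>" "algebra_hom P" "algebra_hom Q" "algebra_hom g" "algebra_hom h"
    "commuting P g" "commuting Q g" "commuting P h" "commuting Q h"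
  shows "\<tau> (T * Phi P g h) = \<tau> (T * Phi Q g h)" "\<tau> (T * Phi_inv P g h) = \<tau> (T * Phi_inv Q g h)"
  unfolding Phi_def Phi_inv_def
  by (intro right_equivD right_equiv_mlift2 right_equiv_mlift1 assms clinear_mlift hom_linear
      commuting_mlift)+

lemma Phi_eta2:
  assumes "algebra_hom f" "algebra_hom h" "commuting f h"
  shows "Phi f eta h = 1" "Phi_inv f eta h = 1"
proof -
  note l = assms(1,2)[THEN hom_linear]
  have c: "clinear (counit_fst H)"
    unfolding counit_fst_def by (intro clinear_lift lin)
  have "mlift eta h = (\<lambda>t. h (counit_fst H t))"
    by (rule HOL.ext) (rule mlift_eta_left[OF l(2)])
  then have "Phi f eta h = mlift f h (tensor_map id (counit_fst H) (coassociator H))"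
    by (simp add: Phi_def mlift_map_id l c)
  also have "\<dots> = 1"
    by (simp add: counit_coassociator hom_one[OF mlift_hom] assms)
  finally show *: "Phi f eta h = 1" .
  have "Phi f eta h * Phi_inv f eta h = 1"
    by (intro Phi_cancel legs assms)
  with * show "Phi_inv f eta h = 1" by simp
qed

text \<open>Only the counit in the middle slot is part of the axioms. In the outer slots, the pentagon with two
trivial legs makes \<open>Phi\<close> idempotent, and it is invertible.\<close>

lemma Phi_eta1:
  assumes "algebra_hom h" "algebra_hom k" "commuting h k"
  shows "Phi eta h k = 1" "Phi_inv eta h k = 1"
proof -
  have c: "Phi eta h k * Phi_inv eta h k = 1"
    by (intro Phi_cancel legs assms)
  have "Phi (conv eta eta) h k * Phi eta eta (conv h k)
      = Phi eta eta h * Phi eta (conv eta h) k * Phi eta h k"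
    by (intro Phi_pentagon legs assms)
  then have "Phi eta h k = Phi eta h k * Phi eta h k"
    by (simp add: conv_eta eta_hom assms Phi_eta2 conv_hom commuting_eta)
  then have "Phi eta h k * Phi_inv eta h k = Phi eta h k * (Phi eta h k * Phi_inv eta h k)"
    by (simp flip: mult.assoc)
  with c show "Phi eta h k = 1" by simp
  with c show "Phi_inv eta h k = 1" by simp
qed

lemma Phi_eta3:
  assumes "algebra_hom f" "algebra_hom g" "commuting f g"
  shows "Phi f g eta = 1" "Phi_inv f g eta = 1"
proof -
  have c: "Phi_inv f g eta * Phi f g eta = 1"
    by (intro Phi_cancel legs assms)
  have "Phi (conv f g) eta eta * Phi f g (conv eta eta)
      = Phi f g eta * Phi f (conv g eta) eta * Phi g eta eta"
    by (intro Phi_pentagon legs assms)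
  then have "Phi f g eta = Phi f g eta * Phi f g eta"
    by (simp add: conv_eta eta_hom assms Phi_eta2 conv_hom commuting_eta)
  then have "Phi_inv f g eta * Phi f g eta = Phi_inv f g eta * Phi f g eta * Phi f g eta"
    by (simp add: mult.assoc)
  with c show "Phi f g eta = 1" by simp
  with c show "Phi_inv f g eta = 1" by simp
qed

lemma Phi_inv_conv:
  assumes "algebra_hom f" "algebra_hom g" "algebra_hom h"
    and "commuting f g" "commuting f h" "commuting g h"
  shows "Phi_inv f g h * conv (conv f g) h a = conv f (conv g h) a * Phi_inv f g h"
proof -
  note c = Phi_cancel[OF assms]
  have "Phi_inv f g h * conv (conv f g) h a
      = Phi_inv f g h * (conv (conv f g) h a * Phi f g h) * Phi_inv f g h"
    by (simp add: c mult.assoc)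
  also have "\<dots> = conv f (conv g h) a * Phi_inv f g h"
    by (simp add: c flip: Phi_conv[OF assms] mult.assoc)
  finally show ?thesis .
qed

end

section \<open>Comparison of antipodes along a homomorphism\<close>

text \<open>The legs of tensor powers: the first digit is the exponent, the second one the position.\<close>

definition leg31 :: "'a::complex_algebra_1 \<Rightarrow> 'a \<otimes> 'a \<otimes> 'a" where "leg31 a = a \<otimes> 1 \<otimes> 1"
definition leg32 :: "'a::complex_algebra_1 \<Rightarrow> 'a \<otimes> 'a \<otimes> 'a" where "leg32 a = 1 \<otimes> a \<otimes> 1"
definition leg33 :: "'a::complex_algebra_1 \<Rightarrow> 'a \<otimes> 'a \<otimes> 'a" where "leg33 a = 1 \<otimes> 1 \<otimes> a"

lemmas leg3_defs = leg31_def leg32_def leg33_def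

lemma leg3_hom [legs]: "algebra_hom leg31" "algebra_hom leg32" "algebra_hom leg33"
  unfolding algebra_hom_def leg3_defs[abs_def]
  by (intro conjI lin allI; simp add: one_tensor_def pure_mult_pure)+

lemma leg3_commuting [legs]:
  "commuting leg31 leg32" "commuting leg31 leg33" "commuting leg32 leg33"
  "commuting leg32 leg31" "commuting leg33 leg31" "commuting leg33 leg32"
  by (simp_all add: commuting_def leg3_defs pure_mult_pure)

lemmas leg3_linear = leg3_hom[THEN hom_linear]

lemma leg3_mlift: "mlift leg31 (mlift leg32 leg33) X = X"
  by (rule tensor_ext3[where f="mlift leg31 (mlift leg32 leg33)"])
    (intro lin leg3_linear
      | simp add: mlift_pure leg3_linear clinear_mlift leg3_defs pure_mult_pure)+

definition leg41 :: "'a::complex_algebra_1 \<Rightarrow> 'a \<otimes> 'a \<otimes> 'a \<otimes> 'a" where "leg41 a = a \<otimes> 1 \<otimes> 1 \<otimes> 1"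
definition leg42 :: "'a::complex_algebra_1 \<Rightarrow> 'a \<otimes> 'a \<otimes> 'a \<otimes> 'a" where "leg42 a = 1 \<otimes> a \<otimes> 1 \<otimes> 1"
definition leg43 :: "'a::complex_algebra_1 \<Rightarrow> 'a \<otimes> 'a \<otimes> 'a \<otimes> 'a" where "leg43 a = 1 \<otimes> 1 \<otimes> a \<otimes> 1"
definition leg44 :: "'a::complex_algebra_1 \<Rightarrow> 'a \<otimes> 'a \<otimes> 'a \<otimes> 'a" where "leg44 a = 1 \<otimes> 1 \<otimes> 1 \<otimes> a"

lemmas leg4_defs = leg41_def leg42_def leg43_def leg44_def

lemma leg4_hom [legs]: "algebra_hom leg41" "algebra_hom leg42" "algebra_hom leg43" "algebra_hom leg44"
  unfolding algebra_hom_def leg4_defs[abs_def]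
  by (intro conjI lin allI; simp add: one_tensor_def pure_mult_pure)+

lemma leg4_commuting [legs]:
  "commuting leg41 leg42" "commuting leg41 leg43" "commuting leg41 leg44"
  "commuting leg42 leg41" "commuting leg42 leg43" "commuting leg42 leg44"
  "commuting leg43 leg41" "commuting leg43 leg42" "commuting leg43 leg44"
  "commuting leg44 leg41" "commuting leg44 leg42" "commuting leg44 leg43"
  by (simp_all add: commuting_def leg4_defs pure_mult_pure)

lemmas leg4_linear = leg4_hom[THEN hom_linear]

lemma leg4_lift:
  "mlift leg41 (mlift leg42 leg43) (a \<otimes> b \<otimes> c) = a \<otimes> b \<otimes> c \<otimes> 1"
  "mlift leg42 (mlift leg43 leg44) (a \<otimes> b \<otimes> c) = 1 \<otimes> a \<otimes> b \<otimes> c"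
  by (simp_all add: mlift_pure clinear_mlift leg4_linear) (simp_all add: leg4_defs pure_mult_pure)

text \<open>The relation \<open>ab = cde\<close> between units, solved for the subwords to which the pentagon is applied.\<close>

lemma pentagon_rotations:
  fixes a b c d e :: "'a::monoid_mult"
  assumes p: "a * b = c * d * e"
    and "a * a' = 1" "a' * a = 1" "b * b' = 1" "b' * b = 1" "c * c' = 1" "c' * c = 1"
      "d * d' = 1" "d' * d = 1" "e * e' = 1" "e' * e = 1"
  shows "c' * a = d * e * b'" "a' * c = b * e' * d'" "e * b' = d' * c' * a" "b * e' = a' * c * d"
    "e' * d' * c' = b' * a'" "c = a * (b * (e' * d'))" "e = d' * (c' * (a * b))"
proof -
  have cancel: "x * (y * z) = z" if "x * y = 1" for x y z :: 'a
    using that by (simp flip: mult.assoc)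
  note k = assms(2-) assms(2-)[THEN cancel]
  have p': "a * (b * z) = c * (d * (e * z))" for z
    using p by (metis mult.assoc)
  have "c' * a = c' * (a * (b * b'))" by (simp add: k)
  also have "\<dots> = d * e * b'" by (simp only: p') (simp add: k mult.assoc)
  finally show A: "c' * a = d * e * b'" .
  have "a' * c = a' * (c * (d * (e * (e' * d'))))" by (simp add: k)
  also have "\<dots> = b * e' * d'" by (simp only: p'[symmetric]) (simp add: k mult.assoc)
  finally show "a' * c = b * e' * d'" .
  show "e * b' = d' * c' * a" by (simp add: mult.assoc A k)
  have "b * e' = a' * (a * (b * e'))" by (simp add: k)
  also have "\<dots> = a' * c * d" by (simp only: p') (simp add: k mult.assoc)
  finally show "b * e' = a' * c * d" .
  have "e' * d' * c' = e' * (d' * (c' * (a * (b * (b' * a')))))" by (simp add: k mult.assoc)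
  also have "\<dots> = b' * a'" by (simp only: p') (simp add: k)
  finally show "e' * d' * c' = b' * a'" .
  show "c = a * (b * (e' * d'))" by (simp only: p') (simp add: k)
  show "e = d' * (c' * (a * b))" by (simp only: p) (simp add: k mult.assoc)
qed

context quasi_hopf_algebra
begin

lemma Phi_pentagon_rotations:
  assumes "algebra_hom f" "algebra_hom g" "algebra_hom h" "algebra_hom k"
    and "commuting f g" "commuting f h" "commuting f k" "commuting g h" "commuting g k" "commuting h k"
  shows "Phi_inv f g h * Phi (conv f g) h k = Phi f (conv g h) k * Phi g h k * Phi_inv f g (conv h k)"
    and "Phi_inv (conv f g) h k * Phi f g h = Phi f g (conv h k) * Phi_inv g h k * Phi_inv f (conv g h) k"
    and "Phi g h k * Phi_inv f g (conv h k) = Phi_inv f (conv g h) k * Phi_inv f g h * Phi (conv f g) h k"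
    and "Phi f g (conv h k) * Phi_inv g h k = Phi_inv (conv f g) h k * Phi f g h * Phi f (conv g h) k"
    and "Phi_inv g h k * Phi_inv f (conv g h) k * Phi_inv f g h
      = Phi_inv f g (conv h k) * Phi_inv (conv f g) h k"
    and "Phi f g h
      = Phi (conv f g) h k * (Phi f g (conv h k) * (Phi_inv g h k * Phi_inv f (conv g h) k))"
    and "Phi g h k
      = Phi_inv f (conv g h) k * (Phi_inv f g h * (Phi (conv f g) h k * Phi f g (conv h k)))"
  by - (rule pentagon_rotations[OF Phi_pentagon[OF assms]
          Phi_cancel Phi_cancel Phi_cancel Phi_cancel Phi_cancel];
      intro legs assms assms(5-10)[THEN commuting_sym])+

text \<open>With \<open>\<rho>\<close> viewed as a representation of \<open>H\<close> in \<open>B\<close>, the map \<open>\<sigma>\<close> is the dual representation, \<open>a\<close> the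
evaluation and \<open>b\<close> the coevaluation; the last two conditions are the zigzag identities.\<close>

definition antipode_along ::
    "('h \<Rightarrow> 'b::complex_algebra_1) \<Rightarrow> ('h \<Rightarrow> 'b) \<Rightarrow> 'b \<Rightarrow> 'b \<Rightarrow> bool"
  where "antipode_along \<rho> \<sigma> a b \<longleftrightarrow> algebra_hom \<rho> \<and> algebra_antihom \<sigma>
    \<and> (\<forall>x. tensor_lift (\<lambda>x y. \<sigma> x * a * \<rho> y) (comult H x) = counit H x *\<^sub>C a)
    \<and> (\<forall>x. tensor_lift (\<lambda>x y. \<rho> x * b * \<sigma> y) (comult H x) = counit H x *\<^sub>C b)
    \<and> tensor_lift3 (\<lambda>x y z. \<sigma> x * a * \<rho> y * b * \<sigma> z) (coassociator H) = 1
    \<and> tensor_lift3 (\<lambda>x y z. \<rho> x * b * \<sigma> y * a * \<rho> z) (inv_el (coassociator H)) = 1"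

text \<open>The canonical map between two duals: coevaluation of the second one followed by evaluation of the
first one.\<close>

definition comparison :: "('h \<Rightarrow> 'b::complex_algebra_1) \<Rightarrow> 'b \<Rightarrow> ('h \<Rightarrow> 'b) \<Rightarrow> 'b \<Rightarrow> ('h \<Rightarrow> 'b) \<Rightarrow> 'b"
  where "comparison \<sigma> a \<rho> b \<sigma>' = tensor_lift3 (\<lambda>x y z. \<sigma> x * a * \<rho> y * b * \<sigma>' z) (coassociator H)"

lemma antipode_alongD:
  assumes "antipode_along \<rho> \<sigma> a b"
  shows "algebra_hom \<rho>" "algebra_antihom \<sigma>"
    "tensor_lift (\<lambda>x y. \<sigma> x * a * \<rho> y) (comult H x) = counit H x *\<^sub>C a"
    "tensor_lift (\<lambda>x y. \<rho> x * b * \<sigma> y) (comult H x) = counit H x *\<^sub>C b"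
    "tensor_lift3 (\<lambda>x y z. \<sigma> x * a * \<rho> y * b * \<sigma> z) (coassociator H) = 1"
    "tensor_lift3 (\<lambda>x y z. \<rho> x * b * \<sigma> y * a * \<rho> z) (inv_el (coassociator H)) = 1"
  using assms by (simp_all add: antipode_along_def)

text \<open>Multiply \<open>\<Phi>\<close> by an iterated coproduct of \<open>c\<close>. On the right, the last two factors are contracted at
\<open>b2\<close> and \<open>c\<close> arrives at the outer left as \<open>\<sigma>1(c)\<close>; after passing to the left of \<open>\<Phi>\<close> by
quasi-coassociativity, the first two are contracted at \<open>a1\<close> and \<open>c\<close> arrives at the outer right.\<close>

lemma comparison_intertwines:
  assumes 1: "antipode_along \<rho> \<sigma>1 a1 b1" and 2: "antipode_along \<rho> \<sigma>2 a2 b2"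
  shows "\<sigma>1 c * comparison \<sigma>1 a1 \<rho> b2 \<sigma>2 = comparison \<sigma>1 a1 \<rho> b2 \<sigma>2 * \<sigma>2 c"
proof -
  let ?l1 = "leg31 :: 'h \<Rightarrow> _" and ?l2 = "leg32 :: 'h \<Rightarrow> _"
  let ?l3 = "leg33 :: 'h \<Rightarrow> _"
  let ?c12 = "conv ?l1 ?l2" and ?c23 = "conv ?l2 ?l3"
  note h1 = antipode_alongD[OF 1] and h2 = antipode_alongD[OF 2]
  note l = hom_linear[OF h1(1)] antihom_linear[OF h1(2)] antihom_linear[OF h2(2)]
  note L = lin l[THEN clinear_compose] l
  define \<tau> where "\<tau> = tensor_lift3 (\<lambda>x y z. \<sigma>1 x * a1 * \<rho> y * b2 * \<sigma>2 z)"
  have \<tau>: "clinear \<tau>"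
    unfolding \<tau>_def by (rule clinear_lift3_of[OF _ _ _ clinear_ident]; intro L)
  have \<tau>_pure: "\<tau> (x \<otimes> y \<otimes> z) = \<sigma>1 x * a1 * \<rho> y * b2 * \<sigma>2 z" for x y z
    unfolding \<tau>_def by (rule lift3_pure; intro L)
  note \<tau>s = \<tau>_pure leg3_defs pure_mult_pure mult.assoc hom_mult[OF h1(1)] antihom_mult[OF h1(2)]
    antihom_mult[OF h2(2)] hom_one[OF h1(1)] antihom_one[OF h1(2)] antihom_one[OF h2(2)]
  have c1: "left_equiv \<tau> ?c12 eta"
    by (rule left_contract3[where h="\<lambda>x y. \<sigma>1 x * a1 * \<rho> y" and c=a1 and R="\<lambda>p q r u. \<sigma>1 p * u * (\<rho> q * b2 * \<sigma>2 r)"])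
      (intro \<tau> L leg3_linear h1 | simp add: \<tau>s)+
  have c2: "right_equiv \<tau> ?c23 eta"
    by (rule right_contract3[where h="\<lambda>x y. \<rho> x * b2 * \<sigma>2 y" and c=b2 and R="\<lambda>p q r u. \<sigma>1 p * a1 * \<rho> q * u * \<sigma>2 r"])
      (intro \<tau> L leg3_linear h2 | simp add: \<tau>s)+
  have outer1: "\<tau> (T * ?l1 c) = \<sigma>1 c * \<tau> T" for T
    by (rule tensor_ext3[where f="\<lambda>T. \<tau> (T * ?l1 c)"])
      (intro L clinear_compose[OF \<tau>] | simp add: \<tau>s)+
  have outer2: "\<tau> (?l3 c * T) = \<tau> T * \<sigma>2 c" for T
    by (rule tensor_ext3[where f="\<lambda>T. \<tau> (?l3 c * T)"])
      (intro L clinear_compose[OF \<tau>] | simp add: \<tau>s)+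
  let ?\<Phi> = "Phi ?l1 ?l2 ?l3"
  have w: "\<tau> ?\<Phi> = comparison \<sigma>1 a1 \<rho> b2 \<sigma>2"
    by (simp add: Phi_def leg3_mlift comparison_def \<tau>_def)
  have "\<sigma>1 c * \<tau> ?\<Phi> = \<tau> (?\<Phi> * conv ?l1 eta c)"
    by (simp add: outer1 conv_eta legs)
  also have "\<dots> = \<tau> (?\<Phi> * conv ?l1 ?c23 c)"
    by (rule right_equivD[OF right_equiv_conv2[OF c2 \<tau>], symmetric])
      (intro legs hom_linear)+
  also have "\<dots> = \<tau> (conv ?c12 ?l3 c * ?\<Phi>)"
    by (rule arg_cong[of _ _ \<tau>], rule Phi_conv) (intro legs)+
  also have "\<dots> = \<tau> (conv eta ?l3 c * ?\<Phi>)"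
    by (rule left_equivD[OF left_equiv_conv1[OF c1 \<tau>]])
      (intro legs hom_linear)+
  also have "\<dots> = \<tau> ?\<Phi> * \<sigma>2 c"
    by (simp add: outer2 conv_eta legs)
  finally show ?thesis by (simp add: w)
qed

text \<open>The product is \<open>\<Phi> \<otimes> 1\<close> closed up by a fourth leg. The pentagon rewrites it as a product of four
associators, three of which have a coproduct in a position where it is contracted; what remains is
\<open>a1\<close> times the second zigzag identity of \<open>\<sigma>2\<close>.\<close>

lemma comparison_alpha:
  assumes 1: "antipode_along \<rho> \<sigma>1 a1 b1" and 2: "antipode_along \<rho> \<sigma>2 a2 b2"
  shows "comparison \<sigma>1 a1 \<rho> b2 \<sigma>2 * a2 = a1"
proof -
  let ?l1 = "leg41 :: 'h \<Rightarrow> _" and ?l2 = "leg42 :: 'h \<Rightarrow> _"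
  let ?l3 = "leg43 :: 'h \<Rightarrow> _" and ?l4 = "leg44 :: 'h \<Rightarrow> _"
  let ?c12 = "conv ?l1 ?l2" and ?c23 = "conv ?l2 ?l3" and ?c34 = "conv ?l3 ?l4"
  note h1 = antipode_alongD[OF 1] and h2 = antipode_alongD[OF 2]
  note l = hom_linear[OF h1(1)] antihom_linear[OF h1(2)] antihom_linear[OF h2(2)]
  note L = lin l[THEN clinear_compose] l
  define \<tau> where "\<tau> = tensor_lift4 (\<lambda>x y z t. \<sigma>1 x * a1 * \<rho> y * b2 * \<sigma>2 z * a2 * \<rho> t)"
  have \<tau>: "clinear \<tau>"
    unfolding \<tau>_def by (rule clinear_lift4_of[OF _ _ _ _ clinear_ident]; intro L)
  have \<tau>_pure: "\<tau> (x \<otimes> y \<otimes> z \<otimes> t) = \<sigma>1 x * a1 * \<rho> y * b2 * \<sigma>2 z * a2 * \<rho> t" for x y z t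
    unfolding \<tau>_def by (rule lift4_pure; intro L)
  note \<tau>s = \<tau>_pure leg4_defs pure_mult_pure mult.assoc hom_mult[OF h1(1)] antihom_mult[OF h1(2)]
    antihom_mult[OF h2(2)] hom_one[OF h1(1)] antihom_one[OF h1(2)] antihom_one[OF h2(2)]
  have c1: "left_equiv \<tau> ?c12 eta"
    by (rule left_contract4[where h="\<lambda>x y. \<sigma>1 x * a1 * \<rho> y" and c=a1 and R="\<lambda>p q r s u. \<sigma>1 p * u * (\<rho> q * b2 * \<sigma>2 r * a2 * \<rho> s)"])
      (intro \<tau> L leg4_linear h1 | simp add: \<tau>s)+
  have c2: "left_equiv \<tau> ?c34 eta"
    by (rule left_contract4[where h="\<lambda>x y. \<sigma>2 x * a2 * \<rho> y" and c=a2 and R="\<lambda>p q r s u. \<sigma>1 p * a1 * \<rho> q * b2 * \<sigma>2 r * u * \<rho> s"])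
      (intro \<tau> L leg4_linear h2 | simp add: \<tau>s)+
  have c3: "right_equiv \<tau> ?c23 eta"
    by (rule right_contract4[where h="\<lambda>x y. \<rho> x * b2 * \<sigma>2 y" and c=b2 and R="\<lambda>p q r s u. \<sigma>1 p * a1 * \<rho> q * u * (\<sigma>2 r * a2 * \<rho> s)"])
      (intro \<tau> L leg4_linear h2 | simp add: \<tau>s)+
  have "\<tau> (mlift ?l1 (mlift ?l2 ?l3) X)
      = tensor_lift3 (\<lambda>x y z. \<sigma>1 x * a1 * \<rho> y * b2 * \<sigma>2 z) X * a2" for X
    by (rule tensor_ext3[where f="\<lambda>X. \<tau> (mlift ?l1 (mlift ?l2 ?l3) X)"])
      (subst lift3_pure | intro L clinear_compose[OF \<tau>] leg4_linear
        | simp add: \<tau>s leg4_lift)+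
  then have "comparison \<sigma>1 a1 \<rho> b2 \<sigma>2 * a2 = \<tau> (Phi ?l1 ?l2 ?l3)"
    by (simp add: comparison_def Phi_def)
  also have "Phi ?l1 ?l2 ?l3 = Phi ?c12 ?l3 ?l4
      * (Phi ?l1 ?l2 ?c34
      * (Phi_inv ?l2 ?l3 ?l4 * Phi_inv ?l1 ?c23 ?l4))"
    by (rule Phi_pentagon_rotations(6)) (intro legs)+
  also have "\<tau> \<dots> = \<tau> (Phi eta ?l3 ?l4 * (Phi ?l1 ?l2 ?c34
      * (Phi_inv ?l2 ?l3 ?l4 * Phi_inv ?l1 ?c23 ?l4)))"
    by (rule left_Phi1[OF c1 \<tau>]) (intro legs)+
  also have "\<dots> = \<tau> (Phi ?l1 ?l2 ?c34
      * (Phi_inv ?l2 ?l3 ?l4 * Phi_inv ?l1 ?c23 ?l4))"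
    by (simp add: Phi_eta1 legs)
  also have "\<dots> = \<tau> (Phi ?l1 ?l2 eta
      * (Phi_inv ?l2 ?l3 ?l4 * Phi_inv ?l1 ?c23 ?l4))"
    by (rule left_Phi3[OF c2 \<tau>]) (intro legs)+
  also have "\<dots> = \<tau> (Phi_inv ?l2 ?l3 ?l4 * Phi_inv ?l1 ?c23 ?l4)"
    by (simp add: Phi_eta3 legs)
  also have "\<dots> = \<tau> (Phi_inv ?l2 ?l3 ?l4 * Phi_inv ?l1 eta ?l4)"
    by (rule right_Phi2[OF c3 \<tau>]) (intro legs)+
  also have "\<dots> = \<tau> (Phi_inv ?l2 ?l3 ?l4)"
    by (simp add: Phi_eta2 legs)
  also have "\<tau> (Phi_inv ?l2 ?l3 ?l4) = a1"
  proof -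
    have "\<tau> (mlift ?l2 (mlift ?l3 ?l4) X)
        = a1 * tensor_lift3 (\<lambda>x y z. \<rho> x * b2 * \<sigma>2 y * a2 * \<rho> z) X" for X
      by (rule tensor_ext3[where f="\<lambda>X. \<tau> (mlift ?l2 (mlift ?l3 ?l4) X)"])
        (subst lift3_pure | intro L clinear_compose[OF \<tau>] leg4_linear
          | simp add: \<tau>s leg4_lift)+
    then show ?thesis
      by (simp add: Phi_inv_def h2)
  qed
  finally show ?thesis .
qed

text \<open>Mirror image of the preceding proof: here the fourth leg is on the left, so that the word is
\<open>1 \<otimes> \<Phi>\<close>, and the zigzag identity that remains is the one of \<open>\<sigma>1\<close>.\<close>

lemma comparison_beta:
  assumes 1: "antipode_along \<rho> \<sigma>1 a1 b1" and 2: "antipode_along \<rho> \<sigma>2 a2 b2"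
  shows "b1 * comparison \<sigma>1 a1 \<rho> b2 \<sigma>2 = b2"
proof -
  let ?l1 = "leg41 :: 'h \<Rightarrow> _" and ?l2 = "leg42 :: 'h \<Rightarrow> _"
  let ?l3 = "leg43 :: 'h \<Rightarrow> _" and ?l4 = "leg44 :: 'h \<Rightarrow> _"
  let ?c12 = "conv ?l1 ?l2" and ?c23 = "conv ?l2 ?l3" and ?c34 = "conv ?l3 ?l4"
  note h1 = antipode_alongD[OF 1] and h2 = antipode_alongD[OF 2]
  note l = hom_linear[OF h1(1)] antihom_linear[OF h1(2)] antihom_linear[OF h2(2)]
  note L = lin l[THEN clinear_compose] l
  define \<tau> where "\<tau> = tensor_lift4 (\<lambda>x y z t. \<rho> x * b1 * \<sigma>1 y * a1 * \<rho> z * b2 * \<sigma>2 t)"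
  have \<tau>: "clinear \<tau>"
    unfolding \<tau>_def by (rule clinear_lift4_of[OF _ _ _ _ clinear_ident]; intro L)
  have \<tau>_pure: "\<tau> (x \<otimes> y \<otimes> z \<otimes> t) = \<rho> x * b1 * \<sigma>1 y * a1 * \<rho> z * b2 * \<sigma>2 t" for x y z t
    unfolding \<tau>_def by (rule lift4_pure; intro L)
  note \<tau>s = \<tau>_pure leg4_defs pure_mult_pure mult.assoc hom_mult[OF h1(1)] antihom_mult[OF h1(2)]
    antihom_mult[OF h2(2)] hom_one[OF h1(1)] antihom_one[OF h1(2)] antihom_one[OF h2(2)]
  have c1: "right_equiv \<tau> ?c34 eta"
    by (rule right_contract4[where h="\<lambda>x y. \<rho> x * b2 * \<sigma>2 y" and c=b2 and R="\<lambda>p q r s u. \<rho> p * b1 * \<sigma>1 q * a1 * \<rho> r * u * \<sigma>2 s"])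
      (intro \<tau> L leg4_linear h2 | simp add: \<tau>s)+
  have c2: "right_equiv \<tau> ?c12 eta"
    by (rule right_contract4[where h="\<lambda>x y. \<rho> x * b1 * \<sigma>1 y" and c=b1 and R="\<lambda>p q r s u. \<rho> p * u * (\<sigma>1 q * a1 * \<rho> r * b2 * \<sigma>2 s)"])
      (intro \<tau> L leg4_linear h1 | simp add: \<tau>s)+
  have c3: "left_equiv \<tau> ?c23 eta"
    by (rule left_contract4[where h="\<lambda>x y. \<sigma>1 x * a1 * \<rho> y" and c=a1 and R="\<lambda>p q r s u. \<rho> p * b1 * \<sigma>1 q * u * (\<rho> r * b2 * \<sigma>2 s)"])
      (intro \<tau> L leg4_linear h1 | simp add: \<tau>s)+
  have "\<tau> (mlift ?l2 (mlift ?l3 ?l4) X)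
      = b1 * tensor_lift3 (\<lambda>x y z. \<sigma>1 x * a1 * \<rho> y * b2 * \<sigma>2 z) X" for X
    by (rule tensor_ext3[where f="\<lambda>X. \<tau> (mlift ?l2 (mlift ?l3 ?l4) X)"])
      (subst lift3_pure | intro L clinear_compose[OF \<tau>] leg4_linear
        | simp add: \<tau>s leg4_lift)+
  then have "b1 * comparison \<sigma>1 a1 \<rho> b2 \<sigma>2 = \<tau> (Phi ?l2 ?l3 ?l4)"
    by (simp add: comparison_def Phi_def)
  also have "Phi ?l2 ?l3 ?l4 = Phi_inv ?l1 ?c23 ?l4
      * (Phi_inv ?l1 ?l2 ?l3
      * (Phi ?c12 ?l3 ?l4 * Phi ?l1 ?l2 ?c34))"
    by (rule Phi_pentagon_rotations(7)) (intro legs)+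
  also have "\<tau> \<dots> = \<tau> (Phi_inv ?l1 eta ?l4
      * (Phi_inv ?l1 ?l2 ?l3
      * (Phi ?c12 ?l3 ?l4 * Phi ?l1 ?l2 ?c34)))"
    by (rule left_Phi2[OF c3 \<tau>]) (intro legs)+
  also have "\<dots> = \<tau> ((Phi_inv ?l1 ?l2 ?l3
      * Phi ?c12 ?l3 ?l4) * Phi ?l1 ?l2 ?c34)"
    by (simp add: Phi_eta2 legs mult.assoc)
  also have "\<dots> = \<tau> ((Phi_inv ?l1 ?l2 ?l3
      * Phi ?c12 ?l3 ?l4) * Phi ?l1 ?l2 eta)"
    by (rule right_Phi3[OF c1 \<tau>]) (intro legs)+
  also have "\<dots> = \<tau> (Phi_inv ?l1 ?l2 ?l3 * Phi ?c12 ?l3 ?l4)"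
    by (simp add: Phi_eta3 legs)
  also have "\<dots> = \<tau> (Phi_inv ?l1 ?l2 ?l3 * Phi eta ?l3 ?l4)"
    by (rule right_Phi1[OF c2 \<tau>]) (intro legs)+
  also have "\<dots> = \<tau> (Phi_inv ?l1 ?l2 ?l3)"
    by (simp add: Phi_eta1 legs)
  also have "\<tau> (Phi_inv ?l1 ?l2 ?l3) = b2"
  proof -
    have "\<tau> (mlift ?l1 (mlift ?l2 ?l3) X)
        = tensor_lift3 (\<lambda>x y z. \<rho> x * b1 * \<sigma>1 y * a1 * \<rho> z) X * b2" for X
      by (rule tensor_ext3[where f="\<lambda>X. \<tau> (mlift ?l1 (mlift ?l2 ?l3) X)"])
        (subst lift3_pure | intro L clinear_compose[OF \<tau>] leg4_linear
          | simp add: \<tau>s leg4_lift)+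
    then show ?thesis
      by (simp add: Phi_inv_def h1)
  qed
  finally show ?thesis .
qed

text \<open>Insert the first zigzag identity of \<open>\<sigma>2\<close> to the right of \<open>u\<close>, and move \<open>u\<close> past \<open>\<sigma>2\<close> and \<open>a2\<close>.\<close>

lemma comparison_unique:
  assumes 1: "antipode_along \<rho> \<sigma>1 a1 b1" and 2: "antipode_along \<rho> \<sigma>2 a2 b2"
    and i: "\<And>c. \<sigma>1 c * u = u * \<sigma>2 c" and a: "u * a2 = a1"
  shows "u = comparison \<sigma>1 a1 \<rho> b2 \<sigma>2"
proof -
  note h1 = antipode_alongD[OF 1] and h2 = antipode_alongD[OF 2]
  note l = hom_linear[OF h1(1)] antihom_linear[OF h1(2)] antihom_linear[OF h2(2)]
  note L = lin l[THEN clinear_compose] l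
  have "u * tensor_lift3 (\<lambda>x y z. \<sigma>2 x * a2 * \<rho> y * b2 * \<sigma>2 z) X
      = tensor_lift3 (\<lambda>x y z. \<sigma>1 x * a1 * \<rho> y * b2 * \<sigma>2 z) X" for X
  proof (rule tensor_ext3[where f="\<lambda>X. u * tensor_lift3 (\<lambda>x y z. \<sigma>2 x * a2 * \<rho> y * b2 * \<sigma>2 z) X"
        and g="\<lambda>X. tensor_lift3 (\<lambda>x y z. \<sigma>1 x * a1 * \<rho> y * b2 * \<sigma>2 z) X"])
    fix x y z
    have "u * (\<sigma>2 x * a2 * \<rho> y * b2 * \<sigma>2 z) = \<sigma>1 x * (u * a2) * \<rho> y * b2 * \<sigma>2 z"
      by (simp add: i flip: mult.assoc)
    moreover have "tensor_lift3 (\<lambda>x y z. \<sigma>2 x * a2 * \<rho> y * b2 * \<sigma>2 z) (x \<otimes> y \<otimes> z)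
        = \<sigma>2 x * a2 * \<rho> y * b2 * \<sigma>2 z"
      by (rule lift3_pure; intro L)
    moreover have "tensor_lift3 (\<lambda>x y z. \<sigma>1 x * a1 * \<rho> y * b2 * \<sigma>2 z) (x \<otimes> y \<otimes> z)
        = \<sigma>1 x * a1 * \<rho> y * b2 * \<sigma>2 z"
      by (rule lift3_pure; intro L)
    ultimately show "u * tensor_lift3 (\<lambda>x y z. \<sigma>2 x * a2 * \<rho> y * b2 * \<sigma>2 z) (x \<otimes> y \<otimes> z)
        = tensor_lift3 (\<lambda>x y z. \<sigma>1 x * a1 * \<rho> y * b2 * \<sigma>2 z) (x \<otimes> y \<otimes> z)"
      by (simp add: a)
  qed (intro L)+
  from this[of "coassociator H"] show ?thesis
    by (simp add: h2 comparison_def)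
qed

lemma comparison_self: "antipode_along \<rho> \<sigma> a b \<Longrightarrow> comparison \<sigma> a \<rho> b \<sigma> = 1"
  by (simp add: antipode_along_def comparison_def)

text \<open>The product of the two comparison elements has the two properties that determine
\<open>comparison \<sigma>1 a1 \<rho> b1 \<sigma>1 = 1\<close>.\<close>

lemma comparison_inverse:
  assumes 1: "antipode_along \<rho> \<sigma>1 a1 b1" and 2: "antipode_along \<rho> \<sigma>2 a2 b2"
  shows "comparison \<sigma>1 a1 \<rho> b2 \<sigma>2 * comparison \<sigma>2 a2 \<rho> b1 \<sigma>1 = 1"
proof -
  let ?w = "comparison \<sigma>1 a1 \<rho> b2 \<sigma>2" and ?v = "comparison \<sigma>2 a2 \<rho> b1 \<sigma>1"
  have "?w * ?v = comparison \<sigma>1 a1 \<rho> b1 \<sigma>1"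
  proof (rule comparison_unique[OF 1 1])
    show "\<sigma>1 c * (?w * ?v) = ?w * ?v * \<sigma>1 c" for c
    proof -
      have "\<sigma>1 c * ?w * ?v = ?w * (\<sigma>2 c * ?v)"
        by (simp add: comparison_intertwines[OF 1 2] mult.assoc)
      then show ?thesis
        by (simp add: comparison_intertwines[OF 2 1] mult.assoc)
    qed
    show "?w * ?v * a1 = a1"
      by (simp add: comparison_alpha[OF 1 2] comparison_alpha[OF 2 1] mult.assoc)
  qed
  then show ?thesis by (simp add: comparison_self[OF 1])
qed

end

section \<open>The dual of the coproduct representation\<close>

lemma leg4_mlift: "mlift leg41 (mlift leg42 (mlift leg43 leg44)) X = X"
  by (rule tensor_ext4[where f="mlift leg41 (mlift leg42 (mlift leg43 leg44))"])
    (intro lin leg4_linear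
      | simp add: mlift_pure leg4_linear clinear_mlift leg4_defs pure_mult_pure)+

context quasi_hopf_algebra
begin

lemma Phi_commutes:
  assumes "algebra_hom f" "algebra_hom g" "algebra_hom h"
    and "commuting k f" "commuting k g" "commuting k h"
  shows "Phi f g h * k a = k a * Phi f g h" "Phi_inv f g h * k a = k a * Phi_inv f g h"
  using commuting_mlift[OF _ _ assms(4) commuting_mlift[OF _ _ assms(5,6)]] assms(1-3)
  by (simp_all add: Phi_def Phi_inv_def hom_linear clinear_mlift commuting_def)

lemma conv_intertwine:
  assumes "clinear f" "clinear g" "clinear f'" "clinear g'"
    and "\<And>x. u * f x = f' x * u" "\<And>y. u * g y = g' y * u"
  shows "u * conv f g a = conv f' g' a * u"
  unfolding conv_def by (rule mlift_intertwine; fact assms)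

text \<open>The axioms of the antipode are preserved by applying a homomorphism to them.\<close>

lemma antipode_along_antipode:
  assumes "algebra_hom \<psi>"
  shows "antipode_along \<psi> (\<lambda>x. \<psi> (antipode H x)) (\<psi> (alpha H)) (\<psi> (beta H))"
proof -
  note L = lin hom_linear[OF assms] hom_linear[OF assms, THEN clinear_compose]
  have 2: "tensor_lift (\<lambda>x y. \<psi> (h x y)) t = \<psi> (tensor_lift h t)" if "bilinear h" for h :: "'h \<Rightarrow> 'h \<Rightarrow> 'h" and t
    by (rule tensor_ext[where g="\<lambda>t. \<psi> (tensor_lift h t)"])
      (intro L that[unfolded bilinear_def, THEN conjunct1, rule_format]
        that[unfolded bilinear_def, THEN conjunct2, rule_format] that clinear_lift
      | simp add: lift_pure that
      | subst lift_pure)+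
  have 3: "tensor_lift3 (\<lambda>x y z. \<psi> (h x y z)) t = \<psi> (tensor_lift3 h t)"
    if "\<And>b c. clinear (\<lambda>a. h a b c)" "\<And>a c. clinear (\<lambda>b. h a b c)" "\<And>a b. clinear (\<lambda>c. h a b c)"
    for h :: "'h \<Rightarrow> 'h \<Rightarrow> 'h \<Rightarrow> 'h" and t
    by (rule tensor_ext3[where g="\<lambda>t. \<psi> (tensor_lift3 h t)"])
      (intro L that | simp add: lift3_pure that | subst lift3_pure)+
  have "algebra_antihom (\<lambda>x. \<psi> (antipode H x))"
    using assms antipode_antihom by (simp add: algebra_antihom_def algebra_hom_def clinear_compose)
  moreover have "tensor_lift (\<lambda>x y. \<psi> (antipode H x) * \<psi> (alpha H) * \<psi> y) (comult H x)
      = counit H x *\<^sub>C \<psi> (alpha H)" for x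
    using 2[of "\<lambda>x y. antipode H x * alpha H * y" "comult H x"]
    by (simp add: hom_mult[OF assms] lin antipode_alpha clinear_scaleC[OF hom_linear[OF assms]])
  moreover have "tensor_lift (\<lambda>x y. \<psi> x * \<psi> (beta H) * \<psi> (antipode H y)) (comult H x)
      = counit H x *\<^sub>C \<psi> (beta H)" for x
    using 2[of "\<lambda>x y. x * beta H * antipode H y" "comult H x"]
    by (simp add: hom_mult[OF assms] lin antipode_beta clinear_scaleC[OF hom_linear[OF assms]])
  moreover have "tensor_lift3 (\<lambda>x y z. \<psi> (antipode H x) * \<psi> (alpha H) * \<psi> y * \<psi> (beta H)
      * \<psi> (antipode H z)) (coassociator H) = 1"
    using 3[of "\<lambda>x y z. antipode H x * alpha H * y * beta H * antipode H z" "coassociator H"]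
    by (simp add: hom_mult[OF assms] hom_one[OF assms] lin clinear_antipode antipode_coassociator)
  moreover have "tensor_lift3 (\<lambda>x y z. \<psi> x * \<psi> (beta H) * \<psi> (antipode H y) * \<psi> (alpha H)
      * \<psi> z) (inv_el (coassociator H)) = 1"
    using 3[of "\<lambda>x y z. x * beta H * antipode H y * alpha H * z" "inv_el (coassociator H)"]
    by (simp add: hom_mult[OF assms] hom_one[OF assms] lin antipode_coassociator_inv)
  ultimately show ?thesis
    unfolding antipode_along_def using assms by blast
qed

text \<open>\<open>(S \<otimes> S)\<close> after the flip. As an antihomomorphism it composes with the coproduct to the dual of
\<open>\<Delta>\<close>: the dual of a tensor product is the tensor product of the duals in reversed order.\<close>

definition antipode2 :: "'h \<otimes> 'h \<Rightarrow> 'h \<otimes> 'h"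
  where "antipode2 t = tensor_map (antipode H) (antipode H) (flip t)"

lemma antipode2_pure: "antipode2 (a \<otimes> b) = antipode H b \<otimes> antipode H a"
  by (simp add: antipode2_def tensor_map_pure_linear clinear_antipode)

lemma clinear_antipode2: "clinear antipode2"
  unfolding antipode2_def[abs_def] by (intro lin clinear_antipode)

lemmas clinear_antipode2_of [lin] = clinear_compose[OF clinear_antipode2]

lemma antipode2_antihom: "algebra_antihom antipode2"
proof -
  have "antipode2 (s * t) = antipode2 t * antipode2 s" for s t
    by (rule tensor_ext22[where f="\<lambda>s t. antipode2 (s * t)" and g="\<lambda>s t. antipode2 t * antipode2 s"])
      (intro lin clinear_antipode2
        | simp add: antipode2_pure pure_mult_pure antihom_mult[OF antipode_antihom])+
  then show ?thesis
    by (simp add: algebra_antihom_def clinear_antipode2 one_tensor_def antipode2_pure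
        antihom_one[OF antipode_antihom])
qed

text \<open>Evaluation and coevaluation for a tensor product are nested: the inner pair of legs is \<open>(2, 3)\<close>, the
outer pair \<open>(1, 4)\<close>. The rebracketing of the four factors supplies the arguments of these maps.\<close>

definition gamma_map :: "'h \<otimes> 'h \<otimes> 'h \<otimes> 'h \<Rightarrow> 'h \<otimes> 'h"
  where "gamma_map =
    tensor_lift4 (\<lambda>a b c d. (antipode H b * alpha H * c) \<otimes> (antipode H a * alpha H * d))"

definition gamma_bar_map :: "'h \<otimes> 'h \<otimes> 'h \<otimes> 'h \<Rightarrow> 'h \<otimes> 'h"
  where "gamma_bar_map =
    tensor_lift4 (\<lambda>a b c d. (a * beta H * antipode H d) \<otimes> (b * beta H * antipode H c))"

definition gamma_bar :: "'h \<otimes> 'h"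
  where "gamma_bar = gamma_bar_map
    (comult_fst H (inv_el (coassociator H)) * tensor3_one (coassociator H))"

lemma clinear_gamma_map: "clinear gamma_map"
  unfolding gamma_map_def by (rule clinear_lift4_of[OF _ _ _ _ clinear_ident]; intro lin clinear_antipode)

lemma clinear_gamma_bar_map: "clinear gamma_bar_map"
  unfolding gamma_bar_map_def by (rule clinear_lift4_of[OF _ _ _ _ clinear_ident]; intro lin clinear_antipode)

lemma gamma_map_pure:
  "gamma_map (a \<otimes> b \<otimes> c \<otimes> d) = (antipode H b * alpha H * c) \<otimes> (antipode H a * alpha H * d)"
  unfolding gamma_map_def by (rule lift4_pure; intro lin clinear_antipode)

lemma gamma_bar_map_pure:
  "gamma_bar_map (a \<otimes> b \<otimes> c \<otimes> d) = (a * beta H * antipode H d) \<otimes> (b * beta H * antipode H c)"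
  unfolding gamma_bar_map_def by (rule lift4_pure; intro lin clinear_antipode)

lemmas clinear_gamma_map_of [lin] = clinear_compose[OF clinear_gamma_map]
lemmas clinear_gamma_bar_map_of [lin] = clinear_compose[OF clinear_gamma_bar_map]

lemmas S_simps = antihom_mult[OF antipode_antihom] antihom_one[OF antipode_antihom]

lemma gamma_left_contract:
  "left_equiv gamma_map (conv leg42 leg43) eta" "left_equiv gamma_map (conv leg41 leg44) eta"
proof -
  note s = gamma_map_pure leg4_defs pure_mult_pure mult.assoc S_simps
  show "left_equiv gamma_map (conv leg42 leg43) eta"
    by (rule left_contract4[where h="\<lambda>x y. antipode H x * alpha H * y" and c="alpha H" and
          R="\<lambda>p q r s u. (antipode H q * u * r) \<otimes> (antipode H p * alpha H * s)"])
      (intro clinear_gamma_map lin clinear_antipode leg4_linear antipode_alpha | simp add: s)+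
  show "left_equiv gamma_map (conv leg41 leg44) eta"
    by (rule left_contract4[where h="\<lambda>x y. antipode H x * alpha H * y" and c="alpha H" and
          R="\<lambda>p q r s u. (antipode H q * alpha H * r) \<otimes> (antipode H p * u * s)"])
      (intro clinear_gamma_map lin clinear_antipode leg4_linear antipode_alpha | simp add: s)+
qed

lemma gamma_bar_right_contract:
  "right_equiv gamma_bar_map (conv leg42 leg43) eta" "right_equiv gamma_bar_map (conv leg41 leg44) eta"
proof -
  note s = gamma_bar_map_pure leg4_defs pure_mult_pure mult.assoc S_simps
  show "right_equiv gamma_bar_map (conv leg42 leg43) eta"
    by (rule right_contract4[where h="\<lambda>x y. x * beta H * antipode H y" and c="beta H" and
          R="\<lambda>p q r s u. (p * beta H * antipode H s) \<otimes> (q * u * antipode H r)"])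
      (intro clinear_gamma_bar_map lin clinear_antipode leg4_linear antipode_beta | simp add: s)+
  show "right_equiv gamma_bar_map (conv leg41 leg44) eta"
    by (rule right_contract4[where h="\<lambda>x y. x * beta H * antipode H y" and c="beta H" and
          R="\<lambda>p q r s u. (p * u * antipode H s) \<otimes> (q * beta H * antipode H r)"])
      (intro clinear_gamma_bar_map lin clinear_antipode leg4_linear antipode_beta | simp add: s)+
qed

lemma gamma_legs:
  assumes "algebra_hom f" "algebra_hom g" "algebra_hom h" "algebra_hom k"
    and "commuting f g" "commuting f h" "commuting f k" "commuting g h" "commuting g k" "commuting h k"
  shows "mlift f (mlift g (mlift h k)) (tensor3_one (inv_el (coassociator H)) * comult_fst H (coassociator H))
      = Phi_inv f g h * Phi (conv f g) h k"
    and "mlift f (mlift g (mlift h k)) (comult_fst H (inv_el (coassociator H)) * tensor3_one (coassociator H))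
      = Phi_inv (conv f g) h k * Phi f g h"
proof -
  have hom: "algebra_hom (mlift f (mlift g (mlift h k)))"
    by (intro legs assms)
  note l = assms(1-4)[THEN hom_linear]
  show "mlift f (mlift g (mlift h k)) (tensor3_one (inv_el (coassociator H)) * comult_fst H (coassociator H))
      = Phi_inv f g h * Phi (conv f g) h k"
    by (simp add: hom_mult[OF hom] mlift_tensor3_one mlift_comult_fst l assms clinear_mlift
        Phi_def Phi_inv_def)
  show "mlift f (mlift g (mlift h k)) (comult_fst H (inv_el (coassociator H)) * tensor3_one (coassociator H))
      = Phi_inv (conv f g) h k * Phi f g h"
    by (simp add: hom_mult[OF hom] mlift_tensor3_one mlift_comult_fst l assms clinear_mlift
        Phi_def Phi_inv_def)
qed

lemma drinfeld_gamma_legs: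
  "drinfeld_gamma H = gamma_map (Phi_inv leg41 leg42 leg43 * Phi (conv leg41 leg42) leg43 leg44)"
proof -
  have "Phi_inv leg41 leg42 leg43 * Phi (conv leg41 leg42) leg43 leg44
      = tensor3_one (inv_el (coassociator H)) * comult_fst H (coassociator H)"
    by (subst gamma_legs(1)[symmetric]) (intro legs | simp add: leg4_mlift)+
  then show ?thesis
    by (simp add: drinfeld_gamma_def gamma_map_def)
qed

lemma gamma_bar_legs:
  "gamma_bar = gamma_bar_map (Phi_inv (conv leg41 leg42) leg43 leg44 * Phi leg41 leg42 leg43)"
proof -
  have "Phi_inv (conv leg41 leg42) leg43 leg44 * Phi leg41 leg42 leg43
      = comult_fst H (inv_el (coassociator H)) * tensor3_one (coassociator H)"
    by (subst gamma_legs(2)[symmetric]) (intro legs | simp add: leg4_mlift)+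
  then show ?thesis
    by (simp add: gamma_bar_def)
qed

lemma leg4_mlift2:
  "mlift leg41 leg42 (a \<otimes> b) = a \<otimes> b \<otimes> 1 \<otimes> 1"
  "mlift leg43 leg44 (a \<otimes> b) = 1 \<otimes> 1 \<otimes> a \<otimes> b"
  by (simp_all add: mlift_pure leg4_linear) (simp_all add: leg4_defs pure_mult_pure)

text \<open>Factors at the right end of a word leave \<open>gamma_map\<close>: those on the first two legs through the antipode
to the left, those on the last two legs to the right. Factors at the left end are the ones that get
contracted.\<close>

lemma gamma_map_outer:
  "gamma_map (T * (mlift leg41 leg42 s * mlift leg43 leg44 t)) = antipode2 s * gamma_map T * t"
proof (rule tensor_ext4[where t=T and f="\<lambda>T. gamma_map (T * (mlift leg41 leg42 s * mlift leg43 leg44 t))"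
      and g="\<lambda>T. antipode2 s * gamma_map T * t"])
  fix p q r v
  show "gamma_map ((p \<otimes> q \<otimes> r \<otimes> v) * (mlift leg41 leg42 s * mlift leg43 leg44 t))
      = antipode2 s * gamma_map (p \<otimes> q \<otimes> r \<otimes> v) * t"
    by (rule tensor_ext22[where f="\<lambda>s t. gamma_map ((p \<otimes> q \<otimes> r \<otimes> v) * (mlift leg41 leg42 s * mlift leg43 leg44 t))"
          and g="\<lambda>s t. antipode2 s * gamma_map (p \<otimes> q \<otimes> r \<otimes> v) * t"])
      (intro lin leg4_linear clinear_antipode2
        | simp add: leg4_mlift2 gamma_map_pure antipode2_pure pure_mult_pure S_simps mult.assoc)+
qed (intro lin leg4_linear clinear_gamma_map)+

lemma gamma_bar_map_outer:
  "gamma_bar_map (mlift leg41 leg42 s * mlift leg43 leg44 t * T) = s * gamma_bar_map T * antipode2 t"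
proof (rule tensor_ext4[where t=T and f="\<lambda>T. gamma_bar_map (mlift leg41 leg42 s * mlift leg43 leg44 t * T)"
      and g="\<lambda>T. s * gamma_bar_map T * antipode2 t"])
  fix p q r v
  show "gamma_bar_map (mlift leg41 leg42 s * mlift leg43 leg44 t * (p \<otimes> q \<otimes> r \<otimes> v))
      = s * gamma_bar_map (p \<otimes> q \<otimes> r \<otimes> v) * antipode2 t"
    by (rule tensor_ext22[where f="\<lambda>s t. gamma_bar_map (mlift leg41 leg42 s * mlift leg43 leg44 t * (p \<otimes> q \<otimes> r \<otimes> v))"
          and g="\<lambda>s t. s * gamma_bar_map (p \<otimes> q \<otimes> r \<otimes> v) * antipode2 t"])
      (intro lin leg4_linear clinear_antipode2
        | simp add: leg4_mlift2 gamma_bar_map_pure antipode2_pure pure_mult_pure S_simps mult.assoc)+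
qed (intro lin leg4_linear clinear_gamma_bar_map)+

lemma gamma_map_conv:
  "gamma_map (T * mlift (conv leg41 leg42) (conv leg43 leg44) t)
    = tensor_lift (\<lambda>x y. antipode2 (comult H x) * gamma_map T * comult H y) t"
  by (rule tensor_ext[where f="\<lambda>t. gamma_map (T * mlift (conv leg41 leg42) (conv leg43 leg44) t)"])
    (intro lin leg4_linear clinear_conv clinear_comult | subst lift_pure
      | simp add: mlift_pure leg4_linear clinear_conv | simp add: conv_def gamma_map_outer)+

text \<open>The coproduct of \<open>a\<close> on four legs passes from the right end of the word that defines \<open>\<gamma>\<close> to the left
end. On its way its bracketing \<open>(12)(34)\<close> becomes \<open>((12)3)4\<close> and then \<open>(1(23))4\<close>, in which first
\<open>(23)\<close> and then \<open>14\<close> is contracted.\<close>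

lemma gamma_invariant:
  "tensor_lift (\<lambda>x y. antipode2 (comult H x) * drinfeld_gamma H * comult H y) (comult H a)
    = counit H a *\<^sub>C drinfeld_gamma H"
proof -
  let ?c = conv
  let ?G = "Phi_inv leg41 leg42 leg43 * Phi (?c leg41 leg42) leg43 leg44"
  have "tensor_lift (\<lambda>x y. antipode2 (comult H x) * drinfeld_gamma H * comult H y) (comult H a)
      = gamma_map (?G * ?c (?c leg41 leg42) (?c leg43 leg44) a)"
    by (simp add: drinfeld_gamma_legs gamma_map_conv[symmetric] conv_def[of "conv leg41 leg42"])
  also have "?G * ?c (?c leg41 leg42) (?c leg43 leg44) a
      = Phi_inv leg41 leg42 leg43 * ?c (?c (?c leg41 leg42) leg43) leg44 a * Phi (?c leg41 leg42) leg43 leg44"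
    by (simp only: mult.assoc, subst Phi_conv) (intro legs | simp)+
  also have "Phi_inv leg41 leg42 leg43 * ?c (?c (?c leg41 leg42) leg43) leg44 a
      = ?c (?c leg41 (?c leg42 leg43)) leg44 a * Phi_inv leg41 leg42 leg43"
  proof (rule conv_intertwine)
    show "Phi_inv leg41 leg42 leg43 * leg44 y = leg44 y * Phi_inv leg41 leg42 leg43" for y
      by (intro Phi_commutes legs)
  qed (intro legs hom_linear Phi_inv_conv)+
  also have "gamma_map (\<dots> * Phi (?c leg41 leg42) leg43 leg44) = gamma_map (?c (?c leg41 (?c leg42 leg43)) leg44 a * ?G)"
    by (simp add: mult.assoc)
  also have "\<dots> = gamma_map (?c (?c leg41 eta) leg44 a * ?G)"
    by (rule left_equivD, rule left_equiv_conv1, rule left_equiv_conv2)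
      (intro gamma_left_contract legs hom_linear clinear_gamma_map)+
  also have "\<dots> = gamma_map (eta a * ?G)"
    by (simp add: conv_eta legs left_equivD[OF gamma_left_contract(2)])
  also have "\<dots> = counit H a *\<^sub>C drinfeld_gamma H"
    by (simp add: eta_mult clinear_scaleC[OF clinear_gamma_map] drinfeld_gamma_legs)
  finally show ?thesis .
qed

text \<open>The same passage in the opposite direction.\<close>

lemma gamma_bar_invariant:
  "tensor_lift (\<lambda>x y. comult H x * gamma_bar * antipode2 (comult H y)) (comult H a)
    = counit H a *\<^sub>C gamma_bar"
proof -
  let ?c = conv
  let ?G = "Phi_inv (?c leg41 leg42) leg43 leg44 * Phi leg41 leg42 leg43"
  let ?M = "mlift (?c leg41 leg42) (?c leg43 leg44)"
  have "gamma_bar_map (?M t * T) = tensor_lift (\<lambda>x y. comult H x * gamma_bar_map T * antipode2 (comult H y)) t" for T t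
    by (rule tensor_ext[where f="\<lambda>t. gamma_bar_map (?M t * T)"])
      (intro lin leg4_linear clinear_conv clinear_comult | subst lift_pure
        | simp add: mlift_pure leg4_linear clinear_conv | simp add: conv_def gamma_bar_map_outer)+
  then have "tensor_lift (\<lambda>x y. comult H x * gamma_bar * antipode2 (comult H y)) (comult H a)
      = gamma_bar_map (?c (?c leg41 leg42) (?c leg43 leg44) a * ?G)"
    by (simp add: gamma_bar_legs conv_def[of "conv leg41 leg42"])
  also have "?c (?c leg41 leg42) (?c leg43 leg44) a * ?G
      = Phi_inv (?c leg41 leg42) leg43 leg44 * (?c (?c (?c leg41 leg42) leg43) leg44 a * Phi leg41 leg42 leg43)"
    by (simp only: mult.assoc[symmetric], subst Phi_inv_conv[symmetric]) (intro legs | simp)+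
  also have "?c (?c (?c leg41 leg42) leg43) leg44 a * Phi leg41 leg42 leg43
      = Phi leg41 leg42 leg43 * ?c (?c leg41 (?c leg42 leg43)) leg44 a"
  proof (rule conv_intertwine[symmetric])
    show "Phi leg41 leg42 leg43 * leg44 y = leg44 y * Phi leg41 leg42 leg43" for y
      by (intro Phi_commutes legs)
  qed (intro legs hom_linear Phi_conv)+
  also have "gamma_bar_map (Phi_inv (?c leg41 leg42) leg43 leg44 * \<dots>)
      = gamma_bar_map (?G * ?c (?c leg41 (?c leg42 leg43)) leg44 a)"
    by (simp add: mult.assoc)
  also have "\<dots> = gamma_bar_map (?G * ?c (?c leg41 eta) leg44 a)"
    by (rule right_equivD, rule right_equiv_conv1, rule right_equiv_conv2)
      (intro gamma_bar_right_contract legs hom_linear clinear_gamma_bar_map)+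
  also have "\<dots> = gamma_bar_map (?G * eta a)"
    by (simp add: conv_eta legs right_equivD[OF gamma_bar_right_contract(2)])
  also have "\<dots> = counit H a *\<^sub>C gamma_bar"
    by (simp add: eta_mult clinear_scaleC[OF clinear_gamma_bar_map] gamma_bar_legs)
  finally show ?thesis .
qed

end

section \<open>The zigzag identities for the coproduct\<close>

definition tensor_lift6 where
  "tensor_lift6 h = tensor_lift (\<lambda>a. tensor_lift (\<lambda>b. tensor_lift4 (h a b)))"

lemma tensor_lift6_rules:
  assumes "\<And>b c d e k. clinear (\<lambda>a. h a b c d e k)" "\<And>a c d e k. clinear (\<lambda>b. h a b c d e k)"
    "\<And>a b d e k. clinear (\<lambda>c. h a b c d e k)" "\<And>a b c e k. clinear (\<lambda>d. h a b c d e k)"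
    "\<And>a b c d k. clinear (\<lambda>e. h a b c d e k)" "\<And>a b c d e. clinear (\<lambda>k. h a b c d e k)"
  shows "clinear (tensor_lift6 h)"
    and "tensor_lift6 h (a \<otimes> b \<otimes> c \<otimes> d \<otimes> e \<otimes> k) = h a b c d e k"
proof -
  have 1: "bilinear (\<lambda>c. tensor_lift3 (h a b c))" for a b
    by (rule bilinear_lift4; rule assms)
  have 2: "bilinear (\<lambda>d. tensor_lift (h a b c d))" "bilinear (h a b c d)" for a b c d
    by (rule bilinear_lift3; rule assms)+
  have 3: "bilinear (\<lambda>b. tensor_lift4 (h a b))" for a
    unfolding tensor_lift4_def tensor_lift3_def
    by (intro bilinearI clinear_lift_param clinear_lift 1[unfolded tensor_lift3_def] 2 assms)
  have 4: "bilinear (\<lambda>a. tensor_lift (\<lambda>b. tensor_lift4 (h a b)))"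
    unfolding tensor_lift4_def tensor_lift3_def
    by (intro bilinearI clinear_lift_param clinear_lift 3[unfolded tensor_lift3_def tensor_lift4_def]
        1[unfolded tensor_lift3_def] 2 assms)
  show "clinear (tensor_lift6 h)"
    unfolding tensor_lift6_def by (rule clinear_lift[OF 4])
  have "tensor_lift4 (h a b) (c \<otimes> d \<otimes> e \<otimes> k) = h a b c d e k"
    by (rule lift4_pure; rule assms)
  then show "tensor_lift6 h (a \<otimes> b \<otimes> c \<otimes> d \<otimes> e \<otimes> k) = h a b c d e k"
    unfolding tensor_lift6_def by (simp add: lift_pure 3 4)
qed

definition leg61 :: "'a::complex_algebra_1 \<Rightarrow> 'a \<otimes> 'a \<otimes> 'a \<otimes> 'a \<otimes> 'a \<otimes> 'a"
  where "leg61 a = a \<otimes> 1 \<otimes> 1 \<otimes> 1 \<otimes> 1 \<otimes> 1"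
definition leg62 :: "'a::complex_algebra_1 \<Rightarrow> 'a \<otimes> 'a \<otimes> 'a \<otimes> 'a \<otimes> 'a \<otimes> 'a"
  where "leg62 a = 1 \<otimes> a \<otimes> 1 \<otimes> 1 \<otimes> 1 \<otimes> 1"
definition leg63 :: "'a::complex_algebra_1 \<Rightarrow> 'a \<otimes> 'a \<otimes> 'a \<otimes> 'a \<otimes> 'a \<otimes> 'a"
  where "leg63 a = 1 \<otimes> 1 \<otimes> a \<otimes> 1 \<otimes> 1 \<otimes> 1"
definition leg64 :: "'a::complex_algebra_1 \<Rightarrow> 'a \<otimes> 'a \<otimes> 'a \<otimes> 'a \<otimes> 'a \<otimes> 'a"
  where "leg64 a = 1 \<otimes> 1 \<otimes> 1 \<otimes> a \<otimes> 1 \<otimes> 1"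
definition leg65 :: "'a::complex_algebra_1 \<Rightarrow> 'a \<otimes> 'a \<otimes> 'a \<otimes> 'a \<otimes> 'a \<otimes> 'a"
  where "leg65 a = 1 \<otimes> 1 \<otimes> 1 \<otimes> 1 \<otimes> a \<otimes> 1"
definition leg66 :: "'a::complex_algebra_1 \<Rightarrow> 'a \<otimes> 'a \<otimes> 'a \<otimes> 'a \<otimes> 'a \<otimes> 'a"
  where "leg66 a = 1 \<otimes> 1 \<otimes> 1 \<otimes> 1 \<otimes> 1 \<otimes> a"

lemmas leg6_defs = leg61_def leg62_def leg63_def leg64_def leg65_def leg66_def

lemma leg6_hom [legs]:
  "algebra_hom leg61" "algebra_hom leg62" "algebra_hom leg63"
  "algebra_hom leg64" "algebra_hom leg65" "algebra_hom leg66"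
  unfolding algebra_hom_def leg6_defs[abs_def]
  by (intro conjI lin allI; simp add: one_tensor_def pure_mult_pure)+

lemma leg6_commuting [legs]:
  "commuting leg61 leg62" "commuting leg61 leg63" "commuting leg61 leg64"
  "commuting leg61 leg65" "commuting leg61 leg66" "commuting leg62 leg63"
  "commuting leg62 leg64" "commuting leg62 leg65" "commuting leg62 leg66"
  "commuting leg63 leg64" "commuting leg63 leg65" "commuting leg63 leg66"
  "commuting leg64 leg65" "commuting leg64 leg66" "commuting leg65 leg66"
  "commuting leg62 leg61" "commuting leg63 leg61" "commuting leg64 leg61"
  "commuting leg65 leg61" "commuting leg66 leg61" "commuting leg63 leg62"
  "commuting leg64 leg62" "commuting leg65 leg62" "commuting leg66 leg62"
  "commuting leg64 leg63" "commuting leg65 leg63" "commuting leg66 leg63"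
  "commuting leg65 leg64" "commuting leg66 leg64" "commuting leg66 leg65"
  by (simp_all add: commuting_def leg6_defs pure_mult_pure)

lemmas leg6_linear = leg6_hom[THEN hom_linear]

lemma leg6_lift:
  "mlift leg61 leg62 (a \<otimes> b) = a \<otimes> b \<otimes> 1 \<otimes> 1 \<otimes> 1 \<otimes> 1"
  "mlift leg63 leg64 (a \<otimes> b) = 1 \<otimes> 1 \<otimes> a \<otimes> b \<otimes> 1 \<otimes> 1"
  "mlift leg65 leg66 (a \<otimes> b) = 1 \<otimes> 1 \<otimes> 1 \<otimes> 1 \<otimes> a \<otimes> b"
  "mlift leg61 (mlift leg62 (mlift leg63 leg64)) (a \<otimes> b \<otimes> c \<otimes> d) = a \<otimes> b \<otimes> c \<otimes> d \<otimes> 1 \<otimes> 1"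
  "mlift leg63 (mlift leg64 (mlift leg65 leg66)) (a \<otimes> b \<otimes> c \<otimes> d) = 1 \<otimes> 1 \<otimes> a \<otimes> b \<otimes> c \<otimes> d"
  "mlift leg61 (mlift leg64 leg65) (a \<otimes> b \<otimes> c) = a \<otimes> 1 \<otimes> 1 \<otimes> b \<otimes> c \<otimes> 1"
  "mlift leg62 (mlift leg63 leg66) (a \<otimes> b \<otimes> c) = 1 \<otimes> a \<otimes> b \<otimes> 1 \<otimes> 1 \<otimes> c"
  by (simp_all add: mlift_pure clinear_mlift leg6_linear) (simp_all add: leg6_defs pure_mult_pure)

context quasi_hopf_algebra
begin

lemma Phi_natural:
  assumes "clinear f" "clinear g" "clinear h" "clinear f'" "clinear g'" "clinear h'"
    and "\<And>x. u * f x = f' x * u" "\<And>x. u * g x = g' x * u" "\<And>x. u * h x = h' x * u"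
  shows "u * Phi f g h = Phi f' g' h' * u" "u * Phi_inv f g h = Phi_inv f' g' h' * u"
  unfolding Phi_def Phi_inv_def
  by (intro mlift_intertwine clinear_mlift assms)+

lemma gamma_as_image:
  "drinfeld_gamma H = gamma_map (tensor3_one (inv_el (coassociator H)) * comult_fst H (coassociator H))"
  by (simp add: drinfeld_gamma_def gamma_map_def)

text \<open>The expression is \<open>\<tau>\<close> of a word on six legs, where \<open>\<tau>\<close> joins the legs \<open>1, 4, 5\<close> and the legs
\<open>2, 3, 6\<close> to one zigzag each. Under \<open>\<tau>\<close>, the pairs \<open>45\<close> and \<open>36\<close> are contracted at the left end and
\<open>23\<close> and \<open>14\<close> at the right end. Pentagons and contractions reduce the word to
\<open>\<Phi>\<^sup>-\<^sup>1\<close> on \<open>2, 3, 6\<close> times \<open>\<Phi>\<^sup>-\<^sup>1\<close> on \<open>1, 4, 5\<close>, which is the zigzag identity of \<open>H\<close> in each tensor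
factor.\<close>

lemma drinfeld_zigzag_right:
  "tensor_lift3 (\<lambda>x y z. comult H x * gamma_bar * antipode2 (comult H y) * drinfeld_gamma H * comult H z)
    (inv_el (coassociator H)) = 1"
proof -
  let ?l1 = "leg61 :: 'h \<Rightarrow> _" and ?l2 = "leg62 :: 'h \<Rightarrow> _" and ?l3 = "leg63 :: 'h \<Rightarrow> _"
  let ?l4 = "leg64 :: 'h \<Rightarrow> _" and ?l5 = "leg65 :: 'h \<Rightarrow> _" and ?l6 = "leg66 :: 'h \<Rightarrow> _"
  let ?c12 = "conv ?l1 ?l2" and ?c34 = "conv ?l3 ?l4" and ?c56 = "conv ?l5 ?l6" and ?c14 = "conv ?l1 ?l4"
  let ?c23 = "conv ?l2 ?l3" and ?c45 = "conv ?l4 ?l5" and ?c36 = "conv ?l3 ?l6"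
  let ?S = "antipode H" and ?\<alpha> = "alpha H" and ?\<beta> = "beta H"
  define \<tau> where "\<tau> = tensor_lift6 (\<lambda>a b c d e k. (a * ?\<beta> * ?S d * ?\<alpha> * e) \<otimes> (b * ?\<beta> * ?S c * ?\<alpha> * k))"
  have \<tau>: "clinear \<tau>"
    unfolding \<tau>_def by (rule tensor_lift6_rules(1); intro lin)
  have \<tau>_pure: "\<tau> (a \<otimes> b \<otimes> c \<otimes> d \<otimes> e \<otimes> k) = (a * ?\<beta> * ?S d * ?\<alpha> * e) \<otimes> (b * ?\<beta> * ?S c * ?\<alpha> * k)"
    for a b c d e k
    unfolding \<tau>_def by (rule tensor_lift6_rules(2); intro lin)
  note s = \<tau>_pure pure_mult_pure mult.assoc S_simps
  have l45: "left_equiv \<tau> ?c45 eta"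
    by (rule left_contract6[where h="\<lambda>x y. ?S x * ?\<alpha> * y" and c="?\<alpha>" and
          R="\<lambda>p q r s u v w. (p * ?\<beta> * ?S s * w * u) \<otimes> (q * ?\<beta> * ?S r * ?\<alpha> * v)"])
      (intro \<tau> lin clinear_antipode leg6_linear antipode_alpha | simp add: s leg6_defs)+
  have l36: "left_equiv \<tau> ?c36 eta"
    by (rule left_contract6[where h="\<lambda>x y. ?S x * ?\<alpha> * y" and c="?\<alpha>" and
          R="\<lambda>p q r s u v w. (p * ?\<beta> * ?S s * ?\<alpha> * u) \<otimes> (q * ?\<beta> * ?S r * w * v)"])
      (intro \<tau> lin clinear_antipode leg6_linear antipode_alpha | simp add: s leg6_defs)+
  have r23: "right_equiv \<tau> ?c23 eta"
    by (rule right_contract6[where h="\<lambda>x y. x * ?\<beta> * ?S y" and c="?\<beta>" and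
          R="\<lambda>p q r s u v w. (p * ?\<beta> * ?S s * ?\<alpha> * u) \<otimes> (q * w * ?S r * ?\<alpha> * v)"])
      (intro \<tau> lin clinear_antipode leg6_linear antipode_beta | simp add: s leg6_defs)+
  have r14: "right_equiv \<tau> ?c14 eta"
    by (rule right_contract6[where h="\<lambda>x y. x * ?\<beta> * ?S y" and c="?\<beta>" and
          R="\<lambda>p q r s u v w. (p * w * ?S s * ?\<alpha> * u) \<otimes> (q * ?\<beta> * ?S r * ?\<alpha> * v)"])
      (intro \<tau> lin clinear_antipode leg6_linear antipode_beta | simp add: s leg6_defs)+
  let ?P = "mlift ?l3 (mlift ?l4 (mlift ?l5 ?l6))"
  let ?Q = "mlift ?l1 (mlift ?l2 (mlift ?l3 ?l4))"
  let ?X = "mlift ?c12 (mlift ?c34 ?c56)"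
  \<comment> \<open>Multiplying the six legs out gives back the factors of the statement: \<open>P\<close> ends up in \<open>\<gamma>\<close>,
       \<open>Q\<close> in the coevaluation, and \<open>x\<close>, \<open>y\<close>, \<open>z\<close> on the pairs \<open>12\<close>, \<open>34\<close>, \<open>56\<close>.\<close>
  have core: "\<tau> (?P P * ((mlift ?l1 ?l2 x * (mlift ?l3 ?l4 y * mlift ?l5 ?l6 z)) * ?Q Q))
      = x * gamma_bar_map Q * antipode2 y * gamma_map P * z" for P Q x y z
  proof (rule tensor_ext4[where t=P and g="\<lambda>P. x * gamma_bar_map Q * antipode2 y * gamma_map P * z"
        and f="\<lambda>P. \<tau> (?P P * ((mlift ?l1 ?l2 x * (mlift ?l3 ?l4 y * mlift ?l5 ?l6 z)) * ?Q Q))"])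
    fix a b c d
    let ?L = "?P (a \<otimes> b \<otimes> c \<otimes> d)" and ?R = "gamma_map (a \<otimes> b \<otimes> c \<otimes> d)"
    show "\<tau> (?L * ((mlift ?l1 ?l2 x * (mlift ?l3 ?l4 y * mlift ?l5 ?l6 z)) * ?Q Q))
        = x * gamma_bar_map Q * antipode2 y * ?R * z"
    proof (rule tensor_ext4[where t=Q and g="\<lambda>Q. x * gamma_bar_map Q * antipode2 y * ?R * z"
          and f="\<lambda>Q. \<tau> (?L * ((mlift ?l1 ?l2 x * (mlift ?l3 ?l4 y * mlift ?l5 ?l6 z)) * ?Q Q))"])
      fix a' b' c' d'
      let ?L' = "?Q (a' \<otimes> b' \<otimes> c' \<otimes> d')" and ?R' = "gamma_bar_map (a' \<otimes> b' \<otimes> c' \<otimes> d')"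
      show "\<tau> (?L * ((mlift ?l1 ?l2 x * (mlift ?l3 ?l4 y * mlift ?l5 ?l6 z)) * ?L'))
        = x * ?R' * antipode2 y * ?R * z"
      proof (rule tensor_ext22[where s=x and t=y and g="\<lambda>x y. x * ?R' * antipode2 y * ?R * z"
            and f="\<lambda>x y. \<tau> (?L * ((mlift ?l1 ?l2 x * (mlift ?l3 ?l4 y * mlift ?l5 ?l6 z)) * ?L'))"])
        fix x1 x2 y1 y2
        show "\<tau> (?L * ((mlift ?l1 ?l2 (x1 \<otimes> x2) * (mlift ?l3 ?l4 (y1 \<otimes> y2) * mlift ?l5 ?l6 z)) * ?L'))
          = (x1 \<otimes> x2) * ?R' * antipode2 (y1 \<otimes> y2) * ?R * z"
          by (rule tensor_ext[where t=z and f="\<lambda>z. \<tau> (?L * ((mlift ?l1 ?l2 (x1 \<otimes> x2) * (mlift ?l3 ?l4 (y1 \<otimes> y2) * mlift ?l5 ?l6 z)) * ?L'))"])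
            (intro lin clinear_compose[OF \<tau>] leg6_linear clinear_antipode2
             | simp add: leg6_lift s gamma_map_pure gamma_bar_map_pure antipode2_pure)+
      qed (intro lin clinear_compose[OF \<tau>] leg6_linear clinear_antipode2)+
    qed (intro lin clinear_compose[OF \<tau>] leg6_linear clinear_gamma_bar_map)+
  qed (intro lin clinear_compose[OF \<tau>] leg6_linear clinear_gamma_map)+
  have "\<tau> (?P P * (?X X * ?Q Q))
      = tensor_lift3 (\<lambda>x y z. comult H x * gamma_bar_map Q * antipode2 (comult H y) * gamma_map P * comult H z) X"
    for P Q X
    by (rule tensor_ext3[where f="\<lambda>X. \<tau> (?P P * (?X X * ?Q Q))"])
      (intro lin clinear_compose[OF \<tau>] leg6_linear clinear_conv clinear_comult | subst lift3_pure
        | simp add: mlift_pure leg6_linear clinear_conv clinear_mlift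
        | simp add: conv_def core)+
  note expand = this[of "tensor3_one (inv_el (coassociator H)) * comult_fst H (coassociator H)"
      "inv_el (coassociator H)"
      "comult_fst H (inv_el (coassociator H)) * tensor3_one (coassociator H)"]
  let ?A = "Phi ?l3 ?c45 ?l6" and ?B = "Phi ?l4 ?l5 ?l6"
  let ?E = "Phi ?l1 ?l2 ?l3"
  let ?C = "\<lambda>f. Phi_inv ?c12 ?l3 f"
  let ?D = "\<lambda>f. Phi_inv f ?l4 ?c56"
  have P: "?P (tensor3_one (inv_el (coassociator H)) * comult_fst H (coassociator H))
      = Phi_inv ?l3 ?l4 ?l5 * Phi ?c34 ?l5 ?l6"
    by (intro gamma_legs legs)
  have Q: "?Q (comult_fst H (inv_el (coassociator H)) * tensor3_one (coassociator H))
      = Phi_inv ?c12 ?l3 ?l4 * ?E"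
    by (intro gamma_legs legs)
  have "tensor_lift3 (\<lambda>x y z. comult H x * gamma_bar * antipode2 (comult H y) * drinfeld_gamma H * comult H z)
      (inv_el (coassociator H))
    = \<tau> ((Phi_inv ?l3 ?l4 ?l5 * Phi ?c34 ?l5 ?l6)
      * (Phi_inv ?c12 ?c34 ?c56
      * (Phi_inv ?c12 ?l3 ?l4 * ?E)))"
    unfolding gamma_bar_def gamma_as_image expand[symmetric] P Q
    by (simp add: Phi_inv_def[of "?c12" "?c34"])
  \<comment> \<open>Pentagon on \<open>3, 4, 5, 6\<close>; its last factor starts the pentagon on \<open>12, 3, 4, 56\<close> used next.\<close>
  also have "Phi_inv ?l3 ?l4 ?l5 * Phi ?c34 ?l5 ?l6
      = ?A * ?B * Phi_inv ?l3 ?l4 ?c56"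
    by (rule Phi_pentagon_rotations(1)) (intro legs)+
  also have "\<dots> * (Phi_inv ?c12 ?c34 ?c56
        * (Phi_inv ?c12 ?l3 ?l4 * ?E))
      = ?A * (?B * (Phi_inv ?l3 ?l4 ?c56
        * Phi_inv ?c12 ?c34 ?c56
        * Phi_inv ?c12 ?l3 ?l4) * ?E)"
    by (simp add: mult.assoc)
  also have "Phi_inv ?l3 ?l4 ?c56
        * Phi_inv ?c12 ?c34 ?c56
        * Phi_inv ?c12 ?l3 ?l4
      = ?C (conv ?l4 ?c56) * ?D (conv ?c12 ?l3)"
    by (rule Phi_pentagon_rotations(5)) (intro legs)+
  also have "?A * (?B * (?C (conv ?l4 ?c56) * ?D (conv ?c12 ?l3)) * ?E)
      = ?A * (?B * ?C (conv ?l4 ?c56) * (?D (conv ?c12 ?l3) * ?E))"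
    by (simp add: mult.assoc)
  \<comment> \<open>Quasi-coassociativity changes the bracketing of \<open>456\<close> and of \<open>123\<close>, so that \<open>45\<close> and \<open>23\<close> can
       be contracted.\<close>
  also have "?B * ?C (conv ?l4 ?c56) = ?C (conv ?c45 ?l6) * ?B"
    by (rule Phi_natural) (intro hom_linear legs Phi_conv Phi_commutes)+
  also have "?D (conv ?c12 ?l3) * ?E = ?E * ?D (conv ?l1 ?c23)"
    by (rule Phi_natural(2)[symmetric]) (intro hom_linear legs Phi_conv Phi_commutes)+
  also have "\<tau> (?A * (?C (conv ?c45 ?l6) * ?B * (?E * ?D (conv ?l1 ?c23))))
      = \<tau> (Phi ?l3 eta ?l6 * (?C (conv ?c45 ?l6) * ?B * (?E * ?D (conv ?l1 ?c23))))"
    by (rule left_Phi2[OF l45 \<tau>]) (intro legs)+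
  also have "\<dots> = \<tau> (?C (conv ?c45 ?l6) * (?B * (?E * ?D (conv ?l1 ?c23))))"
    by (simp add: Phi_eta2 legs mult.assoc)
  also have "\<dots> = \<tau> (?C (conv eta ?l6) * (?B * (?E * ?D (conv ?l1 ?c23))))"
    by (rule left_Phi3(2)[OF left_equiv_conv1[OF l45 \<tau>] \<tau>]) (intro legs hom_linear)+
  also have "\<dots> = \<tau> (?C ?l6 * (?B * ?E) * ?D (conv ?l1 ?c23))"
    by (simp add: conv_eta legs mult.assoc)
  also have "\<dots> = \<tau> (?C ?l6 * (?B * ?E) * ?D (conv ?l1 eta))"
    by (rule right_Phi1(2)[OF right_equiv_conv2[OF r23 \<tau>] \<tau>]) (intro legs hom_linear)+
  also have "?B * ?E = ?E * ?B"
    by (rule Phi_natural) (intro hom_linear legs Phi_commutes)+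
  also have "?C ?l6 * (?E * ?B) * ?D (conv ?l1 eta) = (?C ?l6 * ?E) * (?B * ?D ?l1)"
    by (simp add: conv_eta legs mult.assoc)
  \<comment> \<open>Pentagons on \<open>1, 2, 3, 6\<close> and on \<open>1, 4, 5, 6\<close>; all factors except \<open>236\<close> and \<open>145\<close> are contracted.\<close>
  also have "?C ?l6 * ?E = Phi ?l1 ?l2 ?c36 * Phi_inv ?l2 ?l3 ?l6
      * Phi_inv ?l1 ?c23 ?l6"
    by (rule Phi_pentagon_rotations(2)) (intro legs)+
  also have "?B * ?D ?l1 = Phi_inv ?l1 ?c45 ?l6 * Phi_inv ?l1 ?l4 ?l5
      * Phi ?c14 ?l5 ?l6"
    by (rule Phi_pentagon_rotations(3)) (intro legs)+
  finally have "tensor_lift3 (\<lambda>x y z. comult H x * gamma_bar * antipode2 (comult H y) * drinfeld_gamma H * comult H z)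
      (inv_el (coassociator H))
    = \<tau> (Phi ?l1 ?l2 ?c36 * (Phi_inv ?l2 ?l3 ?l6
      * Phi_inv ?l1 ?c23 ?l6 * Phi_inv ?l1 ?c45 ?l6
      * Phi_inv ?l1 ?l4 ?l5 * Phi ?c14 ?l5 ?l6))"
    by (simp add: mult.assoc)
  also have "\<dots> = \<tau> (Phi ?l1 ?l2 eta * (Phi_inv ?l2 ?l3 ?l6
      * Phi_inv ?l1 ?c23 ?l6 * Phi_inv ?l1 ?c45 ?l6
      * Phi_inv ?l1 ?l4 ?l5 * Phi ?c14 ?l5 ?l6))"
    by (rule left_Phi3[OF l36 \<tau>]) (intro legs)+
  also have "\<dots> = \<tau> (Phi_inv ?l2 ?l3 ?l6
      * Phi_inv ?l1 ?c23 ?l6 * Phi_inv ?l1 ?c45 ?l6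
      * Phi_inv ?l1 ?l4 ?l5 * Phi ?c14 ?l5 ?l6)"
    by (simp add: Phi_eta3 legs)
  also have "\<dots> = \<tau> (Phi_inv ?l2 ?l3 ?l6
      * Phi_inv ?l1 ?c23 ?l6 * Phi_inv ?l1 ?c45 ?l6
      * Phi_inv ?l1 ?l4 ?l5 * Phi eta ?l5 ?l6)"
    by (rule right_Phi1[OF r14 \<tau>]) (intro legs)+
  also have "\<dots> = \<tau> (Phi_inv ?l2 ?l3 ?l6
      * Phi_inv ?l1 ?c23 ?l6 * (Phi_inv ?l1 ?c45 ?l6
      * Phi_inv ?l1 ?l4 ?l5))"
    by (simp add: Phi_eta1 legs mult.assoc)
  also have "\<dots> = \<tau> (Phi_inv ?l2 ?l3 ?l6
      * Phi_inv ?l1 ?c23 ?l6 * (Phi_inv ?l1 eta ?l6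
      * Phi_inv ?l1 ?l4 ?l5))"
  proof (rule left_Phi2(2)[OF left_equiv_shift[OF l45]])
    let ?u = "Phi_inv ?l2 ?l3 ?l6 * Phi_inv ?l1 ?c23 ?l6"
    show "?u * ?c45 x = ?c45 x * ?u" for x
      by (simp only: mult.assoc, subst Phi_commutes) (intro legs | simp add: Phi_commutes legs flip: mult.assoc)+
    show "?u * eta x = eta x * ?u" for x by (simp add: eta_mult)
  qed (intro legs clinear_compose[OF \<tau>] lin)+
  also have "\<dots> = \<tau> (Phi_inv ?l2 ?l3 ?l6
      * Phi_inv ?l1 ?c23 ?l6 * Phi_inv ?l1 ?l4 ?l5)"
    by (simp add: Phi_eta2 legs)
  also have "\<dots> = \<tau> (Phi_inv ?l2 ?l3 ?l6 * Phi_inv ?l1 eta ?l6 * Phi_inv ?l1 ?l4 ?l5)"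
  proof (rule right_Phi2(2)[OF right_equiv_shift[OF r23]])
    let ?u = "Phi_inv ?l1 ?l4 ?l5"
    show "?c23 x * ?u = ?u * ?c23 x" for x
      by (rule Phi_commutes(2)[symmetric]) (intro legs)+
    show "eta x * ?u = ?u * eta x" for x by (simp add: eta_mult)
  qed (intro legs clinear_compose[OF \<tau>] lin)+
  also have "\<dots> = \<tau> (Phi_inv ?l2 ?l3 ?l6 * Phi_inv ?l1 ?l4 ?l5)"
    by (simp add: Phi_eta2 legs)
  also have "\<dots> = 1"
  proof -
    define z where "z = tensor_lift3 (\<lambda>x y z. x * ?\<beta> * ?S y * ?\<alpha> * z)"
    have zl: "clinear z" unfolding z_def by (rule clinear_lift3_of[OF _ _ _ clinear_ident]; intro lin)
    have z_pure: "z (a \<otimes> b \<otimes> c) = a * ?\<beta> * ?S b * ?\<alpha> * c" for a b c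
      unfolding z_def by (rule lift3_pure; intro lin)
    have "\<tau> (mlift ?l2 (mlift ?l3 ?l6) X * mlift ?l1 (mlift ?l4 ?l5) Y) = z Y \<otimes> z X" for X Y
    proof (rule tensor_ext3[where t=X and g="\<lambda>X. z Y \<otimes> z X"
          and f="\<lambda>X. \<tau> (mlift ?l2 (mlift ?l3 ?l6) X * mlift ?l1 (mlift ?l4 ?l5) Y)"])
      fix a b c
      show "\<tau> (mlift ?l2 (mlift ?l3 ?l6) (a \<otimes> b \<otimes> c) * mlift ?l1 (mlift ?l4 ?l5) Y)
          = z Y \<otimes> z (a \<otimes> b \<otimes> c)"
        by (rule tensor_ext3[where t=Y and g="\<lambda>Y. z Y \<otimes> z (a \<otimes> b \<otimes> c)" and
              f="\<lambda>Y. \<tau> (mlift ?l2 (mlift ?l3 ?l6) (a \<otimes> b \<otimes> c) * mlift ?l1 (mlift ?l4 ?l5) Y)"])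
          (intro lin clinear_compose[OF \<tau>] zl leg6_linear | simp add: leg6_lift s z_pure)+
    qed (intro lin clinear_compose[OF \<tau>] zl leg6_linear)+
    then show ?thesis
      by (simp add: Phi_inv_def z_def antipode_coassociator_inv one_tensor_def)
  qed
  finally show ?thesis .
qed

text \<open>The word on six legs is the inverse of the one in the preceding proof, and it is reduced by the inverse
pentagons in reversed order. Now \<open>\<tau>\<close> joins \<open>1, 4, 5\<close> and \<open>2, 3, 6\<close> with the roles of \<open>\<alpha>\<close> and \<open>\<beta>\<close>
exchanged: \<open>23\<close> and \<open>14\<close> are contracted at the left end, \<open>36\<close> and \<open>45\<close> at the right end.\<close>

lemma drinfeld_zigzag_left:
  "tensor_lift3 (\<lambda>x y z. antipode2 (comult H x) * drinfeld_gamma H * comult H y * gamma_bar * antipode2 (comult H z))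
    (coassociator H) = 1"
proof -
  let ?l1 = "leg61 :: 'h \<Rightarrow> _" and ?l2 = "leg62 :: 'h \<Rightarrow> _" and ?l3 = "leg63 :: 'h \<Rightarrow> _"
  let ?l4 = "leg64 :: 'h \<Rightarrow> _" and ?l5 = "leg65 :: 'h \<Rightarrow> _" and ?l6 = "leg66 :: 'h \<Rightarrow> _"
  let ?c12 = "conv ?l1 ?l2" and ?c34 = "conv ?l3 ?l4" and ?c56 = "conv ?l5 ?l6" and ?c14 = "conv ?l1 ?l4"
  let ?c23 = "conv ?l2 ?l3" and ?c45 = "conv ?l4 ?l5" and ?c36 = "conv ?l3 ?l6"
  let ?S = "antipode H" and ?\<alpha> = "alpha H" and ?\<beta> = "beta H"
  define \<tau> where "\<tau> = tensor_lift6 (\<lambda>a b c d e k. (?S b * ?\<alpha> * c * ?\<beta> * ?S k) \<otimes> (?S a * ?\<alpha> * d * ?\<beta> * ?S e))"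
  have \<tau>: "clinear \<tau>"
    unfolding \<tau>_def by (rule tensor_lift6_rules(1); intro lin clinear_antipode)
  have \<tau>_pure: "\<tau> (a \<otimes> b \<otimes> c \<otimes> d \<otimes> e \<otimes> k) = (?S b * ?\<alpha> * c * ?\<beta> * ?S k) \<otimes> (?S a * ?\<alpha> * d * ?\<beta> * ?S e)"
    for a b c d e k
    unfolding \<tau>_def by (rule tensor_lift6_rules(2); intro lin clinear_antipode)
  note s = \<tau>_pure pure_mult_pure mult.assoc S_simps
  have l23: "left_equiv \<tau> ?c23 eta"
    by (rule left_contract6[where h="\<lambda>x y. ?S x * ?\<alpha> * y" and c="?\<alpha>" and
          R="\<lambda>p q r s u v w. (?S q * w * r * ?\<beta> * ?S v) \<otimes> (?S p * ?\<alpha> * s * ?\<beta> * ?S u)"])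
      (intro \<tau> lin clinear_antipode leg6_linear antipode_alpha | simp add: s leg6_defs)+
  have l14: "left_equiv \<tau> ?c14 eta"
    by (rule left_contract6[where h="\<lambda>x y. ?S x * ?\<alpha> * y" and c="?\<alpha>" and
          R="\<lambda>p q r s u v w. (?S q * ?\<alpha> * r * ?\<beta> * ?S v) \<otimes> (?S p * w * s * ?\<beta> * ?S u)"])
      (intro \<tau> lin clinear_antipode leg6_linear antipode_alpha | simp add: s leg6_defs)+
  have r36: "right_equiv \<tau> ?c36 eta"
    by (rule right_contract6[where h="\<lambda>x y. x * ?\<beta> * ?S y" and c="?\<beta>" and
          R="\<lambda>p q r s u v w. (?S q * ?\<alpha> * r * w * ?S v) \<otimes> (?S p * ?\<alpha> * s * ?\<beta> * ?S u)"])
      (intro \<tau> lin clinear_antipode leg6_linear antipode_beta | simp add: s leg6_defs)+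
  have r45: "right_equiv \<tau> ?c45 eta"
    by (rule right_contract6[where h="\<lambda>x y. x * ?\<beta> * ?S y" and c="?\<beta>" and
          R="\<lambda>p q r s u v w. (?S q * ?\<alpha> * r * ?\<beta> * ?S v) \<otimes> (?S p * ?\<alpha> * s * w * ?S u)"])
      (intro \<tau> lin clinear_antipode leg6_linear antipode_beta | simp add: s leg6_defs)+
  let ?P = "mlift ?l1 (mlift ?l2 (mlift ?l3 ?l4))"
  let ?Q = "mlift ?l3 (mlift ?l4 (mlift ?l5 ?l6))"
  let ?X = "mlift ?c12 (mlift ?c34 ?c56)"
  have core: "\<tau> (?P P * ((mlift ?l1 ?l2 x * (mlift ?l3 ?l4 y * mlift ?l5 ?l6 z)) * ?Q Q))
      = antipode2 x * gamma_map P * y * gamma_bar_map Q * antipode2 z" for P Q x y z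
  proof (rule tensor_ext4[where t=P and g="\<lambda>P. antipode2 x * gamma_map P * y * gamma_bar_map Q * antipode2 z"
        and f="\<lambda>P. \<tau> (?P P * ((mlift ?l1 ?l2 x * (mlift ?l3 ?l4 y * mlift ?l5 ?l6 z)) * ?Q Q))"])
    fix a b c d
    let ?L = "?P (a \<otimes> b \<otimes> c \<otimes> d)" and ?R = "gamma_map (a \<otimes> b \<otimes> c \<otimes> d)"
    show "\<tau> (?L * ((mlift ?l1 ?l2 x * (mlift ?l3 ?l4 y * mlift ?l5 ?l6 z)) * ?Q Q))
        = antipode2 x * ?R * y * gamma_bar_map Q * antipode2 z"
    proof (rule tensor_ext4[where t=Q and g="\<lambda>Q. antipode2 x * ?R * y * gamma_bar_map Q * antipode2 z"
          and f="\<lambda>Q. \<tau> (?L * ((mlift ?l1 ?l2 x * (mlift ?l3 ?l4 y * mlift ?l5 ?l6 z)) * ?Q Q))"])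
      fix a' b' c' d'
      let ?L' = "?Q (a' \<otimes> b' \<otimes> c' \<otimes> d')" and ?R' = "gamma_bar_map (a' \<otimes> b' \<otimes> c' \<otimes> d')"
      show "\<tau> (?L * ((mlift ?l1 ?l2 x * (mlift ?l3 ?l4 y * mlift ?l5 ?l6 z)) * ?L'))
        = antipode2 x * ?R * y * ?R' * antipode2 z"
      proof (rule tensor_ext22[where s=x and t=y and g="\<lambda>x y. antipode2 x * ?R * y * ?R' * antipode2 z"
            and f="\<lambda>x y. \<tau> (?L * ((mlift ?l1 ?l2 x * (mlift ?l3 ?l4 y * mlift ?l5 ?l6 z)) * ?L'))"])
        fix x1 x2 y1 y2
        show "\<tau> (?L * ((mlift ?l1 ?l2 (x1 \<otimes> x2) * (mlift ?l3 ?l4 (y1 \<otimes> y2) * mlift ?l5 ?l6 z)) * ?L'))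
          = antipode2 (x1 \<otimes> x2) * ?R * (y1 \<otimes> y2) * ?R' * antipode2 z"
          by (rule tensor_ext[where t=z and f="\<lambda>z. \<tau> (?L * ((mlift ?l1 ?l2 (x1 \<otimes> x2) * (mlift ?l3 ?l4 (y1 \<otimes> y2) * mlift ?l5 ?l6 z)) * ?L'))"])
            (intro lin clinear_compose[OF \<tau>] leg6_linear clinear_antipode2
             | simp add: leg6_lift s gamma_map_pure gamma_bar_map_pure antipode2_pure)+
      qed (intro lin clinear_compose[OF \<tau>] leg6_linear clinear_antipode2)+
    qed (intro lin clinear_compose[OF \<tau>] leg6_linear clinear_antipode2 clinear_gamma_bar_map)+
  qed (intro lin clinear_compose[OF \<tau>] leg6_linear clinear_antipode2 clinear_gamma_map)+
  have "\<tau> (?P P * (?X X * ?Q Q))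
      = tensor_lift3 (\<lambda>x y z. antipode2 (comult H x) * gamma_map P * comult H y * gamma_bar_map Q * antipode2 (comult H z)) X"
    for P Q X
    by (rule tensor_ext3[where f="\<lambda>X. \<tau> (?P P * (?X X * ?Q Q))"])
      (intro lin clinear_compose[OF \<tau>] leg6_linear clinear_antipode2 clinear_conv clinear_comult | subst lift3_pure
        | simp add: mlift_pure leg6_linear clinear_conv clinear_mlift
        | simp add: conv_def core)+
  note expand = this[of "tensor3_one (inv_el (coassociator H)) * comult_fst H (coassociator H)"
      "coassociator H"
      "comult_fst H (inv_el (coassociator H)) * tensor3_one (coassociator H)"]
  let ?A = "Phi_inv ?l3 ?c45 ?l6" and ?B = "Phi_inv ?l4 ?l5 ?l6"
  let ?E = "Phi_inv ?l1 ?l2 ?l3"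
  let ?C = "\<lambda>f. Phi ?c12 ?l3 f"
  let ?D = "\<lambda>f. Phi f ?l4 ?c56"
  have P: "?P (tensor3_one (inv_el (coassociator H)) * comult_fst H (coassociator H))
      = ?E * Phi ?c12 ?l3 ?l4"
    by (intro gamma_legs legs)
  have Q: "?Q (comult_fst H (inv_el (coassociator H)) * tensor3_one (coassociator H))
      = Phi_inv ?c34 ?l5 ?l6 * Phi ?l3 ?l4 ?l5"
    by (intro gamma_legs legs)
  have "tensor_lift3 (\<lambda>x y z. antipode2 (comult H x) * drinfeld_gamma H * comult H y * gamma_bar * antipode2 (comult H z))
      (coassociator H)
    = \<tau> (?E * Phi ?c12 ?l3 ?l4
      * (Phi ?c12 ?c34 ?c56
      * (Phi_inv ?c34 ?l5 ?l6 * Phi ?l3 ?l4 ?l5)))"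
    unfolding gamma_bar_def gamma_as_image expand[symmetric] P Q
    by (simp add: Phi_def[of "?c12" "?c34"])
  also have "Phi_inv ?c34 ?l5 ?l6 * Phi ?l3 ?l4 ?l5
      = Phi ?l3 ?l4 ?c56 * ?B * ?A"
    by (rule Phi_pentagon_rotations(2)) (intro legs)+
  also have "?E * Phi ?c12 ?l3 ?l4
        * (Phi ?c12 ?c34 ?c56
        * (Phi ?l3 ?l4 ?c56 * ?B * ?A))
      = ?E * ((Phi ?c12 ?l3 ?l4
        * Phi ?c12 ?c34 ?c56
        * Phi ?l3 ?l4 ?c56) * ?B) * ?A"
    by (simp add: mult.assoc)
  also have "Phi ?c12 ?l3 ?l4
        * Phi ?c12 ?c34 ?c56
        * Phi ?l3 ?l4 ?c56
      = ?D (conv ?c12 ?l3) * ?C (conv ?l4 ?c56)"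
    by (rule Phi_pentagon[symmetric]) (intro legs)+
  also have "?E * (?D (conv ?c12 ?l3) * ?C (conv ?l4 ?c56) * ?B) * ?A
      = ?E * ?D (conv ?c12 ?l3) * (?C (conv ?l4 ?c56) * ?B) * ?A"
    by (simp add: mult.assoc)
  also have "?C (conv ?l4 ?c56) * ?B = ?B * ?C (conv ?c45 ?l6)"
    by (rule Phi_natural(1)[symmetric]) (intro hom_linear legs Phi_inv_conv Phi_commutes)+
  also have "?E * ?D (conv ?c12 ?l3) = ?D (conv ?l1 ?c23) * ?E"
    by (rule Phi_natural) (intro hom_linear legs Phi_inv_conv Phi_commutes)+
  also have "\<tau> (?D (conv ?l1 ?c23) * ?E * (?B * ?C (conv ?c45 ?l6)) * ?A)
      = \<tau> (?D (conv ?l1 ?c23) * ?E * (?B * ?C (conv ?c45 ?l6))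
        * Phi_inv ?l3 eta ?l6)"
    by (rule right_Phi2[OF r45 \<tau>]) (intro legs)+
  also have "\<dots> = \<tau> (?D (conv ?l1 ?c23) * ?E * ?B * ?C (conv ?c45 ?l6))"
    by (simp add: Phi_eta2 legs mult.assoc)
  also have "\<dots> = \<tau> (?D (conv ?l1 ?c23) * ?E * ?B * ?C (conv eta ?l6))"
    by (rule right_Phi3(1)[OF right_equiv_conv1[OF r45 \<tau>] \<tau>]) (intro legs hom_linear)+
  also have "\<dots> = \<tau> (?D (conv ?l1 ?c23) * ((?E * ?B) * ?C ?l6))"
    by (simp add: conv_eta legs mult.assoc)
  also have "\<dots> = \<tau> (?D (conv ?l1 eta) * ((?E * ?B) * ?C ?l6))"
    by (rule left_Phi1(1)[OF left_equiv_conv2[OF l23 \<tau>] \<tau>]) (intro legs hom_linear)+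
  also have "?E * ?B = ?B * ?E"
    by (rule Phi_natural) (intro hom_linear legs Phi_commutes)+
  also have "?D (conv ?l1 eta) * (?B * ?E * ?C ?l6) = (?D ?l1 * ?B) * (?E * ?C ?l6)"
    by (simp add: conv_eta legs mult.assoc)
  also have "?D ?l1 * ?B = Phi_inv ?c14 ?l5 ?l6 * Phi ?l1 ?l4 ?l5
      * Phi ?l1 ?c45 ?l6"
    by (rule Phi_pentagon_rotations(4)) (intro legs)+
  also have "?E * ?C ?l6 = Phi ?l1 ?c23 ?l6 * Phi ?l2 ?l3 ?l6
      * Phi_inv ?l1 ?l2 ?c36"
    by (rule Phi_pentagon_rotations(1)) (intro legs)+
  finally have "tensor_lift3 (\<lambda>x y z. antipode2 (comult H x) * drinfeld_gamma H * comult H y * gamma_bar * antipode2 (comult H z))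
      (coassociator H)
    = \<tau> (Phi_inv ?c14 ?l5 ?l6 * (Phi ?l1 ?l4 ?l5
      * Phi ?l1 ?c45 ?l6 * Phi ?l1 ?c23 ?l6
      * Phi ?l2 ?l3 ?l6 * Phi_inv ?l1 ?l2 ?c36))"
    by (simp add: mult.assoc)
  also have "\<dots> = \<tau> (Phi_inv eta ?l5 ?l6 * (Phi ?l1 ?l4 ?l5
      * Phi ?l1 ?c45 ?l6 * Phi ?l1 ?c23 ?l6
      * Phi ?l2 ?l3 ?l6 * Phi_inv ?l1 ?l2 ?c36))"
    by (rule left_Phi1[OF l14 \<tau>]) (intro legs)+
  also have "\<dots> = \<tau> (Phi ?l1 ?l4 ?l5
      * Phi ?l1 ?c45 ?l6 * Phi ?l1 ?c23 ?l6
      * Phi ?l2 ?l3 ?l6 * Phi_inv ?l1 ?l2 ?c36)"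
    by (simp add: Phi_eta1 legs)
  also have "\<dots> = \<tau> (Phi ?l1 ?l4 ?l5
      * Phi ?l1 ?c45 ?l6 * Phi ?l1 ?c23 ?l6
      * Phi ?l2 ?l3 ?l6 * Phi_inv ?l1 ?l2 eta)"
    by (rule right_Phi3[OF r36 \<tau>]) (intro legs)+
  also have "\<dots> = \<tau> (Phi ?l1 ?l4 ?l5
      * Phi ?l1 ?c45 ?l6 * (Phi ?l1 ?c23 ?l6
      * Phi ?l2 ?l3 ?l6))"
    by (simp add: Phi_eta3 legs mult.assoc)
  also have "\<dots> = \<tau> (Phi ?l1 ?l4 ?l5
      * Phi ?l1 ?c45 ?l6 * (Phi ?l1 eta ?l6 * Phi ?l2 ?l3 ?l6))"
  proof (rule left_Phi2(1)[OF left_equiv_shift[OF l23]])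
    let ?u = "Phi ?l1 ?l4 ?l5 * Phi ?l1 ?c45 ?l6"
    show "?u * ?c23 x = ?c23 x * ?u" for x
      by (simp only: mult.assoc, subst Phi_commutes) (intro legs | simp add: Phi_commutes legs flip: mult.assoc)+
    show "?u * eta x = eta x * ?u" for x by (simp add: eta_mult)
  qed (intro legs clinear_compose[OF \<tau>] lin)+
  also have "\<dots> = \<tau> (Phi ?l1 ?l4 ?l5 * Phi ?l1 ?c45 ?l6 * Phi ?l2 ?l3 ?l6)"
    by (simp add: Phi_eta2 legs)
  also have "\<dots> = \<tau> (Phi ?l1 ?l4 ?l5 * Phi ?l1 eta ?l6 * Phi ?l2 ?l3 ?l6)"
  proof (rule right_Phi2(1)[OF right_equiv_shift[OF r45]])
    let ?u = "Phi ?l2 ?l3 ?l6"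
    show "?c45 x * ?u = ?u * ?c45 x" for x
      by (rule Phi_commutes(1)[symmetric]) (intro legs)+
    show "eta x * ?u = ?u * eta x" for x by (simp add: eta_mult)
  qed (intro legs clinear_compose[OF \<tau>] lin)+
  also have "\<dots> = \<tau> (Phi ?l1 ?l4 ?l5 * Phi ?l2 ?l3 ?l6)"
    by (simp add: Phi_eta2 legs)
  also have "\<dots> = 1"
  proof -
    define z where "z = tensor_lift3 (\<lambda>x y z. ?S x * ?\<alpha> * y * ?\<beta> * ?S z)"
    have zl: "clinear z"
      unfolding z_def by (rule clinear_lift3_of[OF _ _ _ clinear_ident]; intro lin clinear_antipode)
    have z_pure: "z (a \<otimes> b \<otimes> c) = ?S a * ?\<alpha> * b * ?\<beta> * ?S c" for a b c
      unfolding z_def by (rule lift3_pure; intro lin clinear_antipode)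
    have "\<tau> (mlift ?l1 (mlift ?l4 ?l5) X * mlift ?l2 (mlift ?l3 ?l6) Y) = z Y \<otimes> z X" for X Y
    proof (rule tensor_ext3[where t=X and g="\<lambda>X. z Y \<otimes> z X"
          and f="\<lambda>X. \<tau> (mlift ?l1 (mlift ?l4 ?l5) X * mlift ?l2 (mlift ?l3 ?l6) Y)"])
      fix a b c
      show "\<tau> (mlift ?l1 (mlift ?l4 ?l5) (a \<otimes> b \<otimes> c) * mlift ?l2 (mlift ?l3 ?l6) Y)
          = z Y \<otimes> z (a \<otimes> b \<otimes> c)"
        by (rule tensor_ext3[where t=Y and g="\<lambda>Y. z Y \<otimes> z (a \<otimes> b \<otimes> c)" and
              f="\<lambda>Y. \<tau> (mlift ?l1 (mlift ?l4 ?l5) (a \<otimes> b \<otimes> c) * mlift ?l2 (mlift ?l3 ?l6) Y)"])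
          (intro lin clinear_compose[OF \<tau>] zl leg6_linear | simp add: leg6_lift s z_pure)+
    qed (intro lin clinear_compose[OF \<tau>] zl leg6_linear)+
    then show ?thesis
      by (simp add: Phi_def z_def antipode_coassociator one_tensor_def)
  qed
  finally show ?thesis .
qed

lemma antipode2_comult_antihom: "algebra_antihom (\<lambda>x. antipode2 (comult H x))"
  using antipode2_antihom comult_hom
  by (simp add: algebra_antihom_def algebra_hom_def clinear_compose)

theorem antipode_along_drinfeld:
  "antipode_along (comult H) (\<lambda>x. antipode2 (comult H x)) (drinfeld_gamma H) gamma_bar"
  unfolding antipode_along_def
  by (intro conjI allI comult_hom antipode2_comult_antihom gamma_invariant gamma_bar_invariant
      drinfeld_zigzag_left drinfeld_zigzag_right)

text \<open>The formula that defines the Drinfeld twist is the one for the comparison element, with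
\<open>\<Delta>(Y \<beta> S(Z))\<close> multiplied out.\<close>

lemma drinfeld_twist_comparison:
  "drinfeld_twist H = comparison (\<lambda>x. antipode2 (comult H x)) (drinfeld_gamma H) (comult H)
    (comult H (beta H)) (\<lambda>x. comult H (antipode H x))"
  unfolding drinfeld_twist_def comparison_def antipode2_def
  by (simp add: hom_mult[OF comult_hom] mult.assoc)

theorem drinfeld_twist_properties:
  shows "has_inverse (drinfeld_twist H)"
    and "antipode2 (comult H a) * drinfeld_twist H = drinfeld_twist H * comult H (antipode H a)"
    and "drinfeld_twist H * comult H (alpha H) = drinfeld_gamma H"
    and "gamma_bar * drinfeld_twist H = comult H (beta H)"
proof -
  note 1 = antipode_along_drinfeld and 2 = antipode_along_antipode[OF comult_hom]
  show "has_inverse (drinfeld_twist H)"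
    unfolding has_inverse_def drinfeld_twist_comparison
    using comparison_inverse[OF 1 2] comparison_inverse[OF 2 1] by blast
  show "antipode2 (comult H a) * drinfeld_twist H = drinfeld_twist H * comult H (antipode H a)"
    unfolding drinfeld_twist_comparison by (rule comparison_intertwines[OF 1 2])
  show "drinfeld_twist H * comult H (alpha H) = drinfeld_gamma H"
    unfolding drinfeld_twist_comparison by (rule comparison_alpha[OF 1 2])
  show "gamma_bar * drinfeld_twist H = comult H (beta H)"
    unfolding drinfeld_twist_comparison by (rule comparison_beta[OF 1 2])
qed

end

section \<open>Antilinear maps and the action of an antihomomorphism\<close>

lemma additive_ext3:
  fixes f g :: "'a::complex_vector \<otimes> 'b::complex_vector \<otimes> 'c::complex_vector \<Rightarrow> 'd::ab_group_add"
  assumes "\<And>x y. f (x + y) = f x + f y" "\<And>x y. g (x + y) = g x + g y"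
    and "\<And>a b c. f (a \<otimes> b \<otimes> c) = g (a \<otimes> b \<otimes> c)"
  shows "f t = g t"
  using assms(1,2)
proof (rule additive_eq_on_tensors)
  show "f (a \<otimes> s) = g (a \<otimes> s)" for a s
    by (rule additive_eq_on_tensors[where f="\<lambda>s. f (a \<otimes> s)" and g="\<lambda>s. g (a \<otimes> s)"])
      (simp_all add: pure_add_right assms)
qed

lemma additive_ext4:
  fixes f g :: "'a::complex_vector \<otimes> 'b::complex_vector \<otimes> 'c::complex_vector \<otimes> 'd::complex_vector
    \<Rightarrow> 'e::ab_group_add"
  assumes "\<And>x y. f (x + y) = f x + f y" "\<And>x y. g (x + y) = g x + g y"
    and "\<And>a b c d. f (a \<otimes> b \<otimes> c \<otimes> d) = g (a \<otimes> b \<otimes> c \<otimes> d)"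
  shows "f t = g t"
  using assms(1,2)
proof (rule additive_eq_on_tensors)
  show "f (a \<otimes> s) = g (a \<otimes> s)" for a s
    by (rule additive_ext3[where f="\<lambda>s. f (a \<otimes> s)" and g="\<lambda>s. g (a \<otimes> s)"])
      (simp_all add: pure_add_right assms)
qed

lemma antilinear_tensor_map:
  assumes "antilinear f" "antilinear g"
  shows "antilinear (tensor_map f g)"
proof -
  have add: "tensor_map f g (x + y) = tensor_map f g x + tensor_map f g y" for x y
    by (simp add: tensor_map_def tensor_lift_add)
  have "f (c *\<^sub>C a) = cnj c *\<^sub>C f a" for c a
    using assms(1) by (simp add: antilinear_def)
  then have pure: "tensor_map f g (c *\<^sub>C (a \<otimes> b)) = cnj c *\<^sub>C tensor_map f g (a \<otimes> b)" for c a b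
    by (simp only: pure_scaleC_left[symmetric] tensor_map_pure_antilinear[OF assms])
  have "tensor_map f g (c *\<^sub>C t) = cnj c *\<^sub>C tensor_map f g t" for c t
    by (rule additive_eq_on_tensors[where f="\<lambda>t. tensor_map f g (c *\<^sub>C t)"])
      (simp_all add: add scaleC_add_right pure)
  then show ?thesis
    by (simp add: antilinear_def add)
qed

text \<open>Tensors act on the algebra by \<open>a \<mapsto> \<sigma>(x) a y\<close> from the right and by \<open>b \<mapsto> x b \<sigma>(y)\<close> from the left. The
twisted elements \<open>\<alpha>\<^sub>F\<close> and \<open>\<beta>\<^sub>F\<close> are the values of these actions, so \<open>act_mult\<close> undoes a twist by
acting with the inverse tensor.\<close>

definition alpha_act :: "('h::complex_algebra_1 \<Rightarrow> 'h) \<Rightarrow> 'h \<Rightarrow> 'h \<otimes> 'h \<Rightarrow> 'h"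
  where "alpha_act \<sigma> a = tensor_lift (\<lambda>x y. \<sigma> x * a * y)"

definition beta_act :: "('h::complex_algebra_1 \<Rightarrow> 'h) \<Rightarrow> 'h \<Rightarrow> 'h \<otimes> 'h \<Rightarrow> 'h"
  where "beta_act \<sigma> b = tensor_lift (\<lambda>x y. x * b * \<sigma> y)"

lemma act_linear:
  assumes "clinear \<sigma>"
  shows "clinear (alpha_act \<sigma> a)" "clinear (beta_act \<sigma> a)"
    "alpha_act \<sigma> a (x \<otimes> y) = \<sigma> x * a * y" "beta_act \<sigma> a (x \<otimes> y) = x * a * \<sigma> y"
    "clinear (\<lambda>a. alpha_act \<sigma> a X)" "clinear (\<lambda>a. beta_act \<sigma> a X)"
proof -
  note L = lin assms clinear_compose[OF assms]
  show "clinear (alpha_act \<sigma> a)" "clinear (beta_act \<sigma> a)"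
    unfolding alpha_act_def beta_act_def by (intro clinear_lift L)+
  show "alpha_act \<sigma> a (x \<otimes> y) = \<sigma> x * a * y" "beta_act \<sigma> a (x \<otimes> y) = x * a * \<sigma> y"
    unfolding alpha_act_def beta_act_def by (rule lift_pure; intro L)+
  show "clinear (\<lambda>a. alpha_act \<sigma> a X)" "clinear (\<lambda>a. beta_act \<sigma> a X)"
    unfolding alpha_act_def beta_act_def by (intro L)+
qed

lemma act_mult:
  assumes "algebra_antihom \<sigma>"
  shows "alpha_act \<sigma> a (X * Y) = alpha_act \<sigma> (alpha_act \<sigma> a X) Y"
    and "beta_act \<sigma> a (X * Y) = beta_act \<sigma> (beta_act \<sigma> a Y) X"
    and "alpha_act \<sigma> a 1 = a" "beta_act \<sigma> a 1 = a"
proof -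
  note l = antihom_linear[OF assms]
  note s = act_linear[OF l] antihom_mult[OF assms] antihom_one[OF assms] mult.assoc pure_mult_pure
  note L = lin act_linear(1,2)[OF l] act_linear(1,2)[OF l, THEN clinear_compose]
    act_linear(5,6)[OF l] act_linear(5,6)[OF l, THEN clinear_compose]
  show "alpha_act \<sigma> a (X * Y) = alpha_act \<sigma> (alpha_act \<sigma> a X) Y"
    by (rule tensor_ext22[where f="\<lambda>X Y. alpha_act \<sigma> a (X * Y)"
          and g="\<lambda>X Y. alpha_act \<sigma> (alpha_act \<sigma> a X) Y"]) (intro L | simp add: s)+
  show "beta_act \<sigma> a (X * Y) = beta_act \<sigma> (beta_act \<sigma> a Y) X"
    by (rule tensor_ext22[where f="\<lambda>X Y. beta_act \<sigma> a (X * Y)"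
          and g="\<lambda>X Y. beta_act \<sigma> (beta_act \<sigma> a Y) X"]) (intro L | simp add: s)+
  show "alpha_act \<sigma> a 1 = a" "beta_act \<sigma> a 1 = a"
    by (simp_all add: one_tensor_def s)
qed

lemma act_transport:
  assumes "clinear \<sigma>" "clinear \<sigma>'" "\<And>x. \<sigma>' x * u = u * \<sigma> x"
  shows "u * alpha_act \<sigma> a X = alpha_act \<sigma>' (u * a) X"
    and "beta_act \<sigma>' a X * u = beta_act \<sigma> (a * u) X"
proof -
  note L = lin act_linear(1,2)[OF assms(1)] act_linear(1,2)[OF assms(2)]
  have "u * (\<sigma> x * a * y) = \<sigma>' x * (u * a) * y" for x y
    using assms(3)[of x] by (simp flip: mult.assoc)
  then show "u * alpha_act \<sigma> a X = alpha_act \<sigma>' (u * a) X"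
    by - (rule tensor_ext[where f="\<lambda>X. u * alpha_act \<sigma> a X" and g="alpha_act \<sigma>' (u * a)"],
      (intro L | simp add: act_linear(3)[OF assms(1)] act_linear(3)[OF assms(2)])+)
  show "beta_act \<sigma>' a X * u = beta_act \<sigma> (a * u) X"
    by (rule tensor_ext[where f="\<lambda>X. beta_act \<sigma>' a X * u" and g="beta_act \<sigma> (a * u)"])
      (intro L | simp add: act_linear(4)[OF assms(1)] act_linear(4)[OF assms(2)] mult.assoc assms(3))+
qed

section \<open>The inverse antipode and the second Drinfeld twist\<close>

context quasi_hopf_algebra
begin

lemma antipode_inv_simps:
  "antipode H (inv (antipode H) a) = a" "inv (antipode H) (antipode H a) = a"
  using antipode_bij by (simp_all add: bij_is_surj surj_f_inv_f bij_is_inj)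

lemma antipode_inv_antihom: "algebra_antihom (inv (antipode H))"
proof -
  have eqI: "x = y" if "antipode H x = antipode H y" for x y
    using that antipode_bij by (simp add: bij_is_inj inj_eq)
  have "clinear (inv (antipode H))"
    by (rule clinearI; rule eqI)
      (simp_all add: antipode_inv_simps clinear_add[OF clinear_antipode] clinear_scaleC[OF clinear_antipode])
  moreover have "inv (antipode H) 1 = 1" "inv (antipode H) (x * y) = inv (antipode H) y * inv (antipode H) x" for x y
    by (rule eqI, simp add: antipode_inv_simps S_simps)+
  ultimately show ?thesis by (simp add: algebra_antihom_def)
qed

lemmas clinear_antipode_inv = antihom_linear[OF antipode_inv_antihom]
lemmas clinear_antipode_inv_of [lin] = clinear_compose[OF clinear_antipode_inv]
lemmas Sinv_simps = antihom_mult[OF antipode_inv_antihom] antihom_one[OF antipode_inv_antihom]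
  antipode_inv_simps

definition antipode_inv2 :: "'h \<otimes> 'h \<Rightarrow> 'h \<otimes> 'h"
  where "antipode_inv2 t = tensor_map (inv (antipode H)) (inv (antipode H)) (flip t)"

lemma antipode_inv2_pure: "antipode_inv2 (a \<otimes> b) = inv (antipode H) b \<otimes> inv (antipode H) a"
  by (simp add: antipode_inv2_def tensor_map_pure_linear clinear_antipode_inv)

lemma clinear_antipode_inv2: "clinear antipode_inv2"
  unfolding antipode_inv2_def[abs_def] by (intro lin clinear_antipode_inv)

lemmas clinear_antipode_inv2_of [lin] = clinear_compose[OF clinear_antipode_inv2]

lemma antipode_inv2_antipode2: "antipode_inv2 (antipode2 t) = t" "antipode2 (antipode_inv2 t) = t"
  by (rule tensor_ext[where f="\<lambda>t. antipode_inv2 (antipode2 t)" and g="\<lambda>t. t"]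
      tensor_ext[where f="\<lambda>t. antipode2 (antipode_inv2 t)" and g="\<lambda>t. t"];
      (intro lin clinear_antipode2 clinear_antipode_inv2)?;
      simp add: antipode2_pure antipode_inv2_pure Sinv_simps)+

lemma antipode_inv2_antihom: "algebra_antihom antipode_inv2"
proof -
  have "antipode_inv2 (s * t) = antipode_inv2 t * antipode_inv2 s" for s t
    by (metis antihom_mult[OF antipode2_antihom] antipode_inv2_antipode2)
  moreover have "antipode_inv2 1 = 1"
    by (metis antihom_one[OF antipode2_antihom] antipode_inv2_antipode2(1))
  ultimately show ?thesis by (simp add: algebra_antihom_def clinear_antipode_inv2)
qed

lemma drinfeld_twist2_image: "drinfeld_twist2 H = antipode_inv2 (drinfeld_twist H)"
  by (simp add: drinfeld_twist2_def antipode_inv2_def)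

lemma drinfeld_twist2_inverse: "has_inverse (drinfeld_twist2 H)"
proof -
  let ?F = "drinfeld_twist H"
  note A = antipode_inv2_antihom
  have "antipode_inv2 (?F * inv_el ?F) = 1" "antipode_inv2 (inv_el ?F * ?F) = 1"
    by (simp_all add: inv_el_left inv_el_right drinfeld_twist_properties antihom_one[OF A])
  then show ?thesis
    unfolding has_inverse_def drinfeld_twist2_image by (auto simp: antihom_mult[OF A])
qed

lemma drinfeld_twist2_intertwines:
  "antipode_inv2 (comult H (antipode H a)) * drinfeld_twist2 H = drinfeld_twist2 H * comult H a"
  using arg_cong[OF drinfeld_twist_properties(2)[of a], of antipode_inv2]
  by (simp add: antihom_mult[OF antipode_inv2_antihom] drinfeld_twist2_image antipode_inv2_antipode2)

text \<open>The relation \<open>\<gamma>' F = \<Delta>(\<beta>)\<close> for the second Drinfeld twist, with the image of \<open>\<Delta>(\<beta>)\<close> moved to the other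
side by the intertwining property.\<close>

lemma drinfeld_twist2_beta:
  "antipode_inv2 gamma_bar * drinfeld_twist2 H = comult H (inv (antipode H) (beta H))"
proof -
  let ?G = "drinfeld_twist2 H"
  have "?G * antipode_inv2 gamma_bar = antipode_inv2 (comult H (beta H))"
    using arg_cong[OF drinfeld_twist_properties(4), of antipode_inv2]
    by (simp add: antihom_mult[OF antipode_inv2_antihom] drinfeld_twist2_image)
  then have "?G * (antipode_inv2 gamma_bar * ?G) = ?G * comult H (inv (antipode H) (beta H))"
    using drinfeld_twist2_intertwines[of "inv (antipode H) (beta H)"]
    by (simp add: Sinv_simps flip: mult.assoc)
  then have "inv_el ?G * (?G * (antipode_inv2 gamma_bar * ?G))
      = inv_el ?G * (?G * comult H (inv (antipode H) (beta H)))"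
    by simp
  then show ?thesis
    by (simp add: inv_el_left drinfeld_twist2_inverse flip: mult.assoc[of "inv_el ?G"])
qed

text \<open>Partial counits are homomorphisms because they are \<open>mlift\<close> of the identity and \<open>eta\<close>; hence the inverse
of a twist is normalised as well (\<open>twist_inverse\<close>).\<close>

lemma counit_snd_hom: "algebra_hom (counit_snd H :: 'h \<otimes> 'h \<Rightarrow> 'h)"
  and counit_fst_hom: "algebra_hom (counit_fst H :: 'h \<otimes> 'h \<Rightarrow> 'h)"
proof -
  have id: "algebra_hom (\<lambda>x::'h. x)" by (simp add: algebra_hom_def clinear_ident)
  have "counit_snd H = mlift (\<lambda>x::'h. x) eta" "counit_fst H = mlift eta (\<lambda>x::'h. x)"
    by (rule HOL.ext, simp add: mlift_eta_right mlift_eta_left clinear_ident)+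
  then show "algebra_hom (counit_snd H :: 'h \<otimes> 'h \<Rightarrow> 'h)" "algebra_hom (counit_fst H :: 'h \<otimes> 'h \<Rightarrow> 'h)"
    by (simp_all add: legs id)
qed

lemma twist_inverse:
  assumes "is_twist H F"
  shows "F * inv_el F = 1" "inv_el F * F = 1" "counit_fst H F = 1" "counit_snd H F = 1"
    "counit_fst H (inv_el F) = 1" "counit_snd H (inv_el F) = 1"
proof -
  show 1: "F * inv_el F = 1" "inv_el F * F = 1" "counit_fst H F = 1" "counit_snd H F = 1"
    using assms by (simp_all add: is_twist_def inv_el_left inv_el_right)
  from hom_mult[OF counit_fst_hom, of F "inv_el F"] hom_mult[OF counit_snd_hom, of F "inv_el F"]
  show "counit_fst H (inv_el F) = 1" "counit_snd H (inv_el F) = 1"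
    by (simp_all add: 1 hom_one[OF counit_fst_hom] hom_one[OF counit_snd_hom])
qed

lemma twist_legs:
  assumes "algebra_hom f" "algebra_hom g" "commuting f g" "is_twist H F"
  shows "mlift f g F * mlift f g (inv_el F) = 1" "mlift f g (inv_el F) * mlift f g F = 1"
  using assms by (simp_all add: twist_inverse hom_one[OF mlift_hom] flip: hom_mult[OF mlift_hom])

lemma twist_coassociator_legs:
  assumes "algebra_hom f" "algebra_hom g" "algebra_hom h"
    and "commuting f g" "commuting f h" "commuting g h"
  shows "mlift f (mlift g h) (twist_coassociator H F)
    = mlift f g F * mlift (conv f g) h F * Phi f g h * mlift f (conv g h) (inv_el F) * mlift g h (inv_el F)"
proof -
  have hom: "algebra_hom (mlift f (mlift g h))" by (intro legs assms)
  note l = assms(1-3)[THEN hom_linear]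
  show ?thesis
    unfolding twist_coassociator_def
    by (simp add: hom_mult[OF hom] mlift_reassoc l hom_one assms mlift_comult_fst mlift_map_id
        clinear_mlift clinear_comult mlift_pure Phi_def conv_def[of g, abs_def])
qed

end

section \<open>The conjugate antipode and the element w\<close>

context quasi_hopf_star_algebra
begin

text \<open>\<open>alpha_conj\<close> and \<open>beta_conj\<close> are the canonical elements of the conjugate structure: reversing products
and replacing \<open>S\<close> by \<open>St\<close> exchanges \<open>\<alpha>\<close> and \<open>\<beta>\<close>.\<close>

abbreviation "Om \<equiv> star_can H"
abbreviation "Omi \<equiv> inv_el (star_can H)"
abbreviation "St \<equiv> conj_antipode H"
abbreviation "alpha_conj \<equiv> conj_op H (inv (antipode H) (beta H))"
abbreviation "beta_conj \<equiv> conj_op H (inv (antipode H) (alpha H))"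

lemmas Om_simps = twist_inverse[OF star_can_twist]

lemma conj_simps:
  "antilinear (conj_op H)" "conj_op H (conj_op H a) = a" "conj_op H (a * b) = conj_op H b * conj_op H a"
  "conj_op H 1 = 1" "conj_op H (x + y) = conj_op H x + conj_op H y"
  "conj_op H (c *\<^sub>C x) = cnj c *\<^sub>C conj_op H x"
proof -
  show 1: "antilinear (conj_op H)" "\<And>a. conj_op H (conj_op H a) = a"
    "\<And>a b. conj_op H (a * b) = conj_op H b * conj_op H a"
    using conj_op by (simp_all add: conjugation_def)
  show "conj_op H 1 = 1"
    using 1(3)[of 1 "conj_op H 1"] by (simp add: 1(2))
  show "conj_op H (x + y) = conj_op H x + conj_op H y" "conj_op H (c *\<^sub>C x) = cnj c *\<^sub>C conj_op H x"
    using 1(1) by (simp_all add: antilinear_def)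
qed

lemma conj2_antilinear: "antilinear (conj2 H)"
  unfolding conj2_def by (intro antilinear_tensor_map conj_simps)

lemma conj3_antilinear: "antilinear (conj3 H)"
  unfolding conj3_def by (intro antilinear_tensor_map conj_simps conj2_antilinear)

definition conj4 :: "'h \<otimes> 'h \<otimes> 'h \<otimes> 'h \<Rightarrow> 'h \<otimes> 'h \<otimes> 'h \<otimes> 'h"
  where "conj4 = tensor_map (conj_op H) (conj3 H)"

lemma conj_pure:
  "conj2 H (a \<otimes> b) = conj_op H a \<otimes> conj_op H b"
  "conj3 H (a \<otimes> t) = conj_op H a \<otimes> conj2 H t"
  "conj4 (a \<otimes> u) = conj_op H a \<otimes> conj3 H u"
  by (simp_all add: conj2_def conj3_def conj4_def tensor_map_pure_antilinear conj_simps
      conj2_antilinear[unfolded conj2_def] conj3_antilinear[unfolded conj3_def conj2_def])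

lemma conj_add:
  "conj2 H (s + t) = conj2 H s + conj2 H t" "conj3 H (x + y) = conj3 H x + conj3 H y"
  "conj4 (u + v) = conj4 u + conj4 v"
  by (simp_all add: conj2_def conj3_def conj4_def tensor_map_def tensor_lift_add)

lemma conj_mult:
  "conj2 H (s * t) = conj2 H t * conj2 H s" "conj3 H (x * y) = conj3 H y * conj3 H x"
  "conj4 (u * v) = conj4 v * conj4 u"
proof -
  note a = conj_add distrib_left distrib_right conj_pure conj_simps pure_mult_pure
  show 2: "conj2 H (s * t) = conj2 H t * conj2 H s" for s t
  proof (rule additive_eq_on_tensors[where x=s and f="\<lambda>s. conj2 H (s * t)" and g="\<lambda>s. conj2 H t * conj2 H s"])
    show "conj2 H ((p \<otimes> q) * t) = conj2 H t * conj2 H (p \<otimes> q)" for p q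
      by (rule additive_eq_on_tensors[where x=t and f="\<lambda>t. conj2 H ((p \<otimes> q) * t)"]) (simp_all add: a)
  qed (simp_all add: a)
  show 3: "conj3 H (x * y) = conj3 H y * conj3 H x" for x y
  proof (rule additive_eq_on_tensors[where x=x and f="\<lambda>x. conj3 H (x * y)" and g="\<lambda>x. conj3 H y * conj3 H x"])
    show "conj3 H ((p \<otimes> q) * y) = conj3 H y * conj3 H (p \<otimes> q)" for p q
      by (rule additive_eq_on_tensors[where x=y and f="\<lambda>t. conj3 H ((p \<otimes> q) * t)"]) (simp_all add: a 2)
  qed (simp_all add: a)
  show "conj4 (u * v) = conj4 v * conj4 u"
  proof (rule additive_eq_on_tensors[where x=u and f="\<lambda>u. conj4 (u * v)" and g="\<lambda>u. conj4 v * conj4 u"])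
    show "conj4 ((p \<otimes> q) * v) = conj4 v * conj4 (p \<otimes> q)" for p q
      by (rule additive_eq_on_tensors[where x=v and f="\<lambda>t. conj4 ((p \<otimes> q) * t)"]) (simp_all add: a 3)
  qed (simp_all add: a)
qed

lemma conj_one: "conj2 H 1 = 1" "conj3 H 1 = 1"
  by (simp_all add: one_tensor_def conj_pure conj_simps)

lemma conj2_comult: "conj2 H (comult H (conj_op H a)) = Om * comult H a * Omi"
  by (simp add: comult_conj conj_simps)

text \<open>The associator of the conjugate structure is the inverse of \<open>\<Phi>\<^sup>\<dagger>\<close>, which by the last axiom of a
quasi-Hopf star-algebra is the twisted associator.\<close>

lemma conj3_coassociator_inv: "conj3 H (inv_el (coassociator H)) = twist_coassociator H Om"
  using inv_el_eqI[of "conj3 H (coassociator H)" "conj3 H (inv_el (coassociator H))"]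
  by (simp add: coassociator_conj conj_one inv_el_left inv_el_right coassociator_inv flip: conj_mult(2))

lemma conj3_coassociator_cancel:
  "conj3 H (coassociator H) * twist_coassociator H Om = 1"
  "twist_coassociator H Om * conj3 H (coassociator H) = 1"
  by (simp_all add: conj_one inv_el_left inv_el_right coassociator_inv
      flip: conj3_coassociator_inv conj_mult(2))

lemma conj_antipode_antihom: "algebra_antihom St"
  unfolding algebra_antihom_def conj_antipode_def[abs_def]
  by (intro conjI clinearI allI)
    (simp_all add: conj_simps Sinv_simps clinear_add[OF clinear_antipode_inv] clinear_scaleC[OF clinear_antipode_inv])

lemmas clinear_St = antihom_linear[OF conj_antipode_antihom]
lemmas clinear_St_of [lin] = clinear_compose[OF clinear_St]
lemmas St_simps = antihom_mult[OF conj_antipode_antihom] antihom_one[OF conj_antipode_antihom]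

text \<open>The map \<open>\<dagger> S\<^sup>-\<^sup>1\<close> takes \<open>x \<beta> S(y)\<close> to \<open>St(x\<^sup>\<dagger>) alpha_conj y\<^sup>\<dagger>\<close>; this is how the axioms for \<open>\<beta>\<close> give
those for \<open>alpha_conj\<close>.\<close>

lemma alpha_act_conj2:
  "alpha_act St alpha_conj (conj2 H t) = conj_op H (inv (antipode H) (beta_act (antipode H) (beta H) t))"
  by (rule additive_eq_on_tensors[where f="\<lambda>t. alpha_act St alpha_conj (conj2 H t)"])
    (simp_all add: conj_add conj_simps clinear_add[OF act_linear(1)[OF clinear_St]]
      clinear_add[OF act_linear(2)[OF clinear_antipode]] clinear_add[OF clinear_antipode_inv]
      conj_pure act_linear clinear_St clinear_antipode Sinv_simps mult.assoc, simp add: conj_antipode_def conj_simps)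

lemma beta_act_conj2:
  "beta_act St beta_conj (conj2 H t) = conj_op H (inv (antipode H) (alpha_act (antipode H) (alpha H) t))"
  by (rule additive_eq_on_tensors[where f="\<lambda>t. beta_act St beta_conj (conj2 H t)"])
    (simp_all add: conj_add conj_simps clinear_add[OF act_linear(2)[OF clinear_St]]
      clinear_add[OF act_linear(1)[OF clinear_antipode]] clinear_add[OF clinear_antipode_inv]
      conj_pure act_linear clinear_St clinear_antipode Sinv_simps mult.assoc, simp add: conj_antipode_def conj_simps)

lemma alpha_act_conj_comult:
  "alpha_act St alpha_conj (Om * comult H a * Omi) = counit H a *\<^sub>C alpha_conj"
  by (simp add: alpha_act_conj2 beta_act_def antipode_beta clinear_scaleC[OF clinear_antipode_inv]
      conj_simps counit_conj flip: conj2_comult)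

lemma beta_act_conj_comult:
  "beta_act St beta_conj (Om * comult H a * Omi) = counit H a *\<^sub>C beta_conj"
  by (simp add: beta_act_conj2 alpha_act_def antipode_alpha clinear_scaleC[OF clinear_antipode_inv]
      conj_simps counit_conj flip: conj2_comult)

text \<open>\<open>(St, alpha_conj, beta_conj)\<close> is an antipode for the coproduct and associator twisted by \<open>\<Omega>\<close>. The
action of \<open>\<Omega>\<close> on \<open>alpha_conj\<close> and of \<open>\<Omega>\<^sup>-\<^sup>1\<close> on \<open>beta_conj\<close> undoes the twist, so that the result can be
compared with \<open>(S, \<alpha>, \<beta>)\<close>.\<close>

definition "alpha_untwisted = alpha_act St alpha_conj Om"
definition "beta_untwisted = beta_act St beta_conj Omi"

lemma untwisted_invariant:
  "alpha_act St alpha_untwisted (comult H a) = counit H a *\<^sub>C alpha_untwisted"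
  "beta_act St beta_untwisted (comult H a) = counit H a *\<^sub>C beta_untwisted"
proof -
  note m = act_mult[OF conj_antipode_antihom] and l = act_linear[OF clinear_St]
  have "Om * comult H a = Om * comult H a * Omi * Om" "comult H a * Omi = Omi * (Om * comult H a * Omi)"
    by (simp_all add: mult.assoc Om_simps) (simp add: Om_simps flip: mult.assoc)
  then show "alpha_act St alpha_untwisted (comult H a) = counit H a *\<^sub>C alpha_untwisted"
    "beta_act St beta_untwisted (comult H a) = counit H a *\<^sub>C beta_untwisted"
    unfolding alpha_untwisted_def beta_untwisted_def
    by (metis m(1) alpha_act_conj_comult clinear_scaleC[OF l(5)])
      (metis m(2) beta_act_conj_comult clinear_scaleC[OF l(6)] \<open>comult H a * Omi = Omi * (Om * comult H a * Omi)\<close>)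
qed

lemma conj3_coassociator_legs:
  fixes f g h :: "'h \<Rightarrow> 'b::complex_algebra_1"
  assumes "algebra_hom f" "algebra_hom g" "algebra_hom h"
    and "commuting f g" "commuting f h" "commuting g h"
  shows "mlift f (mlift g h) (conj3 H (coassociator H))
    = mlift g h Om * mlift f (conv g h) Om * Phi_inv f g h * mlift (conv f g) h Omi * mlift f g Omi"
    (is "?z = ?y")
proof -
  have hom: "algebra_hom (mlift f (mlift g h))" by (intro legs assms)
  let ?x = "mlift f (mlift g h) (twist_coassociator H Om)"
  have zx: "?z * ?x = 1"
    by (simp add: conj3_coassociator_cancel hom_one[OF hom] flip: hom_mult[OF hom])
  have cancel: "p * (q * r) = r" if "p * q = 1" for p q r :: 'b
    using that by (simp flip: mult.assoc)
  have k: "mlift f g Om * mlift f g Omi = 1" "mlift (conv f g) h Om * mlift (conv f g) h Omi = 1"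
    "mlift f (conv g h) Omi * mlift f (conv g h) Om = 1" "mlift g h Omi * mlift g h Om = 1"
    "Phi f g h * Phi_inv f g h = 1"
    by (intro twist_legs Phi_cancel legs assms star_can_twist commuting_sym[OF assms(5)] commuting_sym[OF assms(6)])+
  have "?x * ?y = 1"
    by (simp add: twist_coassociator_legs assms mult.assoc k k[THEN cancel])
  from inv_el_unique[OF this zx] show ?thesis by simp
qed

text \<open>The twisted coproduct on two legs.\<close>

definition conv_tw :: "('h \<Rightarrow> 'a::complex_algebra_1) \<Rightarrow> ('h \<Rightarrow> 'a) \<Rightarrow> 'h \<Rightarrow> 'a"
  where "conv_tw f g a = mlift f g (Om * comult H a * Omi)"

lemma conv_tw_linear: "clinear f \<Longrightarrow> clinear g \<Longrightarrow> clinear (conv_tw f g)"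
  unfolding conv_tw_def[abs_def] by (intro lin clinear_comult)

lemma conv_tw_intertwine:
  assumes "algebra_hom f" "algebra_hom g" "commuting f g"
  shows "mlift f g Om * conv f g a = conv_tw f g a * mlift f g Om"
    and "mlift f g Omi * conv_tw f g a = conv f g a * mlift f g Omi"
  unfolding conv_def conv_tw_def hom_mult[OF mlift_hom[OF assms], symmetric]
  by (simp_all add: mult.assoc Om_simps) (simp add: Om_simps flip: mult.assoc)

text \<open>The identity for \<open>St\<close> with the twisted associator is the conjugate of the second zigzag identity of
\<open>H\<close>. It differs from the claim by two factors, which contain \<open>\<Omega>\<close> with a twisted coproduct on the
first two legs and \<open>\<Omega>\<^sup>-\<^sup>1\<close> with one on the last two legs. These are contracted at \<open>alpha_conj\<close> and \<open>beta_conj\<close>, and the two factors that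
are left turn \<open>alpha_conj\<close> and \<open>beta_conj\<close> into the untwisted elements.\<close>

lemma conj_antipode_zigzag_left:
  "tensor_lift3 (\<lambda>x y z. St x * alpha_untwisted * y * beta_untwisted * St z) (coassociator H) = 1"
proof -
  let ?l1 = "leg31 :: 'h \<Rightarrow> _" and ?l2 = "leg32 :: 'h \<Rightarrow> _"
  let ?l3 = "leg33 :: 'h \<Rightarrow> _"
  let ?c12 = "conv ?l1 ?l2" and ?c23 = "conv ?l2 ?l3"
  let ?z = "\<lambda>a b. tensor_lift3 (\<lambda>x y z. St x * a * y * b * St z)"
  define \<tau> where "\<tau> = ?z alpha_conj beta_conj"
  have zl: "clinear (?z a b)" for a b
    by (rule clinear_lift3_of[OF _ _ _ clinear_ident]; intro lin clinear_St)
  have zp: "?z a b (x \<otimes> y \<otimes> z) = St x * a * y * b * St z" for a b x y z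
    by (rule lift3_pure; intro lin clinear_St)
  have \<tau>: "clinear \<tau>" unfolding \<tau>_def by (rule zl)
  have \<tau>_pure: "\<tau> (x \<otimes> y \<otimes> z) = St x * alpha_conj * y * beta_conj * St z" for x y z
    unfolding \<tau>_def by (rule zp)
  note L = lin clinear_compose[OF \<tau>] leg3_linear clinear_St act_linear(1,2)[OF clinear_St]
  have core: "\<tau> (mlift ?l1 ?l2 s * T * mlift ?l2 ?l3 t)
      = ?z (alpha_act St alpha_conj s) (beta_act St beta_conj t) T" for s t T
  proof (rule tensor_ext3[where t=T and f="\<lambda>T. \<tau> (mlift ?l1 ?l2 s * T * mlift ?l2 ?l3 t)"
        and g="?z (alpha_act St alpha_conj s) (beta_act St beta_conj t)"])
    fix x y z
    show "\<tau> (mlift ?l1 ?l2 s * (x \<otimes> y \<otimes> z) * mlift ?l2 ?l3 t)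
      = ?z (alpha_act St alpha_conj s) (beta_act St beta_conj t) (x \<otimes> y \<otimes> z)"
      unfolding zp
      by (rule tensor_ext22[where f="\<lambda>s t. \<tau> (mlift ?l1 ?l2 s * (x \<otimes> y \<otimes> z) * mlift ?l2 ?l3 t)"
            and g="\<lambda>s t. St x * alpha_act St alpha_conj s * y * beta_act St beta_conj t * St z"])
        (intro L | simp add: mlift_pure leg3_linear
          | simp add: leg3_defs pure_mult_pure \<tau>_pure act_linear clinear_St St_simps mult.assoc)+
  qed (intro L zl)+
  have one: "mlift ?l1 ?l2 1 = (1::'h \<otimes> 'h \<otimes> 'h)" "mlift ?l2 ?l3 1 = (1::'h \<otimes> 'h \<otimes> 'h)"
    by (intro hom_one legs)+
  have eta: "mlift ?l1 ?l2 (counit H a *\<^sub>C 1) = (eta a :: 'h \<otimes> 'h \<otimes> 'h)"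
    "mlift ?l2 ?l3 (counit H a *\<^sub>C 1) = (eta a :: 'h \<otimes> 'h \<otimes> 'h)" for a
    by (simp_all add: clinear_scaleC clinear_mlift leg3_linear one eta_def)
  note m = act_mult[OF conj_antipode_antihom]
  have l: "left_equiv \<tau> (conv_tw ?l1 ?l2) eta"
    unfolding left_equiv_def
  proof (intro allI)
    fix a T
    show "\<tau> (conv_tw ?l1 ?l2 a * T) = \<tau> (eta a * T)"
      using core[of "Om * comult H a * Omi" T 1] core[of "counit H a *\<^sub>C 1" T 1]
      by (simp add: one eta conv_tw_def alpha_act_conj_comult m(3,4)
          clinear_scaleC[OF act_linear(1)[OF clinear_St]])
  qed
  have r: "right_equiv \<tau> (conv_tw ?l2 ?l3) eta"
    unfolding right_equiv_def
  proof (intro allI)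
    fix a T
    show "\<tau> (T * conv_tw ?l2 ?l3 a) = \<tau> (T * eta a)"
      using core[of 1 T "Om * comult H a * Omi"] core[of 1 T "counit H a *\<^sub>C 1"]
      by (simp add: one eta conv_tw_def beta_act_conj_comult m(3,4)
          clinear_scaleC[OF act_linear(2)[OF clinear_St]])
  qed
  let ?P = "Phi ?l1 ?l2 ?l3 :: 'h \<otimes> 'h \<otimes> 'h"
  have "?z alpha_untwisted beta_untwisted (coassociator H)
      = \<tau> (mlift ?l1 ?l2 Om * ?P * mlift ?l2 ?l3 Omi)"
    by (simp add: core alpha_untwisted_def beta_untwisted_def Phi_def leg3_mlift)
  \<comment> \<open>Both partial counits of \<open>\<Omega>\<close> and of its inverse are \<open>1\<close>, so the missing factors may be inserted
       with \<open>eta\<close> in the place of the twisted coproduct.\<close>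
  also have "\<dots> = \<tau> (mlift eta ?l3 Om * (mlift ?l1 ?l2 Om * ?P * mlift ?l2 ?l3 Omi))"
    by (simp add: mlift_eta_left leg3_linear Om_simps hom_one legs)
  also have "\<dots> = \<tau> (mlift (conv_tw ?l1 ?l2) ?l3 Om * (mlift ?l1 ?l2 Om * ?P * mlift ?l2 ?l3 Omi))"
    by (rule left_equivD[OF left_equiv_mlift1[OF l \<tau>], symmetric])
      (intro conv_tw_linear leg3_linear hom_linear[OF eta_hom])+
  also have "\<dots> = \<tau> ((mlift (conv_tw ?l1 ?l2) ?l3 Om * mlift ?l1 ?l2 Om) * ?P
      * mlift ?l2 ?l3 Omi * mlift ?l1 eta Omi)"
    by (simp add: mlift_eta_right leg3_linear Om_simps hom_one legs mult.assoc)
  also have "\<dots> = \<tau> ((mlift (conv_tw ?l1 ?l2) ?l3 Om * mlift ?l1 ?l2 Om) * ?P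
      * mlift ?l2 ?l3 Omi * mlift ?l1 (conv_tw ?l2 ?l3) Omi)"
    by (rule right_equivD[OF right_equiv_mlift2[OF r \<tau>], symmetric])
      (intro conv_tw_linear leg3_linear hom_linear[OF eta_hom])+
  also have "mlift (conv_tw ?l1 ?l2) ?l3 Om * mlift ?l1 ?l2 Om
      = mlift ?l1 ?l2 Om * mlift ?c12 ?l3 (Om :: 'h \<otimes> 'h)"
  proof (rule mlift_intertwine[symmetric])
    have "commuting (mlift ?l1 ?l2) ?l3" by (intro legs)
    then show "mlift ?l1 ?l2 Om * ?l3 y = ?l3 y * mlift ?l1 ?l2 Om" for y
      by (simp add: commuting_def)
  qed (intro conv_tw_linear clinear_conv leg3_linear conv_tw_intertwine legs)+
  also have "mlift ?l1 ?l2 Om * mlift ?c12 ?l3 Om * ?P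
      * mlift ?l2 ?l3 Omi * mlift ?l1 (conv_tw ?l2 ?l3) Omi
    = mlift ?l1 ?l2 Om * mlift ?c12 ?l3 Om * ?P
      * (mlift ?l2 ?l3 Omi * mlift ?l1 (conv_tw ?l2 ?l3) Omi)"
    by (simp add: mult.assoc)
  also have "mlift ?l2 ?l3 Omi * mlift ?l1 (conv_tw ?l2 ?l3) Omi
      = mlift ?l1 ?c23 Omi * mlift ?l2 ?l3 (Omi :: 'h \<otimes> 'h)"
  proof (rule mlift_intertwine)
    have "commuting (mlift ?l2 ?l3) ?l1" by (intro legs)
    then show "mlift ?l2 ?l3 Omi * ?l1 y = ?l1 y * mlift ?l2 ?l3 Omi" for y
      by (simp add: commuting_def)
  qed (intro conv_tw_linear clinear_conv leg3_linear conv_tw_intertwine legs)+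
  also have "mlift ?l1 ?l2 Om * mlift ?c12 ?l3 Om * ?P
      * (mlift ?l1 ?c23 Omi * mlift ?l2 ?l3 Omi)
      = mlift ?l1 (mlift ?l2 ?l3) (twist_coassociator H Om)"
    by (subst twist_coassociator_legs) (intro legs | simp add: mult.assoc)+
  also have "\<dots> = conj3 H (inv_el (coassociator H))"
    by (simp add: leg3_mlift conj3_coassociator_inv)
  also have "\<tau> (conj3 H (inv_el (coassociator H))) = 1"
  proof -
    have "\<tau> (conj3 H X)
      = conj_op H (inv (antipode H) (tensor_lift3 (\<lambda>x y z. x * beta H * antipode H y * alpha H * z) X))" for X
    proof -
      define q where "q = tensor_lift3 (\<lambda>x y z. x * beta H * antipode H y * alpha H * z)"
      have q: "clinear q" unfolding q_def by (rule clinear_lift3_of[OF _ _ _ clinear_ident]; intro lin)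
      have q_pure: "q (x \<otimes> y \<otimes> z) = x * beta H * antipode H y * alpha H * z" for x y z
        unfolding q_def by (rule lift3_pure; intro lin)
      have "\<tau> (conj3 H X) = conj_op H (inv (antipode H) (q X))"
        by (rule additive_ext3[where f="\<lambda>X. \<tau> (conj3 H X)" and g="\<lambda>X. conj_op H (inv (antipode H) (q X))"])
          (simp_all add: conj_add conj_simps clinear_add[OF \<tau>] clinear_add[OF q] clinear_add[OF clinear_antipode_inv]
            conj_pure \<tau>_pure q_pure Sinv_simps mult.assoc, simp add: conj_antipode_def conj_simps)
      then show ?thesis by (simp add: q_def)
    qed
    then show ?thesis
      by (simp add: antipode_coassociator_inv Sinv_simps conj_simps)
  qed
  finally show ?thesis .
qed

text \<open>The same argument for the conjugate of the first zigzag identity of \<open>H\<close>, with the inverse of the twisted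
associator; the coproducts are on the same pairs of legs, but contracted at the opposite ends.\<close>

lemma conj_antipode_zigzag_right:
  "tensor_lift3 (\<lambda>x y z. x * beta_untwisted * St y * alpha_untwisted * z) (inv_el (coassociator H)) = 1"
proof -
  let ?l1 = "leg31 :: 'h \<Rightarrow> _" and ?l2 = "leg32 :: 'h \<Rightarrow> _"
  let ?l3 = "leg33 :: 'h \<Rightarrow> _"
  let ?c12 = "conv ?l1 ?l2" and ?c23 = "conv ?l2 ?l3"
  let ?z = "\<lambda>a b. tensor_lift3 (\<lambda>x y z. x * b * St y * a * z)"
  define \<tau> where "\<tau> = ?z alpha_conj beta_conj"
  have zl: "clinear (?z a b)" for a b
    by (rule clinear_lift3_of[OF _ _ _ clinear_ident]; intro lin clinear_St)
  have zp: "?z a b (x \<otimes> y \<otimes> z) = x * b * St y * a * z" for a b x y z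
    by (rule lift3_pure; intro lin clinear_St)
  have \<tau>: "clinear \<tau>" unfolding \<tau>_def by (rule zl)
  have \<tau>_pure: "\<tau> (x \<otimes> y \<otimes> z) = x * beta_conj * St y * alpha_conj * z" for x y z
    unfolding \<tau>_def by (rule zp)
  note L = lin clinear_compose[OF \<tau>] leg3_linear clinear_St act_linear(1,2)[OF clinear_St]
  have core: "\<tau> (mlift ?l2 ?l3 s * T * mlift ?l1 ?l2 t)
      = ?z (alpha_act St alpha_conj s) (beta_act St beta_conj t) T" for s t T
  proof (rule tensor_ext3[where t=T and f="\<lambda>T. \<tau> (mlift ?l2 ?l3 s * T * mlift ?l1 ?l2 t)"
        and g="?z (alpha_act St alpha_conj s) (beta_act St beta_conj t)"])
    fix x y z
    show "\<tau> (mlift ?l2 ?l3 s * (x \<otimes> y \<otimes> z) * mlift ?l1 ?l2 t)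
      = ?z (alpha_act St alpha_conj s) (beta_act St beta_conj t) (x \<otimes> y \<otimes> z)"
      unfolding zp
      by (rule tensor_ext22[where f="\<lambda>s t. \<tau> (mlift ?l2 ?l3 s * (x \<otimes> y \<otimes> z) * mlift ?l1 ?l2 t)"
            and g="\<lambda>s t. x * beta_act St beta_conj t * St y * alpha_act St alpha_conj s * z"])
        (intro L | simp add: mlift_pure leg3_linear
          | simp add: leg3_defs pure_mult_pure \<tau>_pure act_linear clinear_St St_simps mult.assoc)+
  qed (intro L zl)+
  have one: "mlift ?l1 ?l2 1 = (1::'h \<otimes> 'h \<otimes> 'h)" "mlift ?l2 ?l3 1 = (1::'h \<otimes> 'h \<otimes> 'h)"
    by (intro hom_one legs)+
  have eta: "mlift ?l1 ?l2 (counit H a *\<^sub>C 1) = (eta a :: 'h \<otimes> 'h \<otimes> 'h)"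
    "mlift ?l2 ?l3 (counit H a *\<^sub>C 1) = (eta a :: 'h \<otimes> 'h \<otimes> 'h)" for a
    by (simp_all add: clinear_scaleC clinear_mlift leg3_linear one eta_def)
  note m = act_mult[OF conj_antipode_antihom]
  have l: "left_equiv \<tau> (conv_tw ?l2 ?l3) eta"
    unfolding left_equiv_def
  proof (intro allI)
    fix a T
    show "\<tau> (conv_tw ?l2 ?l3 a * T) = \<tau> (eta a * T)"
      using core[of "Om * comult H a * Omi" T 1] core[of "counit H a *\<^sub>C 1" T 1]
      by (simp add: one eta conv_tw_def alpha_act_conj_comult m(3,4)
          clinear_scaleC[OF act_linear(1)[OF clinear_St]])
  qed
  have r: "right_equiv \<tau> (conv_tw ?l1 ?l2) eta"
    unfolding right_equiv_def
  proof (intro allI)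
    fix a T
    show "\<tau> (T * conv_tw ?l1 ?l2 a) = \<tau> (T * eta a)"
      using core[of 1 T "Om * comult H a * Omi"] core[of 1 T "counit H a *\<^sub>C 1"]
      by (simp add: one eta conv_tw_def beta_act_conj_comult m(3,4)
          clinear_scaleC[OF act_linear(2)[OF clinear_St]])
  qed
  let ?P = "Phi_inv ?l1 ?l2 ?l3 :: 'h \<otimes> 'h \<otimes> 'h"
  have "?z alpha_untwisted beta_untwisted (inv_el (coassociator H))
      = \<tau> (mlift ?l2 ?l3 Om * ?P * mlift ?l1 ?l2 Omi)"
    by (simp add: core alpha_untwisted_def beta_untwisted_def Phi_inv_def leg3_mlift)
  also have "\<dots> = \<tau> (mlift ?l1 eta Om * (mlift ?l2 ?l3 Om * ?P * mlift ?l1 ?l2 Omi))"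
    by (simp add: mlift_eta_right leg3_linear Om_simps hom_one legs)
  also have "\<dots> = \<tau> (mlift ?l1 (conv_tw ?l2 ?l3) Om * (mlift ?l2 ?l3 Om * ?P * mlift ?l1 ?l2 Omi))"
  proof (rule left_equivD[OF left_equiv_mlift2[OF l \<tau>], symmetric])
    have "commuting ?l1 (mlift ?l2 ?l3)" by (intro legs)
    then show "commuting ?l1 (conv_tw ?l2 ?l3 :: 'h \<Rightarrow> _)"
      by (simp add: commuting_def conv_tw_def)
  qed (intro conv_tw_linear leg3_linear hom_linear[OF eta_hom] legs)+
  also have "\<dots> = \<tau> ((mlift ?l1 (conv_tw ?l2 ?l3) Om * mlift ?l2 ?l3 Om) * ?P
      * mlift ?l1 ?l2 Omi * mlift eta ?l3 Omi)"
    by (simp add: mlift_eta_left leg3_linear Om_simps hom_one legs mult.assoc)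
  also have "\<dots> = \<tau> ((mlift ?l1 (conv_tw ?l2 ?l3) Om * mlift ?l2 ?l3 Om) * ?P
      * mlift ?l1 ?l2 Omi * mlift (conv_tw ?l1 ?l2) ?l3 Omi)"
  proof (rule right_equivD[OF right_equiv_mlift1[OF r \<tau>], symmetric])
    have "commuting (mlift ?l1 ?l2) ?l3" by (intro legs)
    then show "commuting (conv_tw ?l1 ?l2) ?l3"
      by (simp add: commuting_def conv_tw_def)
  qed (intro conv_tw_linear leg3_linear hom_linear[OF eta_hom] legs)+
  also have "mlift ?l1 (conv_tw ?l2 ?l3) Om * mlift ?l2 ?l3 Om
      = mlift ?l2 ?l3 Om * mlift ?l1 ?c23 (Om :: 'h \<otimes> 'h)"
  proof (rule mlift_intertwine[symmetric])
    have "commuting (mlift ?l2 ?l3) ?l1" by (intro legs)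
    then show "mlift ?l2 ?l3 Om * ?l1 y = ?l1 y * mlift ?l2 ?l3 Om" for y
      by (simp add: commuting_def)
  qed (intro conv_tw_linear clinear_conv leg3_linear conv_tw_intertwine legs)+
  also have "mlift ?l2 ?l3 Om * mlift ?l1 ?c23 Om * ?P
      * mlift ?l1 ?l2 Omi * mlift (conv_tw ?l1 ?l2) ?l3 Omi
    = mlift ?l2 ?l3 Om * mlift ?l1 ?c23 Om * ?P
      * (mlift ?l1 ?l2 Omi * mlift (conv_tw ?l1 ?l2) ?l3 Omi)"
    by (simp add: mult.assoc)
  also have "mlift ?l1 ?l2 Omi * mlift (conv_tw ?l1 ?l2) ?l3 Omi
      = mlift ?c12 ?l3 Omi * mlift ?l1 ?l2 (Omi :: 'h \<otimes> 'h)"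
  proof (rule mlift_intertwine)
    have "commuting (mlift ?l1 ?l2) ?l3" by (intro legs)
    then show "mlift ?l1 ?l2 Omi * ?l3 y = ?l3 y * mlift ?l1 ?l2 Omi" for y
      by (simp add: commuting_def)
  qed (intro conv_tw_linear clinear_conv leg3_linear conv_tw_intertwine legs)+
  also have "mlift ?l2 ?l3 Om * mlift ?l1 ?c23 Om * ?P
      * (mlift ?c12 ?l3 Omi * mlift ?l1 ?l2 Omi)
      = mlift ?l1 (mlift ?l2 ?l3) (conj3 H (coassociator H))"
    by (subst conj3_coassociator_legs) (intro legs | simp add: mult.assoc)+
  also have "\<dots> = conj3 H (coassociator H)"
    by (simp add: leg3_mlift)
  also have "\<tau> (conj3 H (coassociator H)) = 1"
  proof -
    have "\<tau> (conj3 H X)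
      = conj_op H (inv (antipode H) (tensor_lift3 (\<lambda>x y z. antipode H x * alpha H * y * beta H * antipode H z) X))" for X
    proof -
      define q where "q = tensor_lift3 (\<lambda>x y z. antipode H x * alpha H * y * beta H * antipode H z)"
      have q: "clinear q" unfolding q_def
        by (rule clinear_lift3_of[OF _ _ _ clinear_ident]; intro lin clinear_antipode)
      have q_pure: "q (x \<otimes> y \<otimes> z) = antipode H x * alpha H * y * beta H * antipode H z" for x y z
        unfolding q_def by (rule lift3_pure; intro lin clinear_antipode)
      have "\<tau> (conj3 H X) = conj_op H (inv (antipode H) (q X))"
        by (rule additive_ext3[where f="\<lambda>X. \<tau> (conj3 H X)" and g="\<lambda>X. conj_op H (inv (antipode H) (q X))"])
          (simp_all add: conj_add conj_simps clinear_add[OF \<tau>] clinear_add[OF q] clinear_add[OF clinear_antipode_inv]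
            conj_pure \<tau>_pure q_pure Sinv_simps mult.assoc, simp add: conj_antipode_def conj_simps)
      then show ?thesis by (simp add: q_def)
    qed
    then show ?thesis
      by (simp add: antipode_coassociator Sinv_simps conj_simps)
  qed
  finally show ?thesis .
qed

theorem antipode_along_conj:
  "antipode_along (\<lambda>x. x) St alpha_untwisted beta_untwisted"
  unfolding antipode_along_def
  using untwisted_invariant conj_antipode_zigzag_left conj_antipode_zigzag_right
    conj_antipode_antihom
  by (simp add: algebra_hom_def clinear_ident alpha_act_def beta_act_def)

lemma antipode_along_id: "antipode_along (\<lambda>x. x) (antipode H) (alpha H) (beta H)"
  by (rule antipode_along_antipode) (simp add: algebra_hom_def clinear_ident)

lemma twist_alpha_act: "twist_alpha H Om = alpha_act (antipode H) (alpha H) Omi"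
  by (simp add: twist_alpha_def alpha_act_def)

lemma twist_beta_act: "twist_beta H Om = beta_act (antipode H) (beta H) Om"
  by (simp add: twist_beta_def beta_act_def)

lemma inverse_intertwine:
  assumes "has_inverse w"
  shows "a = w * b * inv_el w \<longleftrightarrow> a * w = w * (b::'h)"
  by (metis assms inv_el_left inv_el_right mult.assoc mult_1_right)

text \<open>The comparison element of \<open>S\<close> and \<open>St\<close> satisfies the conditions that define \<open>w\<close>, once the untwisted
elements are twisted back by \<open>act_transport\<close>. Conversely, for every element that satisfies them the
same untwisting yields the hypotheses of \<open>comparison_unique\<close>.\<close>

theorem canonical_w_properties:
  shows "has_inverse (canonical_w H)"
    and "canonical_w H * alpha_conj = twist_alpha H Om"
    and "antipode H a * canonical_w H = canonical_w H * St a"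
proof -
  note 1 = antipode_along_id and 2 = antipode_along_conj
  define w where "w = comparison (antipode H) (alpha H) (\<lambda>x. x) beta_untwisted St"
  note m = act_mult[OF conj_antipode_antihom] and mS = act_mult[OF antipode_antihom]
  have inv: "has_inverse w"
    unfolding has_inverse_def w_def
    using comparison_inverse[OF 1 2] comparison_inverse[OF 2 1] by blast
  have i: "antipode H c * w = w * St c" for c
    unfolding w_def by (rule comparison_intertwines[OF 1 2])
  have a: "w * alpha_untwisted = alpha H"
    unfolding w_def by (rule comparison_alpha[OF 1 2])
  have b: "beta H * w = beta_untwisted"
    unfolding w_def by (rule comparison_beta[OF 1 2])
  have ac: "alpha_conj = alpha_act St alpha_untwisted Omi"
    by (simp add: alpha_untwisted_def m(3) Om_simps flip: m(1))
  have bc: "beta_conj = beta_act St beta_untwisted Om"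
    by (simp add: beta_untwisted_def m(4) Om_simps flip: m(2))
  have wa: "w * alpha_conj = twist_alpha H Om"
    unfolding ac twist_alpha_act act_transport(1)[OF clinear_St clinear_antipode i] a ..
  have wb: "twist_beta H Om * w = beta_conj"
    unfolding bc twist_beta_act act_transport(2)[OF clinear_St clinear_antipode i] b ..
  have "canonical_w H = w"
    unfolding canonical_w_def
  proof (rule the_equality)
    show "has_inverse w \<and> w * alpha_conj = twist_alpha H Om \<and> twist_beta H Om * w = beta_conj
      \<and> (\<forall>a. antipode H a = w * St a * inv_el w)"
      using inv i wa wb by (simp add: inverse_intertwine)
  next
    fix u
    assume "has_inverse u \<and> u * alpha_conj = twist_alpha H Om \<and> twist_beta H Om * u = beta_conj
      \<and> (\<forall>a. antipode H a = u * St a * inv_el u)"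
    then have u: "u * alpha_conj = twist_alpha H Om" and ui: "\<And>a. antipode H a * u = u * St a"
      using inverse_intertwine by blast+
    have "u * alpha_untwisted = alpha_act (antipode H) (twist_alpha H Om) Om"
      unfolding alpha_untwisted_def act_transport(1)[OF clinear_St clinear_antipode ui] u ..
    also have "\<dots> = alpha H"
      by (simp add: twist_alpha_act mS(3) Om_simps flip: mS(1))
    finally show "u = w"
      unfolding w_def by (intro comparison_unique[OF 1 2] ui)
  qed
  with inv i wa show "has_inverse (canonical_w H)" "canonical_w H * alpha_conj = twist_alpha H Om"
    "antipode H a * canonical_w H = canonical_w H * St a"
    by simp_all
qed

end

section \<open>The star-canonical elements of the twisted algebras\<close>

lemma flip_mult: "flip (s * t) = flip s * flip t"
  for s t :: "'a::complex_algebra_1 \<otimes> 'b::complex_algebra_1"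
  by (rule tensor_ext22[where f="\<lambda>s t. flip (s * t)" and g="\<lambda>s t. flip s * flip t"])
    (intro lin | simp add: pure_mult_pure)+

context quasi_hopf_star_algebra
begin

lemma gamma_map_alpha_act:
  "gamma_map (mlift leg41 leg44 s * (mlift leg42 leg43 t * (y1 \<otimes> y2 \<otimes> y3 \<otimes> y4)))
    = (antipode H y2 * alpha_act (antipode H) (alpha H) t * y3)
      \<otimes> (antipode H y1 * alpha_act (antipode H) (alpha H) s * y4)"
proof -
  note L = lin leg4_linear act_linear(1)[OF clinear_antipode] act_linear(1)[OF clinear_antipode, THEN clinear_compose]
  show ?thesis
    by (rule tensor_ext22[where f="\<lambda>s t. gamma_map (mlift leg41 leg44 s * (mlift leg42 leg43 t * (y1 \<otimes> y2 \<otimes> y3 \<otimes> y4)))"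
          and g="\<lambda>s t. (antipode H y2 * alpha_act (antipode H) (alpha H) t * y3)
            \<otimes> (antipode H y1 * alpha_act (antipode H) (alpha H) s * y4)"])
      (intro L | simp add: mlift_pure leg4_linear
        | simp add: leg4_defs pure_mult_pure gamma_map_pure act_linear clinear_antipode S_simps mult.assoc)+
qed

text \<open>Under \<open>S\<^sup>-\<^sup>1 \<otimes> S\<^sup>-\<^sup>1\<close>, the flip and conjugation, the coevaluation \<open>\<gamma>'\<close> becomes the element \<open>\<gamma>\<close> of the
conjugate structure. Multiplied
by \<open>w \<otimes> w\<close>, it contains \<open>S\<close> and \<open>\<alpha>\<^sub>\<Omega>\<close> in the place of \<open>St\<close> and \<open>alpha_conj\<close>; and \<open>\<alpha>\<^sub>\<Omega>\<close> is \<open>\<alpha>\<close> after the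
action of \<open>\<Omega>\<^sup>-\<^sup>1\<close>, once on the outer pair of legs and once on the inner one.\<close>

lemma conj_gamma_bar_map:
  assumes i: "\<And>a. antipode H a * w = w * St a" and a: "w * alpha_conj = twist_alpha H Om"
  shows "(w \<otimes> w) * conj2 H (antipode_inv2 (gamma_bar_map T))
    = gamma_map (mlift leg41 leg44 Omi * (mlift leg42 leg43 Omi * conj4 T))"
proof (rule additive_ext4[where t=T and f="\<lambda>T. (w \<otimes> w) * conj2 H (antipode_inv2 (gamma_bar_map T))"
      and g="\<lambda>T. gamma_map (mlift leg41 leg44 Omi * (mlift leg42 leg43 Omi * conj4 T))"])
  fix t1 t2 t3 t4
  have "w * conj_op H (inv (antipode H) (x * beta H * antipode H y))
      = antipode H (conj_op H x) * twist_alpha H Om * conj_op H y" for x y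
  proof -
    have "conj_op H (inv (antipode H) (x * beta H * antipode H y)) = St (conj_op H x) * alpha_conj * conj_op H y"
      by (simp add: Sinv_simps conj_simps conj_antipode_def mult.assoc)
    then have "w * conj_op H (inv (antipode H) (x * beta H * antipode H y))
        = (w * St (conj_op H x)) * alpha_conj * conj_op H y"
      by (simp add: mult.assoc)
    then show ?thesis
      by (simp add: mult.assoc a flip: i)
  qed
  then show "(w \<otimes> w) * conj2 H (antipode_inv2 (gamma_bar_map (t1 \<otimes> t2 \<otimes> t3 \<otimes> t4)))
    = gamma_map (mlift leg41 leg44 Omi * (mlift leg42 leg43 Omi * conj4 (t1 \<otimes> t2 \<otimes> t3 \<otimes> t4)))"
    by (simp add: gamma_bar_map_pure antipode_inv2_pure conj_pure gamma_map_alpha_act pure_mult_pure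
        flip: twist_alpha_act)
qed (simp_all add: conj_add clinear_add[OF clinear_gamma_bar_map] clinear_add[OF clinear_gamma_map]
      clinear_add[OF clinear_antipode_inv2] distrib_left)

lemma conj4_comult_fst:
  "conj4 (comult_fst H X) = mlift leg41 leg42 Om * comult_fst H (conj3 H X) * mlift leg41 leg42 Omi"
proof (rule additive_eq_on_tensors[where x=X and f="\<lambda>X. conj4 (comult_fst H X)"
      and g="\<lambda>X. mlift leg41 leg42 Om * comult_fst H (conj3 H X) * mlift leg41 leg42 Omi"])
  have add: "comult_fst H (x + y) = comult_fst H x + comult_fst H (y :: 'h \<otimes> 'h \<otimes> 'h)" for x y
    by (rule clinear_add[OF clinear_comult_fst_of[OF clinear_ident]])
  show "conj4 (comult_fst H (x + y)) = conj4 (comult_fst H x) + conj4 (comult_fst H y)" for x y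
    by (simp add: add conj_add)
  show "mlift leg41 leg42 Om * comult_fst H (conj3 H (x + y)) * mlift leg41 leg42 Omi
      = mlift leg41 leg42 Om * comult_fst H (conj3 H x) * mlift leg41 leg42 Omi
      + mlift leg41 leg42 Om * comult_fst H (conj3 H y) * mlift leg41 leg42 Omi" for x y
    by (simp add: add conj_add distrib_left distrib_right)
  fix a t
  have r: "reassoc (s \<otimes> t) = mlift leg41 leg42 s * mlift leg43 leg44 t" for s t :: "'h \<otimes> 'h"
    by (rule tensor_ext22[where f="\<lambda>s t. reassoc (s \<otimes> t)"
          and g="\<lambda>s t. mlift leg41 leg42 s * mlift leg43 leg44 t"])
      (intro lin leg4_linear | simp add: leg4_mlift2 pure_mult_pure)+
  have c: "conj4 (reassoc (s \<otimes> t)) = reassoc (conj2 H s \<otimes> conj2 H t)" for s t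
    by (rule additive_eq_on_tensors[where x=s and f="\<lambda>s. conj4 (reassoc (s \<otimes> t))"
          and g="\<lambda>s. reassoc (conj2 H s \<otimes> conj2 H t)"])
      (simp_all add: conj_add pure_add_left conj_pure clinear_add[OF clinear_reassoc_of[OF clinear_ident]])
  have m: "algebra_hom (mlift leg41 leg42 :: 'h \<otimes> 'h \<Rightarrow> _)" by (intro legs)
  have "commuting (mlift leg41 leg42 :: 'h \<otimes> 'h \<Rightarrow> _) (mlift leg43 leg44 :: 'h \<otimes> 'h \<Rightarrow> _)"
    by (intro legs)
  then have k: "mlift leg41 leg42 s * mlift leg43 leg44 t = mlift leg43 leg44 t * mlift leg41 leg42 s" for s t :: "'h \<otimes> 'h"
    by (simp add: commuting_def)
  have "conj4 (comult_fst H (a \<otimes> t)) = reassoc (conj2 H (comult H a) \<otimes> conj2 H t)"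
    by (simp add: comult_fst_pure c)
  also have "\<dots> = mlift leg41 leg42 Om * mlift leg41 leg42 (comult H (conj_op H a))
      * (mlift leg41 leg42 Omi * mlift leg43 leg44 (conj2 H t))"
    by (simp add: comult_conj r hom_mult[OF m] mult.assoc)
  also have "\<dots> = mlift leg41 leg42 Om * comult_fst H (conj3 H (a \<otimes> t)) * mlift leg41 leg42 Omi"
    by (simp add: conj_pure comult_fst_pure r k[of Omi] mult.assoc)
  finally show "conj4 (comult_fst H (a \<otimes> t))
    = mlift leg41 leg42 Om * comult_fst H (conj3 H (a \<otimes> t)) * mlift leg41 leg42 Omi" .
qed

lemma conj4_tensor3_one: "conj4 (tensor3_one X) = tensor3_one (conj3 H X)"
proof -
  have p: "tensor3_one (a \<otimes> b \<otimes> c) = a \<otimes> b \<otimes> c \<otimes> 1" for a b c :: 'h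
    by (simp add: tensor3_one_def tensor_map_pure_linear clinear_id clinear_reassoc_of[OF clinear_ident])
  have "clinear (tensor3_one :: 'h \<otimes> 'h \<otimes> 'h \<Rightarrow> _)"
    unfolding tensor3_one_def[abs_def] by (intro lin clinear_id clinear_reassoc_of)
  note add = clinear_add[OF this]
  show ?thesis
    by (rule additive_ext3[where f="\<lambda>X. conj4 (tensor3_one X)"])
      (simp_all add: add p conj_add conj_pure conj_simps)
qed

text \<open>The transformation of \<open>\<gamma>\<close> under the twist by \<open>\<Omega>\<close>. In the word for the twisted \<open>\<gamma>\<close>, written with the
twisted associators, two pairs of factors cancel. The factors \<open>\<Omega>\<^sup>-\<^sup>1\<close> on \<open>23\<close> and \<open>14\<close> cancel factors at
the left end: the first one directly, the second one after the coproduct on \<open>23\<close> has been contracted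
twice. What remains is the word for \<open>\<gamma>\<close>, followed by \<open>\<Omega>\<^sup>-\<^sup>1\<close> on \<open>(12)(34)\<close>, on \<open>34\<close> and on \<open>12\<close>.\<close>

lemma conj_gamma_word:
  "gamma_map (mlift leg41 leg44 Omi * (mlift leg42 leg43 Omi
      * conj4 (comult_fst H (inv_el (coassociator H)) * tensor3_one (coassociator H))))
    = antipode2 Omi * tensor_lift (\<lambda>x y. antipode2 (comult H x) * drinfeld_gamma H * comult H y) Omi * Omi"
proof -
  let ?m = "\<lambda>f g. mlift f g :: 'h \<otimes> 'h \<Rightarrow> 'h \<otimes> 'h \<otimes> 'h \<otimes> 'h"
  let ?P = "Phi_inv leg41 leg42 leg43 :: 'h \<otimes> 'h \<otimes> 'h \<otimes> 'h"
  let ?Q = "Phi (conv leg41 leg42) leg43 leg44 :: 'h \<otimes> 'h \<otimes> 'h \<otimes> 'h"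
  let ?c12 = "conv leg41 leg42 :: 'h \<Rightarrow> 'h \<otimes> 'h \<otimes> 'h \<otimes> 'h"
  let ?c23 = "conv leg42 leg43 :: 'h \<Rightarrow> 'h \<otimes> 'h \<otimes> 'h \<otimes> 'h"
  let ?c34 = "conv leg43 leg44 :: 'h \<Rightarrow> 'h \<otimes> 'h \<otimes> 'h \<otimes> 'h"
  have cancel: "p * (q * r) = r" if "p * q = 1" for p q r :: "'h \<otimes> 'h \<otimes> 'h \<otimes> 'h"
    using that by (simp flip: mult.assoc)
  have "tensor3_one (conj3 H (coassociator H)) = mlift leg41 (mlift leg42 leg43) (conj3 H (coassociator H))"
    using mlift_tensor3_one[OF leg4_linear(1-3) leg4_hom(4), of "conj3 H (coassociator H)"]
    by (simp add: leg4_mlift)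
  also have "\<dots> = ?m leg42 leg43 Om * ?m leg41 ?c23 Om * ?P * ?m ?c12 leg43 Omi * ?m leg41 leg42 Omi"
    by (intro conj3_coassociator_legs legs)
  finally have 1: "tensor3_one (conj3 H (coassociator H))
    = ?m leg42 leg43 Om * ?m leg41 ?c23 Om * ?P * ?m ?c12 leg43 Omi * ?m leg41 leg42 Omi" .
  have "comult_fst H (twist_coassociator H Om) = mlift ?c12 (mlift leg43 leg44) (twist_coassociator H Om)"
    using mlift_comult_fst[OF leg4_linear(1,2) clinear_mlift[OF leg4_linear(3,4)], of "twist_coassociator H Om"]
    by (simp add: leg4_mlift)
  also have "\<dots> = ?m ?c12 leg43 Om * ?m (conv ?c12 leg43) leg44 Om * ?Q * ?m ?c12 ?c34 Omi * ?m leg43 leg44 Omi"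
    by (intro twist_coassociator_legs legs)
  finally have 2: "comult_fst H (twist_coassociator H Om)
    = ?m ?c12 leg43 Om * ?m (conv ?c12 leg43) leg44 Om * ?Q * ?m ?c12 ?c34 Omi * ?m leg43 leg44 Omi" .
  have k: "?m leg42 leg43 Omi * ?m leg42 leg43 Om = 1" "?m leg41 leg42 Omi * ?m leg41 leg42 Om = 1"
    "?m ?c12 leg43 Omi * ?m ?c12 leg43 Om = 1" "?m leg41 leg44 Omi * ?m leg41 leg44 Om = 1"
    by (intro twist_legs legs star_can_twist)+
  let ?R = "?P * ?Q * ?m ?c12 ?c34 Omi * (?m leg43 leg44 Omi * ?m leg41 leg42 Omi)"
  have "conj4 (comult_fst H (inv_el (coassociator H)) * tensor3_one (coassociator H))
     = tensor3_one (conj3 H (coassociator H))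
       * (?m leg41 leg42 Om * comult_fst H (twist_coassociator H Om) * ?m leg41 leg42 Omi)"
    by (simp add: conj_mult conj4_tensor3_one conj4_comult_fst conj3_coassociator_inv)
  then have "?m leg42 leg43 Omi * conj4 (comult_fst H (inv_el (coassociator H)) * tensor3_one (coassociator H))
     = ?m leg41 ?c23 Om * (?P * ?m (conv ?c12 leg43) leg44 Om * ?Q * ?m ?c12 ?c34 Omi
       * (?m leg43 leg44 Omi * ?m leg41 leg42 Omi))"
    by (simp add: 1 2 mult.assoc k k[THEN cancel])
  also have "?P * ?m (conv ?c12 leg43) leg44 Om = ?m (conv leg41 ?c23) leg44 Om * ?P"
    by (rule mlift_intertwine) (intro hom_linear legs Phi_inv_conv Phi_commutes)+
  finally have "gamma_map (?m leg41 leg44 Omi * (?m leg42 leg43 Omi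
      * conj4 (comult_fst H (inv_el (coassociator H)) * tensor3_one (coassociator H))))
    = gamma_map (?m leg41 leg44 Omi * (?m leg41 ?c23 Om * (?m (conv leg41 ?c23) leg44 Om * ?R)))"
    by (simp add: mult.assoc)
  also have "\<dots> = gamma_map (?m leg41 leg44 Omi * (?m leg41 eta Om * (?m (conv leg41 ?c23) leg44 Om * ?R)))"
  proof -
    have "commuting (?m leg41 leg44) ?c23" by (intro legs)
    then have l: "left_equiv (\<lambda>x. gamma_map (?m leg41 leg44 Omi * x)) ?c23 eta"
      by (intro left_equiv_shift gamma_left_contract) (simp_all add: commuting_def eta_mult)
    show ?thesis
      by (rule left_equivD[OF left_equiv_mlift2[OF l]]) (intro lin hom_linear legs)+
  qed
  also have "?m leg41 eta Om = 1"
    by (simp add: mlift_eta_right leg4_linear Om_simps hom_one legs)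
  also have "gamma_map (?m leg41 leg44 Omi * (1 * (?m (conv leg41 ?c23) leg44 Om * ?R)))
      = gamma_map (?m leg41 leg44 Omi * (?m (conv leg41 eta) leg44 Om * ?R))"
  proof -
    have "commuting (?m leg41 leg44) ?c23" by (intro legs)
    then have l: "left_equiv (\<lambda>x. gamma_map (?m leg41 leg44 Omi * x)) ?c23 eta"
      by (intro left_equiv_shift gamma_left_contract) (simp_all add: commuting_def eta_mult)
    have \<tau>: "clinear (\<lambda>x. gamma_map (?m leg41 leg44 Omi * x))"
      by (intro lin)
    show ?thesis
      unfolding mult_1_left
      by (rule left_equivD[OF left_equiv_mlift1[OF left_equiv_conv2[OF l \<tau>] \<tau>]]) (intro hom_linear legs)+
  qed
  also have "\<dots> = gamma_map ?R"
    by (simp add: conv_eta legs k[THEN cancel])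
  also have "\<dots>
    = antipode2 Omi * tensor_lift (\<lambda>x y. antipode2 (comult H x) * drinfeld_gamma H * comult H y) Omi * Omi"
  proof -
    have "commuting (?m leg43 leg44) (?m leg41 leg42)" by (intro legs)
    then have "?R = (?P * ?Q * ?m ?c12 ?c34 Omi) * (?m leg41 leg42 Omi * ?m leg43 leg44 Omi)"
      by (simp add: commuting_def)
    then show ?thesis
      by (simp only: gamma_map_outer gamma_map_conv drinfeld_gamma_legs)
  qed
  finally show ?thesis .
qed

text \<open>The hypotheses on \<open>w\<close> are those that \<open>canonical_w_properties\<close> provides. The element \<open>E\<close> comes from
conjugating the second Drinfeld twist, \<open>E'\<close> from twisting the first one by \<open>\<Omega>\<close>.\<close>

theorem star_can_drinfeld_twist2:
  fixes w :: 'h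
  assumes winv: "has_inverse w" and a: "w * alpha_conj = twist_alpha H Om"
    and i: "\<And>a. antipode H a * w = w * St a"
  shows "inv_el (conj2 H (drinfeld_twist2 H)) * Om
    = (inv_el w \<otimes> inv_el w) * antipode2 Omi * drinfeld_twist H * comult H w"
proof -
  let ?F = "drinfeld_twist H" and ?G = "drinfeld_twist2 H" and ?S = "antipode H"
  let ?Fd = "conj2 H ?G" and ?wi = "inv_el w"
  note w = inv_el_left[OF winv] inv_el_right[OF winv]
  note A = antihom_mult[OF antipode2_antihom] antihom_one[OF antipode2_antihom]
  note D = hom_mult[OF comult_hom] hom_one[OF comult_hom]
  have "conj2 H (?G * inv_el ?G) = 1" "conj2 H (inv_el ?G * ?G) = 1"
    by (simp_all add: inv_el_left inv_el_right drinfeld_twist2_inverse conj_one)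
  then have "has_inverse ?Fd"
    unfolding has_inverse_def conj_mult by blast
  note Fd = inv_el_left[OF this] inv_el_right[OF this]
  define E where "E = (w \<otimes> w) * inv_el ?Fd * Om * comult H ?wi"
  define E' where "E' = antipode2 Omi * ?F"
  let ?\<sigma> = "\<lambda>a. antipode2 (Om * comult H a * Omi)"
  have E'_i: "E' * comult H (?S c) = ?\<sigma> c * E'" for c
  proof -
    have "E' * comult H (?S c) = antipode2 (comult H c * Omi) * ?F"
      by (simp add: E'_def mult.assoc A flip: drinfeld_twist_properties(2))
    also have "comult H c * Omi = Omi * (Om * comult H c * Omi)"
      by (simp add: Om_simps flip: mult.assoc)
    finally show ?thesis by (simp add: E'_def A(1)[of Omi] mult.assoc)
  qed
  have ww: "(w \<otimes> w) * conj2 H (antipode_inv2 t) = antipode2 (conj2 H t) * (w \<otimes> w)" for t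
  proof (rule additive_eq_on_tensors[where x=t and f="\<lambda>t. (w \<otimes> w) * conj2 H (antipode_inv2 t)"
        and g="\<lambda>t. antipode2 (conj2 H t) * (w \<otimes> w)"])
    fix x y
    have "w * conj_op H (inv ?S b) = ?S (conj_op H b) * w" for b
      using i[of "conj_op H b"] by (simp add: conj_antipode_def conj_simps)
    then show "(w \<otimes> w) * conj2 H (antipode_inv2 (x \<otimes> y)) = antipode2 (conj2 H (x \<otimes> y)) * (w \<otimes> w)"
      by (simp add: antipode_inv2_pure antipode2_pure conj_pure pure_mult_pure)
  qed (simp_all add: conj_add clinear_add[OF clinear_antipode2] clinear_add[OF clinear_antipode_inv2]
      distrib_left distrib_right)
  have tw: "Om * comult H b = conj2 H (comult H (conj_op H b)) * Om" for b
    by (simp add: conj2_comult mult.assoc Om_simps)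
  \<comment> \<open>Conjugate of the intertwining property of the second Drinfeld twist.\<close>
  have move: "inv_el ?Fd * conj2 H (comult H b) = conj2 H (antipode_inv2 (comult H (?S b))) * inv_el ?Fd" for b
  proof -
    have "?Fd * conj2 H (antipode_inv2 (comult H (?S b))) = conj2 H (comult H b) * ?Fd"
      using drinfeld_twist2_intertwines[of b] by (simp flip: conj_mult)
    then have "inv_el ?Fd * (?Fd * conj2 H (antipode_inv2 (comult H (?S b)))) * inv_el ?Fd
        = inv_el ?Fd * (conj2 H (comult H b) * ?Fd) * inv_el ?Fd"
      by simp
    then show ?thesis
      by (simp add: mult.assoc Fd) (simp add: Fd flip: mult.assoc)
  qed
  have E_i: "E * comult H (?S c) = ?\<sigma> c * E" for c
  proof -
    have "?wi * ?S c = ?wi * (?S c * w) * ?wi"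
      by (simp add: mult.assoc w)
    also have "\<dots> = St c * ?wi"
      by (simp add: i w flip: mult.assoc)
    finally have "comult H ?wi * comult H (?S c) = comult H (St c) * comult H ?wi"
      by (simp flip: D)
    then have "E * comult H (?S c) = (w \<otimes> w) * inv_el ?Fd * (Om * comult H (St c)) * comult H ?wi"
      by (simp add: E_def mult.assoc)
    also have "Om * comult H (St c) = conj2 H (comult H (inv ?S (conj_op H c))) * Om"
      by (simp add: tw conj_antipode_def conj_simps)
    also have "(w \<otimes> w) * inv_el ?Fd * (conj2 H (comult H (inv ?S (conj_op H c))) * Om) * comult H ?wi
        = (w \<otimes> w) * (inv_el ?Fd * conj2 H (comult H (inv ?S (conj_op H c)))) * Om * comult H ?wi"
      by (simp add: mult.assoc)
    also have "\<dots> = ((w \<otimes> w) * conj2 H (antipode_inv2 (comult H (conj_op H c)))) * inv_el ?Fd * Om * comult H ?wi"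
      by (simp add: move Sinv_simps mult.assoc)
    also have "\<dots> = ?\<sigma> c * E"
      by (simp only: ww conj2_comult E_def mult.assoc)
    finally show ?thesis .
  qed
  \<comment> \<open>The two elements agree on \<open>\<Delta>(\<alpha>\<^sub>\<Omega>)\<close>: for \<open>E\<close> this is the conjugate of the relation between \<open>\<gamma>'\<close>
       and the second Drinfeld twist, for \<open>E'\<close> it is \<open>F \<Delta>(\<alpha>) = \<gamma>\<close>, and \<open>conj_gamma_word\<close>
       identifies the results.\<close>
  have "E * comult H (twist_alpha H Om) = (w \<otimes> w) * inv_el ?Fd * (Om * comult H alpha_conj)"
  proof -
    have "?wi * twist_alpha H Om = alpha_conj"
      by (simp add: w flip: a mult.assoc)
    then have "comult H ?wi * comult H (twist_alpha H Om) = comult H alpha_conj"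
      by (simp flip: D)
    then show ?thesis by (simp add: E_def mult.assoc)
  qed
  also have "Om * comult H alpha_conj = ?Fd * conj2 H (antipode_inv2 gamma_bar) * Om"
    by (simp add: tw conj_simps flip: drinfeld_twist2_beta conj_mult)
  also have "(w \<otimes> w) * inv_el ?Fd * (?Fd * conj2 H (antipode_inv2 gamma_bar) * Om)
      = (w \<otimes> w) * conj2 H (antipode_inv2 gamma_bar) * Om"
    by (simp add: mult.assoc) (simp add: Fd flip: mult.assoc[of "inv_el ?Fd"])
  also have "\<dots> = antipode2 Omi * tensor_lift (\<lambda>x y. antipode2 (comult H x) * drinfeld_gamma H * comult H y) Omi"
    by (simp add: gamma_bar_def conj_gamma_bar_map[OF i a] conj_gamma_word mult.assoc Om_simps)
  also have "antipode2 Omi * tensor_lift (\<lambda>x y. antipode2 (comult H x) * drinfeld_gamma H * comult H y) Omi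
      = E' * comult H (twist_alpha H Om)"
  proof -
    have "tensor_lift (\<lambda>x y. antipode2 (comult H x) * drinfeld_gamma H * comult H y) t
        = ?F * comult H (alpha_act ?S (alpha H) t)" for t
    proof (rule tensor_ext[where g="\<lambda>t. ?F * comult H (alpha_act ?S (alpha H) t)"])
      fix x y
      have "?F * comult H (?S x * alpha H * y) = antipode2 (comult H x) * (?F * comult H (alpha H)) * comult H y"
        by (simp add: D flip: mult.assoc drinfeld_twist_properties(2))
      then show "tensor_lift (\<lambda>x y. antipode2 (comult H x) * drinfeld_gamma H * comult H y) (x \<otimes> y)
        = ?F * comult H (alpha_act ?S (alpha H) (x \<otimes> y))"
        by (subst lift_pure)
          (intro lin clinear_comult
            | simp add: act_linear clinear_antipode drinfeld_twist_properties(3))+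
    qed (intro lin clinear_comult act_linear clinear_antipode clinear_compose[OF act_linear(1)])+
    then show ?thesis
      by (simp add: E'_def twist_alpha_act mult.assoc)
  qed
  finally have on_twisted: "E * comult H (twist_alpha H Om) = E' * comult H (twist_alpha H Om)" .
  \<comment> \<open>By the intertwining property they then agree on \<open>\<Delta>(\<alpha>)\<close>, since \<open>\<alpha>\<close> is \<open>\<alpha>\<^sub>\<Omega>\<close> acted on by \<open>\<Omega>\<close>.\<close>
  have "E * comult H (alpha_act ?S (twist_alpha H Om) t) = E' * comult H (alpha_act ?S (twist_alpha H Om) t)" for t
  proof (rule tensor_ext[where f="\<lambda>t. E * comult H (alpha_act ?S (twist_alpha H Om) t)"
        and g="\<lambda>t. E' * comult H (alpha_act ?S (twist_alpha H Om) t)"])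
    fix x y
    have "e * comult H (?S x * twist_alpha H Om * y) = ?\<sigma> x * (e * comult H (twist_alpha H Om)) * comult H y"
      if "e * comult H (?S x) = ?\<sigma> x * e" for e
      using that by (simp add: D flip: mult.assoc)
    from this[OF E_i] this[OF E'_i]
    show "E * comult H (alpha_act ?S (twist_alpha H Om) (x \<otimes> y))
      = E' * comult H (alpha_act ?S (twist_alpha H Om) (x \<otimes> y))"
      by (simp add: act_linear clinear_antipode on_twisted)
  qed (intro lin clinear_comult act_linear clinear_antipode clinear_compose[OF act_linear(1)])+
  from this[of Om] have on_alpha: "E * comult H (alpha H) = E' * comult H (alpha H)"
    by (simp add: twist_alpha_act Om_simps act_mult(3)[OF antipode_antihom] flip: act_mult(1)[OF antipode_antihom])
  have A1: "antipode2 Om * antipode2 Omi = 1" "antipode2 Omi * antipode2 Om = 1"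
    by (simp_all add: Om_simps A flip: A(1))
  have "antipode2 Om * E = ?F"
    unfolding drinfeld_twist_comparison
  proof (rule comparison_unique[OF antipode_along_drinfeld antipode_along_antipode[OF comult_hom]])
    fix c
    have "antipode2 (comult H c) * antipode2 Om = antipode2 Om * ?\<sigma> c"
      by (simp add: mult.assoc Om_simps flip: A(1))
    then have "antipode2 (comult H c) * (antipode2 Om * E) = antipode2 Om * (?\<sigma> c * E)"
      by (simp flip: mult.assoc)
    then show "antipode2 (comult H c) * (antipode2 Om * E) = antipode2 Om * E * comult H (?S c)"
      by (simp only: E_i mult.assoc)
  next
    have "antipode2 Om * E * comult H (alpha H) = antipode2 Om * antipode2 Omi * (?F * comult H (alpha H))"
      by (simp add: on_alpha E'_def mult.assoc)
    then show "antipode2 Om * E * comult H (alpha H) = drinfeld_gamma H"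
      by (simp add: A1 drinfeld_twist_properties)
  qed
  then have "antipode2 Omi * antipode2 Om * E = antipode2 Omi * ?F"
    by (simp only: mult.assoc)
  then have "E = antipode2 Omi * ?F"
    by (simp add: A1)
  moreover have "(?wi \<otimes> ?wi) * E * comult H w = inv_el ?Fd * Om"
  proof -
    have "(?wi \<otimes> ?wi) * (w \<otimes> w) = 1" by (simp add: pure_mult_pure w one_tensor_def)
    moreover have "comult H ?wi * comult H w = 1" by (simp add: w D flip: D(1))
    ultimately show ?thesis
      by (simp add: E_def mult.assoc) (simp flip: mult.assoc)
  qed
  ultimately show ?thesis by (simp add: mult.assoc)
qed

text \<open>The second formula under \<open>S\<^sup>-\<^sup>1 \<otimes> S\<^sup>-\<^sup>1\<close> and the flip. The conjugate of the second Drinfeld twist becomes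
that of the first one conjugated by \<open>S\<^sup>-\<^sup>1(w) \<otimes> S\<^sup>-\<^sup>1(w)\<close>, because \<open>S\<^sup>-\<^sup>1 St\<close> is conjugation by
\<open>S\<^sup>-\<^sup>1(w)\<close>; and the coproduct of \<open>w\<close> is moved past \<open>F\<^sub>0\<close> by its intertwining property.\<close>

theorem star_can_drinfeld_twist:
  fixes w :: 'h
  assumes winv: "has_inverse w" and a: "w * alpha_conj = twist_alpha H Om"
    and i: "\<And>a. antipode H a * w = w * St a"
  shows "inv_el (conj2 H (drinfeld_twist H)) * Om
    = (inv (antipode H) (inv_el w) \<otimes> inv (antipode H) (inv_el w)) * antipode_inv2 Omi
      * drinfeld_twist2 H * comult H (inv (antipode H) w)"
proof -
  let ?F = "drinfeld_twist H" and ?G = "drinfeld_twist2 H" and ?Si = "inv (antipode H)"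
  let ?Fd = "conj2 H ?G" and ?K = "conj2 H ?F"
  define v v' where "v = ?Si w" and "v' = ?Si (inv_el w)"
  note w = inv_el_left[OF winv] inv_el_right[OF winv]
  have v: "v * v' = 1" "v' * v = 1"
    by (simp_all add: v_def v'_def w Sinv_simps flip: Sinv_simps(1))
  have vv: "(v \<otimes> v) * (v' \<otimes> v') = 1" "(v' \<otimes> v') * (v \<otimes> v) = 1"
    by (simp_all add: pure_mult_pure v one_tensor_def)
  note A = antihom_mult[OF antipode_inv2_antihom] antihom_one[OF antipode_inv2_antihom]
  have K: "?K * inv_el ?K = 1" "inv_el ?K * ?K = 1" and Fd: "?Fd * inv_el ?Fd = 1" "inv_el ?Fd * ?Fd = 1"
  proof -
    have "conj2 H (?F * inv_el ?F) = 1" "conj2 H (inv_el ?F * ?F) = 1"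
      "conj2 H (?G * inv_el ?G) = 1" "conj2 H (inv_el ?G * ?G) = 1"
      by (simp_all add: inv_el_left inv_el_right drinfeld_twist2_inverse drinfeld_twist_properties conj_one)
    then have "has_inverse ?K" "has_inverse ?Fd"
      unfolding has_inverse_def conj_mult by blast+
    then show "?K * inv_el ?K = 1" "inv_el ?K * ?K = 1" "?Fd * inv_el ?Fd = 1" "inv_el ?Fd * ?Fd = 1"
      by (simp_all add: inv_el_left inv_el_right)
  qed
  have "antipode_inv2 (conj2 H (antipode_inv2 t)) = (v \<otimes> v) * conj2 H t * (v' \<otimes> v')" for t
  proof (rule additive_eq_on_tensors[where x=t and f="\<lambda>t. antipode_inv2 (conj2 H (antipode_inv2 t))"
        and g="\<lambda>t. (v \<otimes> v) * conj2 H t * (v' \<otimes> v')"])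
    fix x y
    have "?Si (conj_op H (?Si b)) = v * conj_op H b * v'" for b
    proof -
      have "conj_op H (?Si b) = inv_el w * antipode H (conj_op H b) * w"
        using i[of "conj_op H b"] by (simp add: conj_antipode_def conj_simps mult.assoc) (simp add: w flip: mult.assoc)
      then show ?thesis by (simp add: Sinv_simps v_def v'_def mult.assoc)
    qed
    then show "antipode_inv2 (conj2 H (antipode_inv2 (x \<otimes> y))) = (v \<otimes> v) * conj2 H (x \<otimes> y) * (v' \<otimes> v')"
      by (simp add: antipode_inv2_pure conj_pure pure_mult_pure)
  qed (simp_all add: conj_add clinear_add[OF clinear_antipode_inv2] distrib_left distrib_right)
  then have "antipode_inv2 ?Fd = (v \<otimes> v) * ?K * (v' \<otimes> v')"
    by (simp add: drinfeld_twist2_image)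
  moreover have "antipode_inv2 ?Fd * antipode_inv2 (inv_el ?Fd) = 1"
    by (simp add: Fd A(2) flip: A(1))
  ultimately have "(v \<otimes> v) * ?K * (v' \<otimes> v') * antipode_inv2 (inv_el ?Fd) = 1"
    by simp
  moreover have "(v \<otimes> v) * inv_el ?K * (v' \<otimes> v') * ((v \<otimes> v) * ?K * (v' \<otimes> v')) = 1"
  proof -
    have "(v \<otimes> v) * inv_el ?K * (v' \<otimes> v') * ((v \<otimes> v) * ?K * (v' \<otimes> v'))
      = (v \<otimes> v) * (inv_el ?K * (((v' \<otimes> v') * (v \<otimes> v)) * ?K)) * (v' \<otimes> v')"
      by (simp only: mult.assoc)
    then show ?thesis by (simp add: vv K)
  qed
  ultimately have inv: "antipode_inv2 (inv_el ?Fd) = (v \<otimes> v) * inv_el ?K * (v' \<otimes> v')"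
    by (rule inv_el_unique)
  have "antipode_inv2 Om * antipode_inv2 (inv_el ?Fd)
    = antipode_inv2 ((inv_el w \<otimes> inv_el w) * antipode2 Omi * ?F * comult H w)"
    by (simp add: star_can_drinfeld_twist2[OF assms, symmetric] A)
  also have "\<dots> = antipode_inv2 (comult H w) * ?G * Omi * (v' \<otimes> v')"
    by (simp add: A antipode_inv2_antipode2 antipode_inv2_pure drinfeld_twist2_image v'_def mult.assoc)
  also have "antipode_inv2 (comult H w) * ?G = ?G * comult H v"
    using drinfeld_twist2_intertwines[of v] by (simp add: v_def Sinv_simps)
  finally have eq: "antipode_inv2 Om * ((v \<otimes> v) * inv_el ?K * (v' \<otimes> v')) = ?G * comult H v * Omi * (v' \<otimes> v')"
    unfolding inv .
  have A1: "antipode_inv2 Omi * antipode_inv2 Om = 1"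
    by (simp add: Om_simps A flip: A(1))
  have "inv_el ?K * Om = ((v' \<otimes> v') * (v \<otimes> v)) * inv_el ?K * ((v' \<otimes> v') * (v \<otimes> v)) * Om"
    by (simp add: vv)
  also have "\<dots> = (v' \<otimes> v') * (antipode_inv2 Omi * antipode_inv2 Om) * ((v \<otimes> v) * inv_el ?K * (v' \<otimes> v')) * (v \<otimes> v) * Om"
    by (simp add: A1 mult.assoc)
  also have "\<dots> = (v' \<otimes> v') * antipode_inv2 Omi * (antipode_inv2 Om * ((v \<otimes> v) * inv_el ?K * (v' \<otimes> v'))) * (v \<otimes> v) * Om"
    by (simp only: mult.assoc)
  also have "\<dots> = (v' \<otimes> v') * antipode_inv2 Omi * ?G * comult H v * (Omi * (((v' \<otimes> v') * (v \<otimes> v)) * Om))"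
    unfolding eq by (simp only: mult.assoc)
  also have "\<dots> = (v' \<otimes> v') * antipode_inv2 Omi * ?G * comult H v"
    by (simp add: vv Om_simps)
  finally show ?thesis by (simp add: v_def v'_def)
qed

end

theorem proposition9:
  fixes H :: "'h::complex_algebra_1 qhsa"
  assumes "quasi_hopf_star_algebra H"
  defines "S \<equiv> antipode H"
    and "\<Omega> \<equiv> star_can H"
    and "F\<^sub>\<delta> \<equiv> drinfeld_twist H"
    and "F\<^sub>0 \<equiv> drinfeld_twist2 H"
    and "w \<equiv> canonical_w H"
  shows "star_can (twist_qhsa F\<^sub>\<delta> H) =
      (inv S (inv_el w) \<otimes> inv S (inv_el w))
        * tensor_map (inv S) (inv S) (inv_el (flip \<Omega>))
        * F\<^sub>0 * comult H (inv S w) * inv_el F\<^sub>\<delta>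
    \<and> star_can (twist_qhsa F\<^sub>0 H) =
      (inv_el w \<otimes> inv_el w)
        * tensor_map S S (inv_el (flip \<Omega>))
        * F\<^sub>\<delta> * comult H w * inv_el F\<^sub>0"
proof -
  interpret quasi_hopf_star_algebra H by fact
  have "inv_el (flip Om) = flip Omi"
    by (rule inv_el_eqI) (simp_all add: Om_simps one_tensor_def flip: flip_mult)
  then have "tensor_map (inv S) (inv S) (inv_el (flip \<Omega>)) = antipode_inv2 Omi"
    "tensor_map S S (inv_el (flip \<Omega>)) = antipode2 Omi"
    by (simp_all add: S_def \<Omega>_def antipode_inv2_def antipode2_def)
  moreover have "star_can (twist_qhsa F H) = inv_el (conj2 H F) * Om * inv_el F" for F
    by (simp add: twist_qhsa_def)
  ultimately show ?thesis
    using star_can_drinfeld_twist[OF canonical_w_properties] star_can_drinfeld_twist2[OF canonical_w_properties]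
    by (simp add: S_def w_def F\<^sub>\<delta>_def F\<^sub>0_def)
qed

end
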